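(* Let $(\Gamma,\Lambda)$ be a matched pair of discrete groups, let $\mathscr B=(B,p)$ be a Fell bundle over $\Gamma$ whose unit fibre $\mathscr B_e$ is a unital $C^*$-algebra, and let $\beta$ be a $(\Gamma,\Lambda)$-compatible $\Lambda$-action on $\mathscr B$. Let $i\colon C^*(\mathscr B)\to C^*(\mathscr B\bowtie_\beta\Lambda)$ be the canonical map, i.e. the extension of the map on finitely supported sections given by $i(\sigma)(x,h)=(\sigma(x),e)$ if $h=e$ and $i(\sigma)(x,h)=(0_x,h)$ if $h\ne e$. Then $i$ is an injective $*$-homomorphism.
   Context: Matched pair of discrete groups. Discrete groups $\Gamma,\Lambda$ with maps $\Lambda\times\Gamma\to\Gamma$, $(h,x)\mapsto h\cdot x$, and $\Lambda\times\Gamma\to\Lambda$, $(h,x)\mapsto h|_x$, such that $(h_1h_2)\cdot x=h_1\cdot(h_2\cdot x)$; $e\cdot x=x$; $h|_{xy}=(h|_x)|_y$; $h|_e=h$; $h\cdot(xy)=(h\cdot x)(h|_x\cdot y)$; $(h_1h_2)|_x=h_1|_{h_2\cdot x}\,h_2|_x$. Zappa-Szép product. $\Gamma\bowtie\Lambda=\Gamma\times\Lambda$ as a set, with $(x,h)(y,g)=(x(h\cdot y),h|_yg)$ and $(x,h)^{-1}=(h^{-1}\cdot x^{-1},h^{-1}|_{x^{-1}})$; it is a discrete group. Fell bundle over a discrete group $\Gamma$. A disjoint union $B=\bigsqcup_{x\in\Gamma}\mathscr B_x$ of complex Banach spaces (with bundle map $p\colon B\to\Gamma$) with bilinear associative multiplications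 $\mathscr B_x\times\mathscr B_y\to\mathscr B_{xy}$, $\|ab\|\le\|a\|\|b\|$, and conjugate-linear involutions $\mathscr B_x\to\mathscr B_{x^{-1}}$, $b\mapsto b^*$, with $(ab)^*=b^*a^*$, $b^{**}=b$, $\|b^*b\|=\|b\|^2=\|b^*\|^2$, and $b^*b\ge0$ in the $C^*$-algebra $\mathscr B_e$. Compatible action. A $(\Gamma,\Lambda)$-compatible $\Lambda$-action on $\mathscr B$ is a continuous map $\beta\colon\Lambda\times B\to B$, $\beta_h(b)=\beta(h,b)$, such that $\beta_h$ maps $\mathscr B_x$ linearly into $\mathscr B_{h\cdot x}$; $\beta_{gh}=\beta_g\circ\beta_h$; $\beta_e=\mathrm{id}$; $\beta_h(bc)=\beta_h(b)\beta_{h|_{p(b)}}(c)$; $\beta_h(b)^*=\beta_{h|_{p(b)}}(b^* )$. Product bundle. $\mathscr B\bowtie_\beta\Lambda$ is the Fell bundle over $\Gamma\bowtie\Lambda$ with total space $B\times\Lambda$, fibre $\mathscr B_x\times\{h\}$ over $(x,h)$ with the Banach space structure of $\mathscr B_x$, multiplication $(a,g)(b,h)=(a\beta_g(b),g|_{p(b)}h)$ and involution $(b,h)^*=(\beta_{h^{-1}}(b^* ),h^{-1}|_{p(b)^{-1}})$. $C^*$-algebra. For a Fell bundle $\mathscr C$ over a discrete group $K$, the finitely supported sections form a $*$-algebra $\Gamma_c(K;\mathscr C)$ with $(\sigma\square\tau)(k)=\sum_{l\in K}\sigma(l)\tau(l^{-1}k)$ and $\sigma^*(k)=\sigma(k^{-1})^*$.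 $C^*(\mathscr C)$ is its completion in the norm $\sup\|L(\sigma)\|$ over all $*$-homomorphisms $L$ into the bounded operators of a Hilbert space with $\|L(\sigma)\|\le\sum_{k}\|\sigma(k)\|$. The map $i$ above is a $*$-algebra homomorphism on finitely supported sections that extends to the completions. *)

theory Defs
  imports "HOL-Analysis.Analysis" "HOL-Algebra.Module"
begin

text \<open>Complex vector spaces are modules over the field of complex numbers. A module record also
  has the slots \<open>mult\<close> and \<open>one\<close>, which the module axioms ignore.\<close>

definition complex_ring :: "complex ring" where
  "complex_ring = \<lparr>carrier = UNIV, mult = (*), one = 1, zero = 0, add = (+)\<rparr>"

definition cauchy_wrt :: "('v, 'm) ring_scheme \<Rightarrow> ('v \<Rightarrow> real) \<Rightarrow> (nat \<Rightarrow> 'v) \<Rightarrow> bool" where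
  "cauchy_wrt V N s \<longleftrightarrow> (\<forall>n. s n \<in> carrier V) \<and>
     (\<forall>\<epsilon>>0. \<exists>n\<^sub>0. \<forall>m\<ge>n\<^sub>0. \<forall>n\<ge>n\<^sub>0. N (s m \<ominus>\<^bsub>V\<^esub> s n) < \<epsilon>)"

locale complex_banach = Module.module complex_ring V for V (structure) +
  fixes N :: "'v \<Rightarrow> real"
  assumes norm_nonneg: "v \<in> carrier V \<Longrightarrow> 0 \<le> N v"
    and norm_eq_zero: "v \<in> carrier V \<Longrightarrow> N v = 0 \<longleftrightarrow> v = \<zero>"
    and norm_scale: "v \<in> carrier V \<Longrightarrow> N (c \<odot> v) = cmod c * N v"
    and norm_triangle: "u \<in> carrier V \<Longrightarrow> v \<in> carrier V \<Longrightarrow> N (u \<oplus> v) \<le> N u + N v"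
    and complete: "cauchy_wrt V N s \<Longrightarrow> \<exists>v\<in>carrier V. (\<lambda>n. N (s n \<ominus> v)) \<longlonglongrightarrow> 0"

record 'v hilbert = "(complex, 'v) module" +
  ip :: "'v \<Rightarrow> 'v \<Rightarrow> complex"

definition hnorm :: "('v, 'm) hilbert_scheme \<Rightarrow> 'v \<Rightarrow> real" where
  "hnorm H v = sqrt (Re (ip H v v))"

locale hilbert_space = Module.module complex_ring H for H :: "('v, 'm) hilbert_scheme" (structure) +
  assumes ip_add: "u \<in> carrier H \<Longrightarrow> v \<in> carrier H \<Longrightarrow> w \<in> carrier H \<Longrightarrow>
      ip H (u \<oplus> v) w = ip H u w + ip H v w"
    and ip_scale: "u \<in> carrier H \<Longrightarrow> v \<in> carrier H \<Longrightarrow> ip H (c \<odot> u) v = c * ip H u v"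
    and ip_cnj: "u \<in> carrier H \<Longrightarrow> v \<in> carrier H \<Longrightarrow> ip H u v = cnj (ip H v u)"
    and ip_pos: "v \<in> carrier H \<Longrightarrow> 0 \<le> Re (ip H v v)"
    and ip_definite: "v \<in> carrier H \<Longrightarrow> ip H v v = 0 \<Longrightarrow> v = \<zero>"
    and complete: "cauchy_wrt H (hnorm H) s \<Longrightarrow>
      \<exists>v\<in>carrier H. (\<lambda>n. hnorm H (s n \<ominus> v)) \<longlonglongrightarrow> 0"

definition bounded_operator :: "('v, 'm) hilbert_scheme \<Rightarrow> ('v \<Rightarrow> 'v) \<Rightarrow> bool" where
  "bounded_operator H T \<longleftrightarrow> T \<in> carrier H \<rightarrow> carrier H \<and>
     (\<forall>u\<in>carrier H. \<forall>v\<in>carrier H. T (u \<oplus>\<^bsub>H\<^esub> v) = T u \<oplus>\<^bsub>H\<^esub> T v) \<and>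
     (\<forall>c. \<forall>v\<in>carrier H. T (c \<odot>\<^bsub>H\<^esub> v) = c \<odot>\<^bsub>H\<^esub> T v) \<and>
     (\<exists>C. \<forall>v\<in>carrier H. hnorm H (T v) \<le> C * hnorm H v)"

definition operator_norm :: "('v, 'm) hilbert_scheme \<Rightarrow> ('v \<Rightarrow> 'v) \<Rightarrow> real" where
  "operator_norm H T = Sup {hnorm H (T v) | v. v \<in> carrier H \<and> hnorm H v \<le> 1}"

text \<open>The \<open>one\<close> slot of a star algebra is not used: the algebras need not be unital.\<close>

record 'v star_algebra = "(complex, 'v) module" +
  star :: "'v \<Rightarrow> 'v"
  nrm :: "'v \<Rightarrow> real"

definition star_hom :: "('v, 'm) star_algebra_scheme \<Rightarrow> ('w, 'n) star_algebra_scheme \<Rightarrow>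
    ('v \<Rightarrow> 'w) \<Rightarrow> bool" where
  "star_hom A A' f \<longleftrightarrow> f \<in> carrier A \<rightarrow> carrier A' \<and>
     (\<forall>a\<in>carrier A. \<forall>b\<in>carrier A. f (a \<oplus>\<^bsub>A\<^esub> b) = f a \<oplus>\<^bsub>A'\<^esub> f b) \<and>
     (\<forall>c. \<forall>a\<in>carrier A. f (c \<odot>\<^bsub>A\<^esub> a) = c \<odot>\<^bsub>A'\<^esub> f a) \<and>
     (\<forall>a\<in>carrier A. \<forall>b\<in>carrier A. f (a \<otimes>\<^bsub>A\<^esub> b) = f a \<otimes>\<^bsub>A'\<^esub> f b) \<and>
     (\<forall>a\<in>carrier A. f (star A a) = star A' (f a))"

text \<open>The completion consists of the classes of Cauchy sequences modulo null sequences (so a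
  seminorm is also made into a norm).\<close>

definition null_rel :: "('v, 'm) star_algebra_scheme \<Rightarrow> ((nat \<Rightarrow> 'v) \<times> (nat \<Rightarrow> 'v)) set" where
  "null_rel A = {(s, t). cauchy_wrt A (nrm A) s \<and> cauchy_wrt A (nrm A) t \<and>
     (\<lambda>n. nrm A (s n \<ominus>\<^bsub>A\<^esub> t n)) \<longlonglongrightarrow> 0}"

definition completion :: "('v, 'm) star_algebra_scheme \<Rightarrow> (nat \<Rightarrow> 'v) set star_algebra" where
  "completion A =
     \<lparr>carrier = {s. cauchy_wrt A (nrm A) s} // null_rel A,
      mult = (\<lambda>X Y. \<Union>s\<in>X. \<Union>t\<in>Y. null_rel A `` {\<lambda>n. s n \<otimes>\<^bsub>A\<^esub> t n}),
      one = undefined,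
      zero = null_rel A `` {\<lambda>n. \<zero>\<^bsub>A\<^esub>},
      add = (\<lambda>X Y. \<Union>s\<in>X. \<Union>t\<in>Y. null_rel A `` {\<lambda>n. s n \<oplus>\<^bsub>A\<^esub> t n}),
      smult = (\<lambda>c X. \<Union>s\<in>X. null_rel A `` {\<lambda>n. c \<odot>\<^bsub>A\<^esub> s n}),
      star = (\<lambda>X. \<Union>s\<in>X. null_rel A `` {\<lambda>n. star A (s n)}),
      nrm = (\<lambda>X. THE r. \<forall>s\<in>X. (\<lambda>n. nrm A (s n)) \<longlonglongrightarrow> r)\<rparr>"

definition to_completion :: "('v, 'm) star_algebra_scheme \<Rightarrow> 'v \<Rightarrow> (nat \<Rightarrow> 'v) set" where
  "to_completion A a = null_rel A `` {\<lambda>n. a}"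

text \<open>The extension by continuity of a bounded linear map \<open>f\<close>. For such \<open>f\<close> the classes in the
  union coincide.\<close>

definition extend_to_completion :: "('v, 'm) star_algebra_scheme \<Rightarrow> ('w, 'n) star_algebra_scheme \<Rightarrow>
    ('v \<Rightarrow> 'w) \<Rightarrow> (nat \<Rightarrow> 'v) set \<Rightarrow> (nat \<Rightarrow> 'w) set" where
  "extend_to_completion A A' f X = (\<Union>s\<in>X. null_rel A' `` {\<lambda>n. f (s n)})"

record ('x, 'b) bundle_data =
  total :: "'b set"
  proj :: "'b \<Rightarrow> 'x"
  bzero :: "'x \<Rightarrow> 'b"
  badd :: "'b \<Rightarrow> 'b \<Rightarrow> 'b"
  bscale :: "complex \<Rightarrow> 'b \<Rightarrow> 'b"
  bnorm :: "'b \<Rightarrow> real"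
  bmul :: "'b \<Rightarrow> 'b \<Rightarrow> 'b"
  bstar :: "'b \<Rightarrow> 'b"

definition fibre :: "('x, 'b) bundle_data \<Rightarrow> 'x \<Rightarrow> (complex, 'b) module" where
  "fibre B x = \<lparr>carrier = {b \<in> total B. proj B b = x}, mult = bmul B, one = undefined,
     zero = bzero B x, add = badd B, smult = bscale B\<rparr>"

text \<open>Positivity in the unit fibre: the positive elements of a C*-algebra are those of the
  form \<open>c\<^sup>* c\<close> with \<open>c\<close> in that algebra. In the axiom \<open>star_mul_pos\<close> the element \<open>b\<close> lies
  in an arbitrary fibre but \<open>c\<close> must lie in the unit fibre.\<close>

definition unit_fibre_pos :: "('x, 'm) monoid_scheme \<Rightarrow> ('x, 'b) bundle_data \<Rightarrow> 'b \<Rightarrow> bool" where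
  "unit_fibre_pos K C a \<longleftrightarrow> (\<exists>c\<in>carrier (fibre C \<one>\<^bsub>K\<^esub>). a = bmul C (bstar C c) c)"

locale fell_bundle = group K for K :: "('x, 'm) monoid_scheme" (structure) +
  fixes C :: "('x, 'b) bundle_data"
  assumes proj_closed: "b \<in> total C \<Longrightarrow> proj C b \<in> carrier K"
    and banach_fibre: "x \<in> carrier K \<Longrightarrow> complex_banach (fibre C x) (bnorm C)"
    and mul_closed: "a \<in> total C \<Longrightarrow> b \<in> total C \<Longrightarrow> bmul C a b \<in> total C"
    and proj_mul: "a \<in> total C \<Longrightarrow> b \<in> total C \<Longrightarrow>
      proj C (bmul C a b) = proj C a \<otimes> proj C b"
    and mul_add_left: "a \<in> total C \<Longrightarrow> a' \<in> total C \<Longrightarrow> proj C a = proj C a' \<Longrightarrow> b \<in> total C \<Longrightarrow>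
      bmul C (badd C a a') b = badd C (bmul C a b) (bmul C a' b)"
    and mul_add_right: "a \<in> total C \<Longrightarrow> b \<in> total C \<Longrightarrow> b' \<in> total C \<Longrightarrow> proj C b = proj C b' \<Longrightarrow>
      bmul C a (badd C b b') = badd C (bmul C a b) (bmul C a b')"
    and mul_scale_left: "a \<in> total C \<Longrightarrow> b \<in> total C \<Longrightarrow>
      bmul C (bscale C z a) b = bscale C z (bmul C a b)"
    and mul_scale_right: "a \<in> total C \<Longrightarrow> b \<in> total C \<Longrightarrow>
      bmul C a (bscale C z b) = bscale C z (bmul C a b)"
    and mul_assoc: "a \<in> total C \<Longrightarrow> b \<in> total C \<Longrightarrow> c \<in> total C \<Longrightarrow>
      bmul C (bmul C a b) c = bmul C a (bmul C b c)"
    and norm_mul: "a \<in> total C \<Longrightarrow> b \<in> total C \<Longrightarrow> bnorm C (bmul C a b) \<le> bnorm C a * bnorm C b"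
    and star_closed: "b \<in> total C \<Longrightarrow> bstar C b \<in> total C"
    and proj_star: "b \<in> total C \<Longrightarrow> proj C (bstar C b) = inv (proj C b)"
    and star_add: "a \<in> total C \<Longrightarrow> b \<in> total C \<Longrightarrow> proj C a = proj C b \<Longrightarrow>
      bstar C (badd C a b) = badd C (bstar C a) (bstar C b)"
    and star_scale: "b \<in> total C \<Longrightarrow> bstar C (bscale C z b) = bscale C (cnj z) (bstar C b)"
    and star_mul: "a \<in> total C \<Longrightarrow> b \<in> total C \<Longrightarrow>
      bstar C (bmul C a b) = bmul C (bstar C b) (bstar C a)"
    and star_star: "b \<in> total C \<Longrightarrow> bstar C (bstar C b) = b"
    and norm_star_mul: "b \<in> total C \<Longrightarrow> bnorm C (bmul C (bstar C b) b) = (bnorm C b)\<^sup>2"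
    and norm_star: "b \<in> total C \<Longrightarrow> (bnorm C (bstar C b))\<^sup>2 = (bnorm C b)\<^sup>2"
    and star_mul_pos: "b \<in> total C \<Longrightarrow> unit_fibre_pos K C (bmul C (bstar C b) b)"

definition unital_unit_fibre :: "('x, 'm) monoid_scheme \<Rightarrow> ('x, 'b) bundle_data \<Rightarrow> bool" where
  "unital_unit_fibre K C \<longleftrightarrow> (\<exists>u\<in>carrier (fibre C \<one>\<^bsub>K\<^esub>). \<forall>a\<in>carrier (fibre C \<one>\<^bsub>K\<^esub>).
     bmul C u a = a \<and> bmul C a u = a)"

text \<open>The disjoint union topology of the norm topologies on the fibres.\<close>

definition bundle_topology :: "('x, 'b) bundle_data \<Rightarrow> 'b topology" where
  "bundle_topology C = topology (\<lambda>U. U \<subseteq> total C \<and>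
     (\<forall>b\<in>U. \<exists>\<epsilon>>0. \<forall>c\<in>carrier (fibre C (proj C b)).
        bnorm C (c \<ominus>\<^bsub>fibre C (proj C b)\<^esub> b) < \<epsilon> \<longrightarrow> c \<in> U))"

lemma openin_bundle_topology:
  "openin (bundle_topology C) U \<longleftrightarrow> U \<subseteq> total C \<and>
     (\<forall>b\<in>U. \<exists>\<epsilon>>0. \<forall>c\<in>carrier (fibre C (proj C b)).
        bnorm C (c \<ominus>\<^bsub>fibre C (proj C b)\<^esub> b) < \<epsilon> \<longrightarrow> c \<in> U)"
proof -
  let ?P = "\<lambda>U. U \<subseteq> total C \<and> (\<forall>b\<in>U. \<exists>\<epsilon>>0. \<forall>c\<in>carrier (fibre C (proj C b)).
        bnorm C (c \<ominus>\<^bsub>fibre C (proj C b)\<^esub> b) < \<epsilon> \<longrightarrow> c \<in> U)"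
  have "istopology ?P"
    unfolding istopology_def
  proof (intro conjI allI impI)
    fix S T assume S: "?P S" and T: "?P T"
    show "S \<inter> T \<subseteq> total C" using S by blast
    show "\<forall>b\<in>S \<inter> T. \<exists>\<epsilon>>0. \<forall>c\<in>carrier (fibre C (proj C b)).
        bnorm C (c \<ominus>\<^bsub>fibre C (proj C b)\<^esub> b) < \<epsilon> \<longrightarrow> c \<in> S \<inter> T"
    proof
      fix b assume b: "b \<in> S \<inter> T"
      obtain d where "d > 0" "\<forall>c\<in>carrier (fibre C (proj C b)).
          bnorm C (c \<ominus>\<^bsub>fibre C (proj C b)\<^esub> b) < d \<longrightarrow> c \<in> S" using S b by blast
      moreover obtain e where "e > 0" "\<forall>c\<in>carrier (fibre C (proj C b)).
          bnorm C (c \<ominus>\<^bsub>fibre C (proj C b)\<^esub> b) < e \<longrightarrow> c \<in> T" using T b by blast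
      ultimately show "\<exists>\<epsilon>>0. \<forall>c\<in>carrier (fibre C (proj C b)).
        bnorm C (c \<ominus>\<^bsub>fibre C (proj C b)\<^esub> b) < \<epsilon> \<longrightarrow> c \<in> S \<inter> T"
        by (intro exI[of _ "min d e"]) auto
    qed
  next
    fix \<K> assume K: "\<forall>S\<in>\<K>. ?P S"
    show "\<Union>\<K> \<subseteq> total C" using K by blast
    show "\<forall>b\<in>\<Union>\<K>. \<exists>\<epsilon>>0. \<forall>c\<in>carrier (fibre C (proj C b)).
        bnorm C (c \<ominus>\<^bsub>fibre C (proj C b)\<^esub> b) < \<epsilon> \<longrightarrow> c \<in> \<Union>\<K>"
      using K by (meson UnionE UnionI)
  qed
  then show ?thesis
    unfolding bundle_topology_def by (simp add: topology_inverse')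
qed

definition section_support :: "('x, 'm) monoid_scheme \<Rightarrow> ('x, 'b) bundle_data \<Rightarrow> ('x \<Rightarrow> 'b) \<Rightarrow> 'x set" where
  "section_support K C \<sigma> = {k \<in> carrier K. \<sigma> k \<noteq> bzero C k}"

definition finite_sections :: "('x, 'm) monoid_scheme \<Rightarrow> ('x, 'b) bundle_data \<Rightarrow> ('x \<Rightarrow> 'b) set" where
  "finite_sections K C =
     {\<sigma> \<in> (\<Pi>\<^sub>E k\<in>carrier K. carrier (fibre C k)). finite (section_support K C \<sigma>)}"

definition section_mult :: "('x, 'm) monoid_scheme \<Rightarrow> ('x, 'b) bundle_data \<Rightarrow>
    ('x \<Rightarrow> 'b) \<Rightarrow> ('x \<Rightarrow> 'b) \<Rightarrow> 'x \<Rightarrow> 'b" where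
  "section_mult K C \<sigma> \<tau> = (\<lambda>k\<in>carrier K. finsum (fibre C k)
     (\<lambda>l. bmul C (\<sigma> l) (\<tau> (inv\<^bsub>K\<^esub> l \<otimes>\<^bsub>K\<^esub> k))) (section_support K C \<sigma>))"

definition section_star :: "('x, 'm) monoid_scheme \<Rightarrow> ('x, 'b) bundle_data \<Rightarrow> ('x \<Rightarrow> 'b) \<Rightarrow> 'x \<Rightarrow> 'b" where
  "section_star K C \<sigma> = (\<lambda>k\<in>carrier K. bstar C (\<sigma> (inv\<^bsub>K\<^esub> k)))"

definition section_add :: "('x, 'm) monoid_scheme \<Rightarrow> ('x, 'b) bundle_data \<Rightarrow>
    ('x \<Rightarrow> 'b) \<Rightarrow> ('x \<Rightarrow> 'b) \<Rightarrow> 'x \<Rightarrow> 'b" where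
  "section_add K C \<sigma> \<tau> = (\<lambda>k\<in>carrier K. badd C (\<sigma> k) (\<tau> k))"

definition section_scale :: "('x, 'm) monoid_scheme \<Rightarrow> ('x, 'b) bundle_data \<Rightarrow>
    complex \<Rightarrow> ('x \<Rightarrow> 'b) \<Rightarrow> 'x \<Rightarrow> 'b" where
  "section_scale K C z \<sigma> = (\<lambda>k\<in>carrier K. bscale C z (\<sigma> k))"

definition l1_norm :: "('x, 'm) monoid_scheme \<Rightarrow> ('x, 'b) bundle_data \<Rightarrow> ('x \<Rightarrow> 'b) \<Rightarrow> real" where
  "l1_norm K C \<sigma> = (\<Sum>k\<in>section_support K C \<sigma>. bnorm C (\<sigma> k))"

definition section_rep :: "('x, 'm) monoid_scheme \<Rightarrow> ('x, 'b) bundle_data \<Rightarrow>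
    ('v, 'n) hilbert_scheme \<Rightarrow> (('x \<Rightarrow> 'b) \<Rightarrow> 'v \<Rightarrow> 'v) \<Rightarrow> bool" where
  "section_rep K C H L \<longleftrightarrow>
     (\<forall>\<sigma>\<in>finite_sections K C. bounded_operator H (L \<sigma>) \<and>
        operator_norm H (L \<sigma>) \<le> l1_norm K C \<sigma>) \<and>
     (\<forall>\<sigma>\<in>finite_sections K C. \<forall>\<tau>\<in>finite_sections K C. \<forall>v\<in>carrier H.
        L (section_add K C \<sigma> \<tau>) v = L \<sigma> v \<oplus>\<^bsub>H\<^esub> L \<tau> v) \<and>
     (\<forall>z. \<forall>\<sigma>\<in>finite_sections K C. \<forall>v\<in>carrier H.
        L (section_scale K C z \<sigma>) v = z \<odot>\<^bsub>H\<^esub> L \<sigma> v) \<and>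
     (\<forall>\<sigma>\<in>finite_sections K C. \<forall>\<tau>\<in>finite_sections K C. \<forall>v\<in>carrier H.
        L (section_mult K C \<sigma> \<tau>) v = L \<sigma> (L \<tau> v)) \<and>
     (\<forall>\<sigma>\<in>finite_sections K C. \<forall>u\<in>carrier H. \<forall>v\<in>carrier H.
        ip H (L (section_star K C \<sigma>) u) v = ip H u (L \<sigma> v))"

text \<open>HOL cannot quantify over Hilbert spaces of all types inside a term, so the Hilbert spaces
  below have their underlying set in the fixed type of complex functions on \<open>'x \<Rightarrow> 'b\<close>. The
  supremum is the same as over all Hilbert spaces. Given a representation \<open>L\<close> on any \<open>H\<close>, a
  section \<open>\<sigma>\<close> and a vector \<open>\<xi>\<close>, the closure \<open>M\<close> of the subspace of all \<open>L \<tau> \<xi>\<close> is invariant;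
  the map sending \<open>\<eta>\<close> in \<open>M\<close> to the function \<open>\<tau> \<mapsto> ip H \<eta> (L \<tau> \<xi>)\<close> is injective, so the
  restriction of \<open>L\<close> to \<open>M\<close> can be transported to this type. Since \<open>L \<sigma>\<^sup>* \<xi>\<close> lies in \<open>M\<close> and
  the norm of \<open>L \<sigma>\<close> is the supremum of the quotients of the norms of \<open>L \<sigma> (L \<sigma>\<^sup>* \<xi>)\<close> and
  \<open>L \<sigma>\<^sup>* \<xi>\<close>, these restrictions determine it.\<close>

definition universal_norm :: "('x, 'm) monoid_scheme \<Rightarrow> ('x, 'b) bundle_data \<Rightarrow> ('x \<Rightarrow> 'b) \<Rightarrow> real" where
  "universal_norm K C \<sigma> = Sup {operator_norm H (L \<sigma>) |
     (H :: (('x \<Rightarrow> 'b) \<Rightarrow> complex) hilbert) L. hilbert_space H \<and> section_rep K C H L}"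

definition section_algebra :: "('x, 'm) monoid_scheme \<Rightarrow> ('x, 'b) bundle_data \<Rightarrow>
    ('x \<Rightarrow> 'b) star_algebra" where
  "section_algebra K C =
     \<lparr>carrier = finite_sections K C, mult = section_mult K C, one = undefined,
      zero = (\<lambda>k\<in>carrier K. bzero C k), add = section_add K C, smult = section_scale K C,
      star = section_star K C, nrm = universal_norm K C\<rparr>"

definition Cstar :: "('x, 'm) monoid_scheme \<Rightarrow> ('x, 'b) bundle_data \<Rightarrow>
    (nat \<Rightarrow> 'x \<Rightarrow> 'b) set star_algebra" where
  "Cstar K C = completion (section_algebra K C)"

text \<open>\<open>act h x\<close> stands for \<open>h \<cdot> x\<close> and \<open>res h x\<close> for the restriction of \<open>h\<close> to \<open>x\<close>.\<close>

locale matched_pair =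
  G: group \<Gamma> + L: group \<Lambda>
  for \<Gamma> :: "('x, 'm) monoid_scheme" and \<Lambda> :: "('h, 'n) monoid_scheme" +
  fixes act :: "'h \<Rightarrow> 'x \<Rightarrow> 'x" and res :: "'h \<Rightarrow> 'x \<Rightarrow> 'h"
  assumes act_closed: "h \<in> carrier \<Lambda> \<Longrightarrow> x \<in> carrier \<Gamma> \<Longrightarrow> act h x \<in> carrier \<Gamma>"
    and res_closed: "h \<in> carrier \<Lambda> \<Longrightarrow> x \<in> carrier \<Gamma> \<Longrightarrow> res h x \<in> carrier \<Lambda>"
    and act_mult: "h \<in> carrier \<Lambda> \<Longrightarrow> g \<in> carrier \<Lambda> \<Longrightarrow> x \<in> carrier \<Gamma> \<Longrightarrow>
      act (h \<otimes>\<^bsub>\<Lambda>\<^esub> g) x = act h (act g x)"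
    and act_one: "x \<in> carrier \<Gamma> \<Longrightarrow> act \<one>\<^bsub>\<Lambda>\<^esub> x = x"
    and res_mult: "h \<in> carrier \<Lambda> \<Longrightarrow> x \<in> carrier \<Gamma> \<Longrightarrow> y \<in> carrier \<Gamma> \<Longrightarrow>
      res h (x \<otimes>\<^bsub>\<Gamma>\<^esub> y) = res (res h x) y"
    and res_one: "h \<in> carrier \<Lambda> \<Longrightarrow> res h \<one>\<^bsub>\<Gamma>\<^esub> = h"
    and act_of_mult: "h \<in> carrier \<Lambda> \<Longrightarrow> x \<in> carrier \<Gamma> \<Longrightarrow> y \<in> carrier \<Gamma> \<Longrightarrow>
      act h (x \<otimes>\<^bsub>\<Gamma>\<^esub> y) = act h x \<otimes>\<^bsub>\<Gamma>\<^esub> act (res h x) y"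
    and res_of_mult: "h \<in> carrier \<Lambda> \<Longrightarrow> g \<in> carrier \<Lambda> \<Longrightarrow> x \<in> carrier \<Gamma> \<Longrightarrow>
      res (h \<otimes>\<^bsub>\<Lambda>\<^esub> g) x = res h (act g x) \<otimes>\<^bsub>\<Lambda>\<^esub> res g x"

definition zappa_szep :: "('x, 'm) monoid_scheme \<Rightarrow> ('h, 'n) monoid_scheme \<Rightarrow>
    ('h \<Rightarrow> 'x \<Rightarrow> 'x) \<Rightarrow> ('h \<Rightarrow> 'x \<Rightarrow> 'h) \<Rightarrow> ('x \<times> 'h) monoid" where
  "zappa_szep \<Gamma> \<Lambda> act res =
     \<lparr>carrier = carrier \<Gamma> \<times> carrier \<Lambda>,
      mult = (\<lambda>(x, h) (y, g). (x \<otimes>\<^bsub>\<Gamma>\<^esub> act h y, res h y \<otimes>\<^bsub>\<Lambda>\<^esub> g)),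
      one = (\<one>\<^bsub>\<Gamma>\<^esub>, \<one>\<^bsub>\<Lambda>\<^esub>)\<rparr>"

locale compatible_action =
  matched_pair \<Gamma> \<Lambda> act res + fell_bundle \<Gamma> B
  for \<Gamma> :: "('x, 'm) monoid_scheme" and \<Lambda> :: "('h, 'n) monoid_scheme"
    and act :: "'h \<Rightarrow> 'x \<Rightarrow> 'x" and res :: "'h \<Rightarrow> 'x \<Rightarrow> 'h" and B :: "('x, 'b) bundle_data" +
  fixes \<beta> :: "'h \<Rightarrow> 'b \<Rightarrow> 'b"
  assumes action_continuous: "continuous_map
      (prod_topology (discrete_topology (carrier \<Lambda>)) (bundle_topology B))
      (bundle_topology B) (\<lambda>(h, b). \<beta> h b)"
    and action_closed: "h \<in> carrier \<Lambda> \<Longrightarrow> b \<in> total B \<Longrightarrow> \<beta> h b \<in> total B"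
    and proj_action: "h \<in> carrier \<Lambda> \<Longrightarrow> b \<in> total B \<Longrightarrow> proj B (\<beta> h b) = act h (proj B b)"
    and action_add: "h \<in> carrier \<Lambda> \<Longrightarrow> a \<in> total B \<Longrightarrow> b \<in> total B \<Longrightarrow> proj B a = proj B b \<Longrightarrow>
      \<beta> h (badd B a b) = badd B (\<beta> h a) (\<beta> h b)"
    and action_scale: "h \<in> carrier \<Lambda> \<Longrightarrow> b \<in> total B \<Longrightarrow>
      \<beta> h (bscale B z b) = bscale B z (\<beta> h b)"
    and action_mult: "g \<in> carrier \<Lambda> \<Longrightarrow> h \<in> carrier \<Lambda> \<Longrightarrow> b \<in> total B \<Longrightarrow>
      \<beta> (g \<otimes>\<^bsub>\<Lambda>\<^esub> h) b = \<beta> g (\<beta> h b)"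
    and action_one: "b \<in> total B \<Longrightarrow> \<beta> \<one>\<^bsub>\<Lambda>\<^esub> b = b"
    and action_bmul: "h \<in> carrier \<Lambda> \<Longrightarrow> b \<in> total B \<Longrightarrow> c \<in> total B \<Longrightarrow>
      \<beta> h (bmul B b c) = bmul B (\<beta> h b) (\<beta> (res h (proj B b)) c)"
    and action_bstar: "h \<in> carrier \<Lambda> \<Longrightarrow> b \<in> total B \<Longrightarrow>
      bstar B (\<beta> h b) = \<beta> (res h (proj B b)) (bstar B b)"

definition product_bundle :: "('x, 'm) monoid_scheme \<Rightarrow> ('h, 'n) monoid_scheme \<Rightarrow>
    ('h \<Rightarrow> 'x \<Rightarrow> 'h) \<Rightarrow> ('x, 'b) bundle_data \<Rightarrow> ('h \<Rightarrow> 'b \<Rightarrow> 'b) \<Rightarrow> ('x \<times> 'h, 'b \<times> 'h) bundle_data" where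
  "product_bundle \<Gamma> \<Lambda> res B \<beta> =
     \<lparr>total = total B \<times> carrier \<Lambda>,
      proj = (\<lambda>(b, h). (proj B b, h)),
      bzero = (\<lambda>(x, h). (bzero B x, h)),
      badd = (\<lambda>(a, g) (b, h). (badd B a b, g)),
      bscale = (\<lambda>z (b, h). (bscale B z b, h)),
      bnorm = (\<lambda>(b, h). bnorm B b),
      bmul = (\<lambda>(a, g) (b, h). (bmul B a (\<beta> g b), res g (proj B b) \<otimes>\<^bsub>\<Lambda>\<^esub> h)),
      bstar = (\<lambda>(b, h). (\<beta> (inv\<^bsub>\<Lambda>\<^esub> h) (bstar B b), res (inv\<^bsub>\<Lambda>\<^esub> h) (inv\<^bsub>\<Gamma>\<^esub> (proj B b))))\<rparr>"

definition section_embedding :: "('x, 'm) monoid_scheme \<Rightarrow> ('h, 'n) monoid_scheme \<Rightarrow>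
    ('x, 'b) bundle_data \<Rightarrow> ('x \<Rightarrow> 'b) \<Rightarrow> 'x \<times> 'h \<Rightarrow> 'b \<times> 'h" where
  "section_embedding \<Gamma> \<Lambda> B \<sigma> = (\<lambda>(x, h)\<in>carrier \<Gamma> \<times> carrier \<Lambda>.
     if h = \<one>\<^bsub>\<Lambda>\<^esub> then (\<sigma> x, \<one>\<^bsub>\<Lambda>\<^esub>) else (bzero B x, h))"

definition canonical_map :: "('x, 'm) monoid_scheme \<Rightarrow> ('h, 'n) monoid_scheme \<Rightarrow>
    ('h \<Rightarrow> 'x \<Rightarrow> 'x) \<Rightarrow> ('h \<Rightarrow> 'x \<Rightarrow> 'h) \<Rightarrow> ('x, 'b) bundle_data \<Rightarrow> ('h \<Rightarrow> 'b \<Rightarrow> 'b) \<Rightarrow>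
    (nat \<Rightarrow> 'x \<Rightarrow> 'b) set \<Rightarrow> (nat \<Rightarrow> 'x \<times> 'h \<Rightarrow> 'b \<times> 'h) set" where
  "canonical_map \<Gamma> \<Lambda> act res B \<beta> =
     extend_to_completion (section_algebra \<Gamma> B)
       (section_algebra (zappa_szep \<Gamma> \<Lambda> act res) (product_bundle \<Gamma> \<Lambda> res B \<beta>))
       (section_embedding \<Gamma> \<Lambda> B)"

end

theory Submission
  imports Defs
begin

text \<open>The canonical map \<open>i\<close> is a star homomorphism on finitely supported sections, so everything rests
  on one equality: the universal norms of \<open>\<sigma>\<close> and of \<open>i \<sigma>\<close> agree (\<open>universal_norm_embedding\<close>). An
  isometric star homomorphism extends to an injective star homomorphism of the completions
  (\<open>isometric_star_hom\<close>).

  Composing a representation of the product bundle with \<open>i\<close> gives a representation of \<open>B\<close>, so \<open>i\<close>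
  does not increase the norm. For the other inequality every representation \<open>\<pi>\<close> of \<open>B\<close> on \<open>H\<close> must be
  recovered from one of the product bundle. View \<open>\<Gamma>\<close> as a subgroup of the Zappa-Szep product and
  induce. Each left coset of \<open>\<Gamma>\<close> has a unique representative \<open>(e, k)\<close> with \<open>k\<close> in \<open>\<Lambda>\<close>, so the induced
  representation lives on the square-summable families \<open>\<Lambda> \<rightarrow> H\<close>. Working out how \<open>(b, g)\<close> moves the
  cosets, and labelling the coset of \<open>(e, k)\<close> by \<open>m = k\<^sup>-\<^sup>1\<close>, gives the formula
  \<open>(Ind (b, g) \<eta>) m = \<pi> (\<beta> m b) (\<eta> (res m (proj b) g))\<close>.
  That it is multiplicative and compatible with the involution is exactly what the axioms of a
  matched pair and of a compatible action say (\<open>induced_bundle_representation\<close>). On a family that is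
  concentrated at \<open>m = e\<close>, the component at \<open>e\<close> of \<open>Ind (i \<sigma>)\<close> is \<open>\<pi> \<sigma>\<close>, because \<open>e\<close> acts trivially and
  restricts to itself. Hence the norm of \<open>i \<sigma>\<close> is at least that of \<open>\<pi> \<sigma>\<close>.

  Two points need care. First, the induced representation must be bounded by the norms of the
  fibres, so \<open>\<beta> m\<close> has to be isometric. Continuity only bounds each \<open>\<beta> m\<close> on the unit fibre by some
  constant; repeated squaring of self-adjoint elements and the C*-identity improve the constant to
  1, and the C*-identity carries this to all fibres (\<open>action_isometric\<close>). Secondly, the universal norm
  is a supremum over Hilbert spaces on one fixed type, while the induced representation lives on
  another. The cyclic subrepresentations of any representation embed into the fixed type by
  their coefficient functions, and they determine the norm (\<open>operator_norm_le_universal_norm\<close>).\<close>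

section \<open>Seminormed complex vector spaces\<close>

lemma complex_ring_simps [simp]:
  "carrier complex_ring = UNIV" "x \<otimes>\<^bsub>complex_ring\<^esub> y = x * y" "\<one>\<^bsub>complex_ring\<^esub> = 1"
  "\<zero>\<^bsub>complex_ring\<^esub> = 0" "x \<oplus>\<^bsub>complex_ring\<^esub> y = x + y"
  by (simp_all add: complex_ring_def)

lemma cring_complex_ring: "cring complex_ring"
proof (rule cringI)
  show "abelian_group complex_ring"
    by (rule abelian_groupI) (auto simp: algebra_simps intro: exI[of _ "- x" for x :: complex])
  show "Group.comm_monoid complex_ring"
    by (rule comm_monoidI) (auto simp: algebra_simps)
qed (simp add: algebra_simps)

text \<open>Additive inverses come from scaling by \<open>-1\<close>.\<close>

lemma complex_moduleI:
  fixes V :: "(complex, 'v, 'm) module_scheme" (structure)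
  assumes "\<And>x y. \<lbrakk>x \<in> carrier V; y \<in> carrier V\<rbrakk> \<Longrightarrow> x \<oplus> y \<in> carrier V"
    and "\<zero> \<in> carrier V"
    and "\<And>x y z. \<lbrakk>x \<in> carrier V; y \<in> carrier V; z \<in> carrier V\<rbrakk> \<Longrightarrow> (x \<oplus> y) \<oplus> z = x \<oplus> (y \<oplus> z)"
    and "\<And>x y. \<lbrakk>x \<in> carrier V; y \<in> carrier V\<rbrakk> \<Longrightarrow> x \<oplus> y = y \<oplus> x"
    and "\<And>x. x \<in> carrier V \<Longrightarrow> \<zero> \<oplus> x = x"
    and "\<And>c x. x \<in> carrier V \<Longrightarrow> c \<odot> x \<in> carrier V"
    and "\<And>c d x. x \<in> carrier V \<Longrightarrow> (c + d) \<odot> x = c \<odot> x \<oplus> d \<odot> x"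
    and "\<And>c x y. \<lbrakk>x \<in> carrier V; y \<in> carrier V\<rbrakk> \<Longrightarrow> c \<odot> (x \<oplus> y) = c \<odot> x \<oplus> c \<odot> y"
    and "\<And>c d x. x \<in> carrier V \<Longrightarrow> (c * d) \<odot> x = c \<odot> (d \<odot> x)"
    and "\<And>x. x \<in> carrier V \<Longrightarrow> 1 \<odot> x = x"
    and "\<And>x. x \<in> carrier V \<Longrightarrow> 0 \<odot> x = \<zero>"
  shows "Module.module complex_ring V"
proof (rule moduleI)
  show "abelian_group V"
  proof (rule abelian_groupI)
    fix x assume x: "x \<in> carrier V"
    have "(-1) \<odot> x \<oplus> x = (-1) \<odot> x \<oplus> 1 \<odot> x" using x assms(10) by simp
    also have "\<dots> = (-1 + 1) \<odot> x" by (rule assms(7)[symmetric]) (rule x)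
    also have "\<dots> = \<zero>" using x assms(11) by simp
    finally show "\<exists>y\<in>carrier V. y \<oplus> x = \<zero>" using assms(6)[OF x] by blast
  qed (use assms in auto)
qed (use assms cring_complex_ring in auto)

lemma complex_module_minus:
  fixes V :: "(complex, 'v, 'm) module_scheme" (structure)
  assumes "Module.module complex_ring V" and "x \<in> carrier V" and "y \<in> carrier V"
  shows "\<ominus> x = (-1) \<odot> x" and "x \<ominus> y = x \<oplus> (-1) \<odot> y"
proof -
  interpret Module.module complex_ring V by (rule assms)
  have *: "\<ominus> z = (-1) \<odot> z" if z: "z \<in> carrier V" for z
  proof -
    have "(-1) \<odot> z \<oplus> z = (-1) \<odot> z \<oplus> 1 \<odot> z" using z smult_one by simp
    also have "\<dots> = (-1 + 1) \<odot> z" using smult_l_distr[of "-1" 1 z] z by simp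
    also have "\<dots> = \<zero>" using smult_l_null[OF z] by simp
    finally show ?thesis using M.minus_equality[of "(-1) \<odot> z" z] z by simp
  qed
  then show "\<ominus> x = (-1) \<odot> x" "x \<ominus> y = x \<oplus> (-1) \<odot> y"
    using assms by (simp_all add: a_minus_def)
qed

lemma (in abelian_monoid) finsum_swap:
  assumes "finite A" "finite A'" "\<And>i j. i \<in> A \<Longrightarrow> j \<in> A' \<Longrightarrow> f i j \<in> carrier G"
  shows "finsum G (\<lambda>i. finsum G (f i) A') A = finsum G (\<lambda>j. finsum G (\<lambda>i. f i j) A) A'"
  using assms(1,3)
proof (induction A)
  case empty
  then show ?case by simp
next
  case (insert a A)
  have cl: "(\<lambda>j. finsum G (\<lambda>i. f i j) A) \<in> A' \<rightarrow> carrier G" "f a \<in> A' \<rightarrow> carrier G"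
    "(\<lambda>i. finsum G (f i) A') \<in> A \<rightarrow> carrier G"
    using insert.prems by (auto intro!: finsum_closed)
  have "finsum G (\<lambda>i. finsum G (f i) A') (insert a A)
      = finsum G (f a) A' \<oplus> finsum G (\<lambda>i. finsum G (f i) A') A"
    using insert cl by (auto intro!: finsum_insert)
  also have "\<dots> = finsum G (f a) A' \<oplus> finsum G (\<lambda>j. finsum G (\<lambda>i. f i j) A) A'"
    using insert by simp
  also have "\<dots> = finsum G (\<lambda>j. f a j \<oplus> finsum G (\<lambda>i. f i j) A) A'"
    using cl by (auto intro!: finsum_addf[symmetric])
  also have "\<dots> = finsum G (\<lambda>j. finsum G (\<lambda>i. f i j) (insert a A)) A'"
    using insert by (intro finsum_cong') (auto intro!: finsum_insert[symmetric] finsum_closed)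
  finally show ?case .
qed

lemma finsum_additive:
  assumes "abelian_monoid G" "abelian_monoid G'" "finite A" "g \<in> A \<rightarrow> carrier G"
    and "f \<in> carrier G \<rightarrow> carrier G'" "f \<zero>\<^bsub>G\<^esub> = \<zero>\<^bsub>G'\<^esub>"
    and add: "\<And>x y. x \<in> carrier G \<Longrightarrow> y \<in> carrier G \<Longrightarrow> f (x \<oplus>\<^bsub>G\<^esub> y) = f x \<oplus>\<^bsub>G'\<^esub> f y"
  shows "f (finsum G g A) = finsum G' (\<lambda>i. f (g i)) A"
proof -
  interpret G: abelian_monoid G by fact
  interpret G': abelian_monoid G' by fact
  show ?thesis using assms(3,4)
  proof (induction A)
    case empty
    then show ?case using assms(6) by simp
  next
    case (insert a A)
    then have g: "g \<in> A \<rightarrow> carrier G" "g a \<in> carrier G" by auto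
    moreover have "finsum G g A \<in> carrier G" using g by (rule_tac G.finsum_closed)
    moreover have "finsum G g (insert a A) = g a \<oplus>\<^bsub>G\<^esub> finsum G g A"
      using insert g by (rule_tac G.finsum_insert) auto
    moreover have "finsum G' (\<lambda>i. f (g i)) (insert a A) = f (g a) \<oplus>\<^bsub>G'\<^esub> finsum G' (\<lambda>i. f (g i)) A"
      using insert g assms(5) by (intro G'.finsum_insert) auto
    ultimately show ?case using insert.IH add by simp
  qed
qed

lemma (in abelian_monoid) finsum_superset:
  assumes "finite A'" "A \<subseteq> A'" "f \<in> A' \<rightarrow> carrier G" "\<And>i. i \<in> A' - A \<Longrightarrow> f i = \<zero>"
  shows "finsum G f A = finsum G f A'"
  using assms by (intro add.finprod_mono_neutral_cong_left[unfolded finsum_def[symmetric]]) auto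

locale seminormed_space = Module.module complex_ring V
  for V :: "(complex, 'v, 'm) module_scheme" (structure) +
  fixes N :: "'v \<Rightarrow> real"
  assumes seminorm_nonneg: "v \<in> carrier V \<Longrightarrow> 0 \<le> N v"
    and seminorm_scale_le: "v \<in> carrier V \<Longrightarrow> N (c \<odot> v) \<le> cmod c * N v"
    and seminorm_triangle: "u \<in> carrier V \<Longrightarrow> v \<in> carrier V \<Longrightarrow> N (u \<oplus> v) \<le> N u + N v"
begin

lemma scale_closed [simp, intro]: "v \<in> carrier V \<Longrightarrow> c \<odot> v \<in> carrier V"
  by simp

lemma minus_scale: "v \<in> carrier V \<Longrightarrow> \<ominus> v = (-1) \<odot> v"
  using complex_module_minus[OF module_axioms] by blast

lemma seminorm_zero [simp]: "N \<zero> = 0"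
proof -
  have "N (0 \<odot> \<zero>) \<le> 0" using seminorm_scale_le[of \<zero> 0] by simp
  then show ?thesis using seminorm_nonneg[of \<zero>] smult_l_null[of \<zero>] by auto
qed

lemma seminorm_minus: "v \<in> carrier V \<Longrightarrow> N (\<ominus> v) = N v"
  using seminorm_scale_le[of v "-1"] seminorm_scale_le[of "\<ominus> v" "-1"]
    minus_scale[of v] minus_scale[of "\<ominus> v"] M.minus_minus[of v] by simp

lemma seminorm_minus_commute: "u \<in> carrier V \<Longrightarrow> v \<in> carrier V \<Longrightarrow> N (u \<ominus> v) = N (v \<ominus> u)"
  using seminorm_minus[of "v \<ominus> u"] by (simp add: a_minus_def M.minus_add M.a_comm)

lemma minus_split:
  "u \<in> carrier V \<Longrightarrow> v \<in> carrier V \<Longrightarrow> w \<in> carrier V \<Longrightarrow> u \<ominus> w = (u \<ominus> v) \<oplus> (v \<ominus> w)"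
  by (simp add: a_minus_def M.a_assoc M.r_neg1)

lemma seminorm_triangle_minus:
  "u \<in> carrier V \<Longrightarrow> v \<in> carrier V \<Longrightarrow> w \<in> carrier V \<Longrightarrow> N (u \<ominus> w) \<le> N (u \<ominus> v) + N (v \<ominus> w)"
  using seminorm_triangle[of "u \<ominus> v" "v \<ominus> w"] by (simp add: minus_split[of u v w])

lemma seminorm_diff_le:
  assumes "u \<in> carrier V" "v \<in> carrier V" shows "N u - N v \<le> N (u \<ominus> v)"
proof -
  have "N ((u \<ominus> v) \<oplus> v) \<le> N (u \<ominus> v) + N v" using assms seminorm_triangle by simp
  moreover have "(u \<ominus> v) \<oplus> v = u" using assms by (simp add: a_minus_def M.a_assoc M.l_neg)
  ultimately show ?thesis by simp
qed

lemma add_minus_add: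
  assumes "u \<in> carrier V" "v \<in> carrier V" "u' \<in> carrier V" "v' \<in> carrier V"
  shows "(u \<oplus> v) \<ominus> (u' \<oplus> v') = (u \<ominus> u') \<oplus> (v \<ominus> v')"
  using assms by (simp add: a_minus_def M.minus_add M.a_ac)

lemma scale_minus:
  assumes "u \<in> carrier V" "v \<in> carrier V" shows "c \<odot> u \<ominus> c \<odot> v = c \<odot> (u \<ominus> v)"
  using assms smult_r_distr[of c u "(-1) \<odot> v"] smult_assoc1[of c "-1" v] smult_assoc1[of "-1" c v]
  by (simp add: a_minus_def minus_scale)

lemma seminorm_scale:
  assumes v: "v \<in> carrier V" shows "N (c \<odot> v) = cmod c * N v"
proof (cases "c = 0")
  case True
  then show ?thesis using v smult_l_null[of v] by simp
next
  case False
  have "N v = N (inverse c \<odot> (c \<odot> v))"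
    using False v smult_assoc1[of "inverse c" c v] smult_one[of v] by simp
  also have "\<dots> \<le> inverse (cmod c) * N (c \<odot> v)"
    using seminorm_scale_le[of "c \<odot> v" "inverse c"] v by (simp add: norm_inverse)
  finally have "cmod c * N v \<le> N (c \<odot> v)" using False by (simp add: field_simps)
  then show ?thesis using seminorm_scale_le[OF v, of c] by simp
qed

lemma cauchy_wrtD: "cauchy_wrt V N s \<Longrightarrow> s n \<in> carrier V"
  unfolding cauchy_wrt_def by blast

lemma cauchy_wrt_const [simp]: "v \<in> carrier V \<Longrightarrow> cauchy_wrt V N (\<lambda>n. v)"
  unfolding cauchy_wrt_def by (simp add: a_minus_def M.r_neg)

lemma cauchy_wrt_bounded:
  assumes s: "cauchy_wrt V N s" obtains C where "0 < C" "\<And>n. N (s n) \<le> C"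
proof -
  obtain n0 where n0: "N (s n \<ominus> s n0) < 1" if "n \<ge> n0" for n
    using s unfolding cauchy_wrt_def by (metis order_refl zero_less_one)
  define C where "C = Max ((\<lambda>n. N (s n)) ` {..n0}) + 1"
  have le: "N (s n) \<le> C - 1" if "n \<le> n0" for n
    unfolding C_def using that by (auto intro!: Max_ge)
  have "N (s n) \<le> C" for n
  proof (cases "n \<le> n0")
    case True then show ?thesis using le[of n] by simp
  next
    case False
    then show ?thesis
      using seminorm_diff_le[of "s n" "s n0"] n0[of n] le[of n0] cauchy_wrtD[OF s] by force
  qed
  moreover have "0 < C" using le[of 0] seminorm_nonneg[OF cauchy_wrtD[OF s, of 0]] by simp
  ultimately show ?thesis using that by blast
qed

lemma cauchy_wrt_add:
  assumes "cauchy_wrt V N s" "cauchy_wrt V N t" shows "cauchy_wrt V N (\<lambda>n. s n \<oplus> t n)"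
  unfolding cauchy_wrt_def
proof (intro conjI allI impI)
  show "s n \<oplus> t n \<in> carrier V" for n using assms cauchy_wrtD by simp
  fix e :: real assume "e > 0"
  then have e2: "e / 2 > 0" by simp
  obtain n1 n2 where n: "\<forall>m\<ge>n1. \<forall>n\<ge>n1. N (s m \<ominus> s n) < e/2" "\<forall>m\<ge>n2. \<forall>n\<ge>n2. N (t m \<ominus> t n) < e/2"
    using assms e2 unfolding cauchy_wrt_def by meson
  show "\<exists>n0. \<forall>m\<ge>n0. \<forall>n\<ge>n0. N ((s m \<oplus> t m) \<ominus> (s n \<oplus> t n)) < e"
  proof (intro exI[of _ "max n1 n2"] allI impI)
    fix m n assume "max n1 n2 \<le> m" "max n1 n2 \<le> n"
    then have "N (s m \<ominus> s n) < e/2" "N (t m \<ominus> t n) < e/2" using n by auto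
    then show "N ((s m \<oplus> t m) \<ominus> (s n \<oplus> t n)) < e"
      using seminorm_triangle[of "s m \<ominus> s n" "t m \<ominus> t n"] add_minus_add[of "s m" "t m" "s n" "t n"]
        cauchy_wrtD[OF assms(1)] cauchy_wrtD[OF assms(2)] by simp
  qed
qed

end

text \<open>Scaling, the involution and homomorphisms all respect Cauchy sequences because they are
  Lipschitz.\<close>

lemma cauchy_wrt_image:
  assumes "cauchy_wrt V N s" and "f \<in> carrier V \<rightarrow> carrier W" and "0 < C"
    and "\<And>u v. u \<in> carrier V \<Longrightarrow> v \<in> carrier V \<Longrightarrow> N' (f u \<ominus>\<^bsub>W\<^esub> f v) \<le> C * N (u \<ominus>\<^bsub>V\<^esub> v)"
  shows "cauchy_wrt W N' (\<lambda>n. f (s n))"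
  unfolding cauchy_wrt_def
proof (intro conjI allI impI)
  have s: "s n \<in> carrier V" for n using assms(1) unfolding cauchy_wrt_def by blast
  then show "f (s n) \<in> carrier W" for n using assms(2) by blast
  fix e :: real assume "e > 0"
  then have "e / C > 0" using \<open>0 < C\<close> by simp
  then obtain n0 where n0: "\<forall>m\<ge>n0. \<forall>n\<ge>n0. N (s m \<ominus>\<^bsub>V\<^esub> s n) < e / C"
    using assms(1) unfolding cauchy_wrt_def by meson
  show "\<exists>n0. \<forall>m\<ge>n0. \<forall>n\<ge>n0. N' (f (s m) \<ominus>\<^bsub>W\<^esub> f (s n)) < e"
  proof (intro exI[of _ n0] allI impI)
    fix m n assume "n0 \<le> m" "n0 \<le> n"
    then have "C * N (s m \<ominus>\<^bsub>V\<^esub> s n) < e" using n0 \<open>0 < C\<close> by (simp add: field_simps)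
    then show "N' (f (s m) \<ominus>\<^bsub>W\<^esub> f (s n)) < e"
      using assms(4)[OF s s, of m n] by simp
  qed
qed

section \<open>Completions of seminormed star algebras\<close>

text \<open>What the completion of a star algebra needs in order to have well-defined operations:
  addition, multiplication and involution that are continuous for a seminorm.\<close>

locale seminormed_star_algebra = seminormed_space A "nrm A"
  for A :: "('v, 'm) star_algebra_scheme" (structure) +
  assumes mult_closed: "a \<in> carrier A \<Longrightarrow> b \<in> carrier A \<Longrightarrow> a \<otimes> b \<in> carrier A"
    and mult_add_left: "a \<in> carrier A \<Longrightarrow> a' \<in> carrier A \<Longrightarrow> b \<in> carrier A \<Longrightarrow>
      (a \<oplus> a') \<otimes> b = a \<otimes> b \<oplus> a' \<otimes> b"
    and mult_add_right: "a \<in> carrier A \<Longrightarrow> b \<in> carrier A \<Longrightarrow> b' \<in> carrier A \<Longrightarrow>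
      a \<otimes> (b \<oplus> b') = a \<otimes> b \<oplus> a \<otimes> b'"
    and nrm_mult: "a \<in> carrier A \<Longrightarrow> b \<in> carrier A \<Longrightarrow> nrm A (a \<otimes> b) \<le> nrm A a * nrm A b"
    and star_closed: "a \<in> carrier A \<Longrightarrow> star A a \<in> carrier A"
    and star_add: "a \<in> carrier A \<Longrightarrow> b \<in> carrier A \<Longrightarrow> star A (a \<oplus> b) = star A a \<oplus> star A b"
    and nrm_star: "a \<in> carrier A \<Longrightarrow> nrm A (star A a) \<le> nrm A a"
begin

abbreviation "cauchy \<equiv> cauchy_wrt A (nrm A)"

lemma minus_eqI:
  assumes "x \<in> carrier A" "y \<in> carrier A" "z \<in> carrier A" "x = z \<oplus> y" shows "x \<ominus> y = z"
  using assms by (simp add: a_minus_def M.a_assoc M.r_neg)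

lemma add_minus_cancel: "x \<in> carrier A \<Longrightarrow> y \<in> carrier A \<Longrightarrow> (x \<ominus> y) \<oplus> y = x"
  by (simp add: a_minus_def M.a_assoc M.l_neg)

lemma mult_minus_left:
  "a \<in> carrier A \<Longrightarrow> a' \<in> carrier A \<Longrightarrow> b \<in> carrier A \<Longrightarrow> a \<otimes> b \<ominus> a' \<otimes> b = (a \<ominus> a') \<otimes> b"
  using mult_add_left[of "a \<ominus> a'" a' b] by (intro minus_eqI) (auto simp: mult_closed add_minus_cancel)

lemma mult_minus_right:
  "a \<in> carrier A \<Longrightarrow> b \<in> carrier A \<Longrightarrow> b' \<in> carrier A \<Longrightarrow> a \<otimes> b \<ominus> a \<otimes> b' = a \<otimes> (b \<ominus> b')"
  using mult_add_right[of a "b \<ominus> b'" b'] by (intro minus_eqI) (auto simp: mult_closed add_minus_cancel)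

lemma star_minus:
  "a \<in> carrier A \<Longrightarrow> b \<in> carrier A \<Longrightarrow> star A a \<ominus> star A b = star A (a \<ominus> b)"
  using star_add[of "a \<ominus> b" b] by (intro minus_eqI) (auto simp: star_closed add_minus_cancel)

lemma equiv_null_rel: "equiv {s. cauchy s} (null_rel A)"
proof (rule equivI)
  show "null_rel A \<subseteq> {s. cauchy s} \<times> {s. cauchy s}" unfolding null_rel_def by auto
  show "refl_on {s. cauchy s} (null_rel A)"
    unfolding refl_on_def null_rel_def by (auto simp: cauchy_wrtD a_minus_def M.r_neg)
  show "sym (null_rel A)"
    unfolding sym_def null_rel_def using seminorm_minus_commute cauchy_wrtD by auto
  show "trans (null_rel A)"
  proof (rule transI)
    fix s t u assume a: "(s, t) \<in> null_rel A" "(t, u) \<in> null_rel A"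
    then have c: "s n \<in> carrier A" "t n \<in> carrier A" "u n \<in> carrier A" for n
      unfolding null_rel_def using cauchy_wrtD by auto
    have "(\<lambda>n. nrm A (s n \<ominus> t n) + nrm A (t n \<ominus> u n)) \<longlonglongrightarrow> 0"
      using a unfolding null_rel_def by (auto intro: tendsto_add_zero)
    then have "(\<lambda>n. nrm A (s n \<ominus> u n)) \<longlonglongrightarrow> 0"
      by (rule tendsto_sandwich[rotated 2, OF tendsto_const])
        (use c seminorm_nonneg seminorm_triangle_minus in auto)
    then show "(s, u) \<in> null_rel A" using a unfolding null_rel_def by auto
  qed
qed

lemma null_relI:
  assumes "cauchy s" "cauchy t" "g \<longlonglongrightarrow> 0" "\<And>n. nrm A (s n \<ominus> t n) \<le> g n"
  shows "(s, t) \<in> null_rel A"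
proof -
  have "(\<lambda>n. nrm A (s n \<ominus> t n)) \<longlonglongrightarrow> 0"
    by (rule tendsto_sandwich[OF _ _ tendsto_const assms(3)])
      (use assms seminorm_nonneg cauchy_wrtD in auto)
  then show ?thesis using assms unfolding null_rel_def by auto
qed

lemma mult_minus_le:
  assumes "a \<in> carrier A" "b \<in> carrier A" "a' \<in> carrier A" "b' \<in> carrier A"
  shows "nrm A (a \<otimes> b \<ominus> a' \<otimes> b') \<le> nrm A (a \<ominus> a') * nrm A b + nrm A a' * nrm A (b \<ominus> b')"
proof -
  have "nrm A (a \<otimes> b \<ominus> a' \<otimes> b') \<le> nrm A ((a \<ominus> a') \<otimes> b) + nrm A (a' \<otimes> (b \<ominus> b'))"
    using seminorm_triangle_minus[of "a \<otimes> b" "a' \<otimes> b" "a' \<otimes> b'"] assms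
    by (simp add: mult_closed mult_minus_left mult_minus_right)
  then show ?thesis
    using nrm_mult[of "a \<ominus> a'" b] nrm_mult[of a' "b \<ominus> b'"] assms by auto
qed

lemma cauchy_mult:
  assumes s: "cauchy s" and t: "cauchy t" shows "cauchy (\<lambda>n. s n \<otimes> t n)"
proof -
  obtain C where C: "0 < C" "\<And>n. nrm A (s n) \<le> C" using cauchy_wrt_bounded[OF s] by metis
  obtain D where D: "0 < D" "\<And>n. nrm A (t n) \<le> D" using cauchy_wrt_bounded[OF t] by metis
  note car = cauchy_wrtD[OF s] cauchy_wrtD[OF t]
  show ?thesis unfolding cauchy_wrt_def
  proof (intro conjI allI impI)
    show "s n \<otimes> t n \<in> carrier A" for n using car mult_closed by simp
    fix e :: real assume e: "e > 0"
    obtain n1 where n1: "\<forall>m\<ge>n1. \<forall>n\<ge>n1. nrm A (s m \<ominus> s n) < e / (2 * D)"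
      using s e D unfolding cauchy_wrt_def by (metis divide_pos_pos mult_pos_pos zero_less_numeral)
    obtain n2 where n2: "\<forall>m\<ge>n2. \<forall>n\<ge>n2. nrm A (t m \<ominus> t n) < e / (2 * C)"
      using t e C unfolding cauchy_wrt_def by (metis divide_pos_pos mult_pos_pos zero_less_numeral)
    show "\<exists>n0. \<forall>m\<ge>n0. \<forall>n\<ge>n0. nrm A (s m \<otimes> t m \<ominus> s n \<otimes> t n) < e"
    proof (intro exI[of _ "max n1 n2"] allI impI)
      fix m n assume mn: "max n1 n2 \<le> m" "max n1 n2 \<le> n"
      have "nrm A (s m \<ominus> s n) * nrm A (t m) \<le> nrm A (s m \<ominus> s n) * D"
        using D car seminorm_nonneg by (intro mult_left_mono) auto
      also have "\<dots> < e / 2" using n1 mn D by (simp add: field_simps)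
      finally have 1: "nrm A (s m \<ominus> s n) * nrm A (t m) < e / 2" .
      have "nrm A (s n) * nrm A (t m \<ominus> t n) \<le> C * nrm A (t m \<ominus> t n)"
        using C car seminorm_nonneg by (intro mult_right_mono) auto
      also have "\<dots> < e / 2" using n2 mn C by (simp add: field_simps)
      finally show "nrm A (s m \<otimes> t m \<ominus> s n \<otimes> t n) < e"
        using 1 mult_minus_le[of "s m" "t m" "s n" "t n"] car by simp
    qed
  qed
qed

lemma cauchy_scale: "cauchy s \<Longrightarrow> cauchy (\<lambda>n. c \<odot> s n)"
  by (rule cauchy_wrt_image[where C = "cmod c + 1"])
    (auto simp: add_nonneg_pos scale_minus seminorm_scale seminorm_nonneg distrib_right)

lemma cauchy_star: "cauchy s \<Longrightarrow> cauchy (\<lambda>n. star A (s n))"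
  by (rule cauchy_wrt_image[where C = 1]) (auto simp: star_minus star_closed nrm_star)

text \<open>The operations of the completion are unions over representatives. Each is continuous, so
  the classes in the union coincide.\<close>

lemma completion_add:
  assumes "cauchy s" "cauchy t"
  shows "null_rel A `` {s} \<oplus>\<^bsub>completion A\<^esub> null_rel A `` {t} = null_rel A `` {\<lambda>n. s n \<oplus> t n}"
proof -
  have "congruent2 (null_rel A) (null_rel A) (\<lambda>s t. null_rel A `` {\<lambda>n. s n \<oplus> t n})"
  proof (rule congruent2I'; rule equiv_class_eq[OF equiv_null_rel])
    fix s s' t t' assume a: "(s, s') \<in> null_rel A" "(t, t') \<in> null_rel A"
    then have c: "cauchy s" "cauchy s'" "cauchy t" "cauchy t'" unfolding null_rel_def by auto
    have "nrm A ((s n \<oplus> t n) \<ominus> (s' n \<oplus> t' n)) \<le> nrm A (s n \<ominus> s' n) + nrm A (t n \<ominus> t' n)" for n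
      using seminorm_triangle[of "s n \<ominus> s' n" "t n \<ominus> t' n"] c[THEN cauchy_wrtD, of n]
      by (simp add: add_minus_add)
    then show "(\<lambda>n. s n \<oplus> t n, \<lambda>n. s' n \<oplus> t' n) \<in> null_rel A"
      using a c by (intro null_relI[where g = "\<lambda>n. nrm A (s n \<ominus> s' n) + nrm A (t n \<ominus> t' n)"])
        (auto simp: null_rel_def intro: cauchy_wrt_add tendsto_add_zero)
  qed
  then show ?thesis
    using assms by (simp add: completion_def UN_equiv_class2[OF equiv_null_rel equiv_null_rel])
qed

lemma completion_mult:
  assumes "cauchy s" "cauchy t"
  shows "null_rel A `` {s} \<otimes>\<^bsub>completion A\<^esub> null_rel A `` {t} = null_rel A `` {\<lambda>n. s n \<otimes> t n}"
proof -
  have "congruent2 (null_rel A) (null_rel A) (\<lambda>s t. null_rel A `` {\<lambda>n. s n \<otimes> t n})"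
  proof (rule congruent2I'; rule equiv_class_eq[OF equiv_null_rel])
    fix s s' t t' assume a: "(s, s') \<in> null_rel A" "(t, t') \<in> null_rel A"
    then have c: "cauchy s" "cauchy s'" "cauchy t" "cauchy t'" unfolding null_rel_def by auto
    obtain C where C: "0 < C" "\<And>n. nrm A (s' n) \<le> C" using cauchy_wrt_bounded[OF c(2)] by metis
    obtain D where D: "0 < D" "\<And>n. nrm A (t n) \<le> D" using cauchy_wrt_bounded[OF c(3)] by metis
    note car = c[THEN cauchy_wrtD]
    have "nrm A (s n \<otimes> t n \<ominus> s' n \<otimes> t' n) \<le> nrm A (s n \<ominus> s' n) * D + C * nrm A (t n \<ominus> t' n)" for n
    proof -
      have "nrm A (s n \<ominus> s' n) * nrm A (t n) \<le> nrm A (s n \<ominus> s' n) * D"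
        using D car seminorm_nonneg by (intro mult_left_mono) auto
      moreover have "nrm A (s' n) * nrm A (t n \<ominus> t' n) \<le> C * nrm A (t n \<ominus> t' n)"
        using C car seminorm_nonneg by (intro mult_right_mono) auto
      ultimately show ?thesis using mult_minus_le[of "s n" "t n" "s' n" "t' n"] car by simp
    qed
    moreover have "(\<lambda>n. nrm A (s n \<ominus> s' n) * D + C * nrm A (t n \<ominus> t' n)) \<longlonglongrightarrow> 0"
      using a by (auto simp: null_rel_def intro!: tendsto_add_zero tendsto_mult_right_zero tendsto_mult_left_zero)
    ultimately show "(\<lambda>n. s n \<otimes> t n, \<lambda>n. s' n \<otimes> t' n) \<in> null_rel A"
      using c by (intro null_relI[where g = "\<lambda>n. nrm A (s n \<ominus> s' n) * D + C * nrm A (t n \<ominus> t' n)"] cauchy_mult)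
  qed
  then show ?thesis
    using assms by (simp add: completion_def UN_equiv_class2[OF equiv_null_rel equiv_null_rel])
qed

lemma completion_scale:
  assumes "cauchy s"
  shows "c \<odot>\<^bsub>completion A\<^esub> null_rel A `` {s} = null_rel A `` {\<lambda>n. c \<odot> s n}"
proof -
  have "(\<lambda>s. null_rel A `` {\<lambda>n. c \<odot> s n}) respects null_rel A"
  proof (rule congruentI; rule equiv_class_eq[OF equiv_null_rel])
    fix s s' assume a: "(s, s') \<in> null_rel A"
    then have c: "cauchy s" "cauchy s'" unfolding null_rel_def by auto
    then show "(\<lambda>n. c \<odot> s n, \<lambda>n. c \<odot> s' n) \<in> null_rel A"
      using a by (intro null_relI[where g = "\<lambda>n. cmod c * nrm A (s n \<ominus> s' n)"])
        (auto simp: null_rel_def scale_minus seminorm_scale cauchy_wrtD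
          intro: cauchy_scale tendsto_mult_right_zero)
  qed
  then show ?thesis
    using assms by (simp add: completion_def UN_equiv_class[OF equiv_null_rel])
qed

lemma completion_star:
  assumes "cauchy s"
  shows "star (completion A) (null_rel A `` {s}) = null_rel A `` {\<lambda>n. star A (s n)}"
proof -
  have "(\<lambda>s. null_rel A `` {\<lambda>n. star A (s n)}) respects null_rel A"
  proof (rule congruentI; rule equiv_class_eq[OF equiv_null_rel])
    fix s s' assume a: "(s, s') \<in> null_rel A"
    then have c: "cauchy s" "cauchy s'" unfolding null_rel_def by auto
    then show "(\<lambda>n. star A (s n), \<lambda>n. star A (s' n)) \<in> null_rel A"
      using a by (intro null_relI[where g = "\<lambda>n. nrm A (s n \<ominus> s' n)"])
        (auto simp: null_rel_def star_minus nrm_star cauchy_wrtD intro: cauchy_star)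
  qed
  then show ?thesis
    using assms by (simp add: completion_def UN_equiv_class[OF equiv_null_rel])
qed

lemma completion_carrierE:
  assumes "X \<in> carrier (completion A)" obtains s where "cauchy s" "X = null_rel A `` {s}"
  using assms unfolding completion_def quotient_def by auto

lemma completion_carrierI: "cauchy s \<Longrightarrow> null_rel A `` {s} \<in> carrier (completion A)"
  unfolding completion_def quotient_def by auto

end

text \<open>That the norm is not increased makes the extension well defined on classes; that it is not
  decreased makes the extension injective.\<close>

locale isometric_star_hom =
  A: seminormed_star_algebra A + A': seminormed_star_algebra A'
  for A :: "('v, 'm) star_algebra_scheme" and A' :: "('w, 'n) star_algebra_scheme" +
  fixes f :: "'v \<Rightarrow> 'w"
  assumes star_hom: "star_hom A A' f"
    and isometric: "a \<in> carrier A \<Longrightarrow> nrm A' (f a) = nrm A a"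
begin

lemma hom_closed: "a \<in> carrier A \<Longrightarrow> f a \<in> carrier A'"
  using star_hom unfolding star_hom_def by blast

lemma hom_minus:
  assumes "a \<in> carrier A" "b \<in> carrier A"
  shows "f a \<ominus>\<^bsub>A'\<^esub> f b = f (a \<ominus>\<^bsub>A\<^esub> b)"
proof (rule A'.minus_eqI)
  have "f (a \<ominus>\<^bsub>A\<^esub> b) \<oplus>\<^bsub>A'\<^esub> f b = f ((a \<ominus>\<^bsub>A\<^esub> b) \<oplus>\<^bsub>A\<^esub> b)"
    using star_hom assms unfolding star_hom_def by simp
  then show "f a = f (a \<ominus>\<^bsub>A\<^esub> b) \<oplus>\<^bsub>A'\<^esub> f b" using assms by (simp add: A.add_minus_cancel)
qed (use assms hom_closed in auto)

lemma cauchy_hom: "A.cauchy s \<Longrightarrow> A'.cauchy (\<lambda>n. f (s n))"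
  by (rule cauchy_wrt_image[where C = 1]) (auto simp: hom_closed hom_minus isometric)

lemma null_rel_hom_iff:
  assumes "A.cauchy s" "A.cauchy t"
  shows "(\<lambda>n. f (s n), \<lambda>n. f (t n)) \<in> null_rel A' \<longleftrightarrow> (s, t) \<in> null_rel A"
  using assms cauchy_hom by (simp add: null_rel_def hom_minus isometric A.cauchy_wrtD)

lemma extend_class:
  assumes "A.cauchy s"
  shows "extend_to_completion A A' f (null_rel A `` {s}) = null_rel A' `` {\<lambda>n. f (s n)}"
proof -
  have "(\<lambda>s. null_rel A' `` {\<lambda>n. f (s n)}) respects null_rel A"
  proof (rule congruentI; rule equiv_class_eq[OF A'.equiv_null_rel])
    fix s t assume st: "(s, t) \<in> null_rel A"
    then have "A.cauchy s" "A.cauchy t" unfolding null_rel_def by auto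
    then show "(\<lambda>n. f (s n), \<lambda>n. f (t n)) \<in> null_rel A'" using st null_rel_hom_iff by blast
  qed
  then show ?thesis
    using assms unfolding extend_to_completion_def by (simp add: UN_equiv_class[OF A.equiv_null_rel])
qed

lemma extend_to_completion_eq:
  "a \<in> carrier A \<Longrightarrow> extend_to_completion A A' f (to_completion A a) = to_completion A' (f a)"
  unfolding to_completion_def by (simp add: extend_class)

lemma star_hom_extend: "star_hom (completion A) (completion A') (extend_to_completion A A' f)"
proof -
  let ?f = "extend_to_completion A A' f"
  have hom: "\<And>a b. a \<in> carrier A \<Longrightarrow> b \<in> carrier A \<Longrightarrow> f (a \<oplus>\<^bsub>A\<^esub> b) = f a \<oplus>\<^bsub>A'\<^esub> f b"
    "\<And>c a. a \<in> carrier A \<Longrightarrow> f (c \<odot>\<^bsub>A\<^esub> a) = c \<odot>\<^bsub>A'\<^esub> f a"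
    "\<And>a b. a \<in> carrier A \<Longrightarrow> b \<in> carrier A \<Longrightarrow> f (a \<otimes>\<^bsub>A\<^esub> b) = f a \<otimes>\<^bsub>A'\<^esub> f b"
    "\<And>a. a \<in> carrier A \<Longrightarrow> f (star A a) = star A' (f a)"
    using star_hom unfolding star_hom_def by auto
  note A_simps = A.completion_add A.completion_mult A.completion_scale A.completion_star
  note A'_simps = A'.completion_add A'.completion_mult A'.completion_scale A'.completion_star
  note cauchy = A.cauchy_wrt_add A.cauchy_mult A.cauchy_scale A.cauchy_star
  show ?thesis unfolding star_hom_def
    by (auto elim!: A.completion_carrierE
        simp: A_simps A'_simps extend_class cauchy cauchy_hom hom A.cauchy_wrtD
        intro!: A'.completion_carrierI)
qed

lemma inj_on_extend: "inj_on (extend_to_completion A A' f) (carrier (completion A))"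
proof (rule inj_onI)
  fix X Y assume X: "X \<in> carrier (completion A)" and Y: "Y \<in> carrier (completion A)"
    and eq: "extend_to_completion A A' f X = extend_to_completion A A' f Y"
  obtain s where s: "A.cauchy s" "X = null_rel A `` {s}" using X by (rule A.completion_carrierE)
  obtain t where t: "A.cauchy t" "Y = null_rel A `` {t}" using Y by (rule A.completion_carrierE)
  have "(\<lambda>n. f (s n), \<lambda>n. f (t n)) \<in> null_rel A'"
    using eq s t cauchy_hom by (simp add: extend_class eq_equiv_class_iff[OF A'.equiv_null_rel])
  then show "X = Y" using s t by (simp add: null_rel_hom_iff eq_equiv_class_iff[OF A.equiv_null_rel])
qed

end

section \<open>Hilbert spaces\<close>

context hilbert_space
begin

lemma ip_add_right: "u \<in> carrier H \<Longrightarrow> v \<in> carrier H \<Longrightarrow> w \<in> carrier H \<Longrightarrow>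
    ip H w (u \<oplus> v) = ip H w u + ip H w v"
  using ip_cnj[of w "u \<oplus> v"] ip_cnj[of w u] ip_cnj[of w v] by (simp add: ip_add)

lemma ip_scale_right: "u \<in> carrier H \<Longrightarrow> v \<in> carrier H \<Longrightarrow> ip H u (c \<odot> v) = cnj c * ip H u v"
  using ip_cnj[of u "c \<odot> v"] ip_cnj[of u v] by (simp add: ip_scale)

lemma ip_zero_left [simp]: "v \<in> carrier H \<Longrightarrow> ip H \<zero> v = 0"
  using ip_scale[of v v 0] smult_l_null[of v] by simp

lemma ip_zero_right [simp]: "v \<in> carrier H \<Longrightarrow> ip H v \<zero> = 0"
  using ip_cnj[of v \<zero>] by simp

lemma ip_minus_left:
  "u \<in> carrier H \<Longrightarrow> v \<in> carrier H \<Longrightarrow> w \<in> carrier H \<Longrightarrow> ip H (u \<ominus> v) w = ip H u w - ip H v w"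
  using complex_module_minus(2)[OF module_axioms, of u v] by (simp add: ip_add ip_scale)

lemma ip_self: "v \<in> carrier H \<Longrightarrow> ip H v v = of_real ((hnorm H v)\<^sup>2)"
  using arg_cong[OF ip_cnj[of v v], of Im] ip_pos[of v]
  unfolding hnorm_def by (simp add: complex_eq_iff)

lemma hnorm_nonneg [simp]: "v \<in> carrier H \<Longrightarrow> 0 \<le> hnorm H v"
  unfolding hnorm_def using ip_pos by simp

lemma hnorm_eq_zero: "v \<in> carrier H \<Longrightarrow> hnorm H v = 0 \<longleftrightarrow> v = \<zero>"
  using ip_self[of v] ip_definite[of v] by (auto simp: hnorm_def)

lemma hnorm_add_scale_square:
  assumes "u \<in> carrier H" "v \<in> carrier H"
  shows "(hnorm H (u \<oplus> c \<odot> v))\<^sup>2 = (hnorm H u)\<^sup>2 + 2 * Re (c * ip H v u) + (cmod c)\<^sup>2 * (hnorm H v)\<^sup>2"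
proof -
  have "ip H (u \<oplus> c \<odot> v) (u \<oplus> c \<odot> v)
      = ip H u u + (c * ip H v u + cnj (c * ip H v u)) + c * cnj c * ip H v v"
    using assms ip_cnj[of u v] by (simp add: ip_add ip_add_right ip_scale ip_scale_right algebra_simps)
  also have "\<dots> = of_real ((hnorm H u)\<^sup>2 + 2 * Re (c * ip H v u) + (cmod c)\<^sup>2 * (hnorm H v)\<^sup>2)"
    unfolding complex_add_cnj complex_norm_square[symmetric] using assms by (simp add: ip_self)
  finally have eq: "ip H (u \<oplus> c \<odot> v) (u \<oplus> c \<odot> v)
      = of_real ((hnorm H u)\<^sup>2 + 2 * Re (c * ip H v u) + (cmod c)\<^sup>2 * (hnorm H v)\<^sup>2)" .
  have "u \<oplus> c \<odot> v \<in> carrier H" using assms by simp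
  then have "complex_of_real ((hnorm H (u \<oplus> c \<odot> v))\<^sup>2)
      = of_real ((hnorm H u)\<^sup>2 + 2 * Re (c * ip H v u) + (cmod c)\<^sup>2 * (hnorm H v)\<^sup>2)"
    unfolding eq[symmetric] by (rule ip_self[symmetric])
  then show ?thesis by (simp only: of_real_eq_iff)
qed

text \<open>The square of the norm of \<open>u + c v\<close> is nonnegative; the best choice of \<open>c\<close> is minus the inner
  product of \<open>u\<close> and \<open>v\<close> divided by the square of the norm of \<open>v\<close>.\<close>

lemma cauchy_schwarz:
  assumes u: "u \<in> carrier H" and v: "v \<in> carrier H"
  shows "cmod (ip H u v) \<le> hnorm H u * hnorm H v"
proof (cases "hnorm H v = 0")
  case True
  then have "v = \<zero>" using hnorm_eq_zero[OF v] by blast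
  then show ?thesis using u True by simp
next
  case False
  define p where "p = ip H v u"
  define r where "r = inverse ((hnorm H v)\<^sup>2)"
  have "0 \<le> (hnorm H (u \<oplus> (- (cnj p * of_real r)) \<odot> v))\<^sup>2" by simp
  also have "\<dots> = (hnorm H u)\<^sup>2 + 2 * Re (- (cnj p * of_real r) * p)
      + (cmod (- (cnj p * of_real r)))\<^sup>2 * (hnorm H v)\<^sup>2"
    using hnorm_add_scale_square[OF u v] unfolding p_def .
  also have "- (cnj p * of_real r) * p = of_real (- ((cmod p)\<^sup>2 * r))"
  proof -
    have "- (cnj p * of_real r) * p = - ((p * cnj p) * of_real r)" by (simp add: ac_simps)
    also have "\<dots> = - (of_real ((cmod p)\<^sup>2) * of_real r)" by (simp only: complex_norm_square)
    finally show ?thesis by simp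
  qed
  also have "(cmod (- (cnj p * of_real r)))\<^sup>2 = (cmod p)\<^sup>2 * (r * r)"
    by (simp add: norm_mult power_mult_distrib power2_eq_square)
  finally have "0 \<le> (hnorm H u)\<^sup>2 - 2 * ((cmod p)\<^sup>2 * r) + (cmod p)\<^sup>2 * (r * (r * (hnorm H v)\<^sup>2))"
    by (simp add: mult.assoc)
  moreover have r: "r * (hnorm H v)\<^sup>2 = 1" using False unfolding r_def by simp
  ultimately have "0 \<le> (hnorm H u)\<^sup>2 - 2 * ((cmod p)\<^sup>2 * r) + (cmod p)\<^sup>2 * (r * 1)"
    by (simp only: r)
  then have "(cmod p)\<^sup>2 * r \<le> (hnorm H u)\<^sup>2" by linarith
  then have "(cmod p)\<^sup>2 \<le> (hnorm H u)\<^sup>2 * (hnorm H v)\<^sup>2"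
    using False unfolding r_def by (simp add: field_simps)
  then have "cmod p \<le> hnorm H u * hnorm H v"
    using u v by (rule_tac power2_le_imp_le) (auto simp: power_mult_distrib)
  moreover have "cmod (ip H u v) = cmod p" unfolding p_def ip_cnj[OF u v] by simp
  ultimately show ?thesis by simp
qed

lemma hnorm_triangle:
  assumes u: "u \<in> carrier H" and v: "v \<in> carrier H"
  shows "hnorm H (u \<oplus> v) \<le> hnorm H u + hnorm H v"
proof -
  have "(hnorm H (u \<oplus> v))\<^sup>2 = (hnorm H u)\<^sup>2 + 2 * Re (ip H v u) + (hnorm H v)\<^sup>2"
    using hnorm_add_scale_square[OF u v, of 1] smult_one[OF v] by simp
  also have "\<dots> \<le> (hnorm H u)\<^sup>2 + 2 * (hnorm H v * hnorm H u) + (hnorm H v)\<^sup>2"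
    using cauchy_schwarz[OF v u] complex_Re_le_cmod[of "ip H v u"] by simp
  also have "\<dots> = (hnorm H u + hnorm H v)\<^sup>2" by (simp add: power2_sum algebra_simps)
  finally show ?thesis using u v by (rule_tac power2_le_imp_le) auto
qed

lemma hnorm_scale: "v \<in> carrier H \<Longrightarrow> hnorm H (c \<odot> v) = cmod c * hnorm H v"
proof -
  assume v: "v \<in> carrier H"
  then have "(hnorm H (c \<odot> v))\<^sup>2 = (cmod c * hnorm H v)\<^sup>2"
    using hnorm_add_scale_square[of \<zero> v c] hnorm_eq_zero[of \<zero>] by (simp add: power_mult_distrib)
  then show "hnorm H (c \<odot> v) = cmod c * hnorm H v" using v by (simp add: power2_eq_iff_nonneg)
qed

sublocale seminormed_space H "hnorm H"
  by unfold_locales (auto simp: hnorm_scale hnorm_triangle)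

lemma minus_minus_cancel: "u \<in> carrier H \<Longrightarrow> v \<in> carrier H \<Longrightarrow> u \<ominus> (u \<ominus> v) = v"
  by (simp add: a_minus_def M.minus_add M.r_neg1 M.r_neg2)

lemma bdd_above_operator:
  assumes T: "bounded_operator H T"
  shows "bdd_above {hnorm H (T v) | v. v \<in> carrier H \<and> hnorm H v \<le> 1}"
proof -
  obtain C where C: "\<And>w. w \<in> carrier H \<Longrightarrow> hnorm H (T w) \<le> C * hnorm H w"
    using T unfolding bounded_operator_def by blast
  show ?thesis
  proof (rule bdd_aboveI[where M = "max C 0"])
    fix r assume "r \<in> {hnorm H (T w) | w. w \<in> carrier H \<and> hnorm H w \<le> 1}"
    then obtain w where w: "r = hnorm H (T w)" "w \<in> carrier H" "hnorm H w \<le> 1" by blast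
    have "C * hnorm H w \<le> max C 0 * 1"
      using w by (intro mult_mono) auto
    then show "r \<le> max C 0" using C[of w] w by simp
  qed
qed

lemma operator_norm_nonneg:
  assumes T: "bounded_operator H T" shows "0 \<le> operator_norm H T"
proof -
  have "T \<zero> \<in> carrier H" using T unfolding bounded_operator_def by blast
  then have "0 \<le> hnorm H (T \<zero>)" by simp
  also have "\<dots> \<le> operator_norm H T"
    unfolding operator_norm_def by (intro cSup_upper[OF _ bdd_above_operator[OF T]]) auto
  finally show ?thesis .
qed

lemma hnorm_le_operator_norm:
  assumes T: "bounded_operator H T" and v: "v \<in> carrier H"
  shows "hnorm H (T v) \<le> operator_norm H T * hnorm H v"
proof (cases "hnorm H v = 0")
  case True
  then show ?thesis using T v unfolding bounded_operator_def by auto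
next
  case False
  have Tv: "T v \<in> carrier H" using T v unfolding bounded_operator_def by blast
  define w where "w = of_real (inverse (hnorm H v)) \<odot> v"
  have w: "w \<in> carrier H" "hnorm H w = 1"
    using False v unfolding w_def by (auto simp: hnorm_scale norm_inverse)
  have "T w = of_real (inverse (hnorm H v)) \<odot> T v"
    using T v unfolding w_def bounded_operator_def by simp
  then have "hnorm H (T w) = inverse (hnorm H v) * hnorm H (T v)"
    using v Tv by (simp add: hnorm_scale norm_inverse)
  moreover have "hnorm H (T w) \<le> operator_norm H T"
    unfolding operator_norm_def using w by (intro cSup_upper[OF _ bdd_above_operator[OF T]]) auto
  ultimately have "inverse (hnorm H v) * hnorm H (T v) \<le> operator_norm H T" by simp
  moreover have "0 < hnorm H v" using False hnorm_nonneg[OF v] by linarith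
  ultimately show ?thesis by (simp add: field_simps)
qed

lemma operator_norm_le:
  assumes "0 \<le> C" "\<And>v. v \<in> carrier H \<Longrightarrow> hnorm H (T v) \<le> C * hnorm H v"
  shows "operator_norm H T \<le> C"
  unfolding operator_norm_def
proof (rule cSup_least)
  show "{hnorm H (T v) | v. v \<in> carrier H \<and> hnorm H v \<le> 1} \<noteq> {}"
    using hnorm_eq_zero[of \<zero>] by (auto intro!: exI[of _ \<zero>])
  fix r assume "r \<in> {hnorm H (T v) | v. v \<in> carrier H \<and> hnorm H v \<le> 1}"
  then obtain v where v: "r = hnorm H (T v)" "v \<in> carrier H" "hnorm H v \<le> 1" by blast
  then show "r \<le> C" using assms(2)[of v] mult_left_mono[OF v(3) assms(1)] by simp
qed

text \<open>With \<open>w = S u\<close> and \<open>w' = S\<^sup>* w\<close> this turns a bound for \<open>S\<^sup>*\<close> on the range of \<open>S\<close> into a bound for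
  \<open>S\<close> on the whole space.\<close>

lemma adjoint_bound:
  assumes u: "u \<in> carrier H" and w: "w \<in> carrier H" and w': "w' \<in> carrier H"
    and adj: "ip H w w = ip H u w'" and le: "hnorm H w' \<le> c * hnorm H w" and "0 \<le> c"
  shows "hnorm H w \<le> c * hnorm H u"
proof (cases "hnorm H w = 0")
  case True
  then show ?thesis using u \<open>0 \<le> c\<close> by simp
next
  case False
  have "(hnorm H w)\<^sup>2 = cmod (ip H u w')"
    unfolding adj[symmetric] ip_self[OF w] by (simp del: of_real_power)
  also have "\<dots> \<le> hnorm H u * hnorm H w'" by (rule cauchy_schwarz[OF u w'])
  also have "\<dots> \<le> hnorm H u * (c * hnorm H w)" using le u by (intro mult_left_mono) auto
  finally have "hnorm H w * hnorm H w \<le> (c * hnorm H u) * hnorm H w"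
    by (simp add: power2_eq_square ac_simps)
  moreover have "0 < hnorm H w" using False hnorm_nonneg[OF w] by linarith
  ultimately show ?thesis using mult_right_le_imp_le by blast
qed

subsection \<open>Orthogonal complements\<close>

definition orth :: "'v set \<Rightarrow> 'v set" where
  "orth S = {v \<in> carrier H. \<forall>w\<in>S. ip H v w = 0}"

definition closed_subspace :: "'v set \<Rightarrow> bool" where
  "closed_subspace M \<longleftrightarrow> M \<subseteq> carrier H \<and> \<zero> \<in> M \<and> (\<forall>u\<in>M. \<forall>v\<in>M. u \<oplus> v \<in> M) \<and>
     (\<forall>c. \<forall>v\<in>M. c \<odot> v \<in> M) \<and>
     (\<forall>s v. (\<forall>n. s n \<in> M) \<longrightarrow> v \<in> carrier H \<longrightarrow> (\<lambda>n. hnorm H (s n \<ominus> v)) \<longlonglongrightarrow> 0 \<longrightarrow> v \<in> M)"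

lemma closed_subspace_orth:
  assumes S: "S \<subseteq> carrier H" shows "closed_subspace (orth S)"
  unfolding closed_subspace_def
proof (intro conjI ballI allI impI)
  fix s v assume s: "\<forall>n. s n \<in> orth S" and v: "v \<in> carrier H"
    and lim: "(\<lambda>n. hnorm H (s n \<ominus> v)) \<longlonglongrightarrow> 0"
  have "ip H v w = 0" if w: "w \<in> S" for w
  proof -
    have wH: "w \<in> carrier H" using w S by blast
    have "cmod (ip H v w) \<le> hnorm H (s n \<ominus> v) * hnorm H w" for n
    proof -
      have "s n \<in> carrier H" "ip H (s n) w = 0" using s w unfolding orth_def by auto
      then show ?thesis using cauchy_schwarz[of "s n \<ominus> v" w] v wH by (simp add: ip_minus_left)
    qed
    moreover have "(\<lambda>n. hnorm H (s n \<ominus> v) * hnorm H w) \<longlonglongrightarrow> 0"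
      using lim by (rule tendsto_mult_left_zero)
    ultimately have "cmod (ip H v w) \<le> 0" by (intro LIMSEQ_le_const) auto
    then show ?thesis by simp
  qed
  then show "v \<in> orth S" using v unfolding orth_def by simp
qed (use S in \<open>auto simp: orth_def subset_iff ip_add ip_scale\<close>)

end

subsection \<open>Transport of a closed subspace along an injection\<close>

text \<open>The universal norm only sees Hilbert spaces on one type of complex functions. A Hilbert space
  on another type can be moved there along any map that is injective on its carrier; moving a closed
  subspace is the form needed for subrepresentations.\<close>

definition transported_space ::
    "('v, 'm) hilbert_scheme \<Rightarrow> 'v set \<Rightarrow> ('v \<Rightarrow> 'w) \<Rightarrow> 'w hilbert" where
  "transported_space H M j = (let q = the_inv_into M j in
     \<lparr>carrier = j ` M, mult = undefined, one = undefined, zero = j \<zero>\<^bsub>H\<^esub>,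
      add = (\<lambda>a b. j (q a \<oplus>\<^bsub>H\<^esub> q b)), smult = (\<lambda>c a. j (c \<odot>\<^bsub>H\<^esub> q a)),
      ip = (\<lambda>a b. ip H (q a) (q b))\<rparr>)"

locale subspace_transport = hilbert_space H
  for H :: "('v, 'm) hilbert_scheme" (structure) +
  fixes M :: "'v set" and j :: "'v \<Rightarrow> 'w"
  assumes closed: "closed_subspace M" and inj: "inj_on j M"
begin

abbreviation "T \<equiv> transported_space H M j"
abbreviation "q \<equiv> the_inv_into M j"

lemma in_M [simp, intro]:
  "\<zero> \<in> M" "u \<in> M \<Longrightarrow> v \<in> M \<Longrightarrow> u \<oplus> v \<in> M" "v \<in> M \<Longrightarrow> c \<odot> v \<in> M" "v \<in> M \<Longrightarrow> v \<in> carrier H"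
  using closed unfolding closed_subspace_def by blast+

lemma minus_in_M: "u \<in> M \<Longrightarrow> v \<in> M \<Longrightarrow> u \<ominus> v \<in> M"
  by (simp add: complex_module_minus(2)[OF module_axioms])

lemma q_j [simp]: "v \<in> M \<Longrightarrow> q (j v) = v"
  using inj by (simp add: the_inv_into_f_f)

lemma transported_simps [simp]:
  "carrier T = j ` M" "\<zero>\<^bsub>T\<^esub> = j \<zero>"
  "u \<in> M \<Longrightarrow> v \<in> M \<Longrightarrow> j u \<oplus>\<^bsub>T\<^esub> j v = j (u \<oplus> v)"
  "v \<in> M \<Longrightarrow> c \<odot>\<^bsub>T\<^esub> j v = j (c \<odot> v)"
  "u \<in> M \<Longrightarrow> v \<in> M \<Longrightarrow> ip T (j u) (j v) = ip H u v"
  "v \<in> M \<Longrightarrow> hnorm T (j v) = hnorm H v"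
  by (simp_all add: transported_space_def Let_def hnorm_def)

lemma transported_module: "Module.module complex_ring T"
  by (rule complex_moduleI)
    (auto simp: M.a_ac smult_l_distr[simplified] smult_r_distr[simplified]
      smult_assoc1[simplified] smult_one[simplified] smult_l_null[simplified])

lemma transported_minus: "u \<in> M \<Longrightarrow> v \<in> M \<Longrightarrow> j u \<ominus>\<^bsub>T\<^esub> j v = j (u \<ominus> v)"
  using complex_module_minus(2)[OF transported_module, of "j u" "j v"]
    complex_module_minus(2)[OF module_axioms, of u v] by simp

lemma transported_hilbert_space: "hilbert_space T"
proof -
  have cnj: "\<And>u v. u \<in> M \<Longrightarrow> v \<in> M \<Longrightarrow> ip H u v = cnj (ip H v u)" using ip_cnj by blast
  have "\<exists>v\<in>carrier T. (\<lambda>n. hnorm T (s n \<ominus>\<^bsub>T\<^esub> v)) \<longlonglongrightarrow> 0"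
    if s: "cauchy_wrt T (hnorm T) s" for s
  proof -
    define t where "t = (\<lambda>n. q (s n))"
    have t: "t n \<in> M" "s n = j (t n)" for n
      using s unfolding t_def cauchy_wrt_def by (auto simp: image_iff) (metis q_j)+
    have "cauchy_wrt H (hnorm H) t"
      using s t(1) unfolding cauchy_wrt_def t(2) by (simp add: transported_minus minus_in_M in_M)
    then obtain v where v: "v \<in> carrier H" "(\<lambda>n. hnorm H (t n \<ominus> v)) \<longlonglongrightarrow> 0"
      using complete by blast
    then have "v \<in> M" using closed t(1) unfolding closed_subspace_def by blast
    then show ?thesis using v t by (auto intro!: bexI[of _ v] simp: transported_minus minus_in_M)
  qed
  moreover have "u = \<zero>\<^bsub>T\<^esub>" if u: "u \<in> carrier T" "ip T u u = 0" for u
  proof -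
    obtain v where v: "v \<in> M" "u = j v" using u by auto
    then have "v = \<zero>" using u(2) by (intro ip_definite) auto
    then show ?thesis using v by simp
  qed
  moreover have "ip T u v = cnj (ip T v u)" if uv: "u \<in> carrier T" "v \<in> carrier T" for u v
  proof -
    obtain a b where ab: "a \<in> M" "u = j a" "b \<in> M" "v = j b" using uv by auto
    then show ?thesis using cnj[OF ab(1,3)] by simp
  qed
  moreover have "ip T (u \<oplus>\<^bsub>T\<^esub> v) w = ip T u w + ip T v w" "ip T (c \<odot>\<^bsub>T\<^esub> u) v = c * ip T u v"
    "0 \<le> Re (ip T u u)" if "u \<in> carrier T" "v \<in> carrier T" "w \<in> carrier T" for u v w c
    using that by (auto simp: ip_add ip_scale ip_pos)
  ultimately show ?thesis
    by (intro hilbert_space.intro[OF transported_module] hilbert_space_axioms.intro) blast+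
qed

end

subsection \<open>Square-summable families\<close>

text \<open>Families are extensional, so that equality of vectors is equality of their components.\<close>

definition l2_space :: "'i set \<Rightarrow> ('v, 'm) hilbert_scheme \<Rightarrow> ('i \<Rightarrow> 'v) hilbert" where
  "l2_space I H =
     \<lparr>carrier = {\<eta> \<in> I \<rightarrow>\<^sub>E carrier H. (\<lambda>i. (hnorm H (\<eta> i))\<^sup>2) summable_on I},
      mult = undefined, one = undefined, zero = (\<lambda>i\<in>I. \<zero>\<^bsub>H\<^esub>),
      add = (\<lambda>\<eta> \<zeta>. \<lambda>i\<in>I. \<eta> i \<oplus>\<^bsub>H\<^esub> \<zeta> i), smult = (\<lambda>c \<eta>. \<lambda>i\<in>I. c \<odot>\<^bsub>H\<^esub> \<eta> i),
      ip = (\<lambda>\<eta> \<zeta>. \<Sum>\<^sub>\<infinity>i\<in>I. ip H (\<eta> i) (\<zeta> i))\<rparr>"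

lemma l2_simps [simp]:
  "\<zero>\<^bsub>l2_space I H\<^esub> = (\<lambda>i\<in>I. \<zero>\<^bsub>H\<^esub>)"
  "\<eta> \<oplus>\<^bsub>l2_space I H\<^esub> \<zeta> = (\<lambda>i\<in>I. \<eta> i \<oplus>\<^bsub>H\<^esub> \<zeta> i)"
  "c \<odot>\<^bsub>l2_space I H\<^esub> \<eta> = (\<lambda>i\<in>I. c \<odot>\<^bsub>H\<^esub> \<eta> i)"
  "ip (l2_space I H) \<eta> \<zeta> = (\<Sum>\<^sub>\<infinity>i\<in>I. ip H (\<eta> i) (\<zeta> i))"
  by (simp_all add: l2_space_def)

context hilbert_space
begin

lemma l2_carrierI:
  "\<lbrakk>\<And>i. i \<in> I \<Longrightarrow> \<eta> i \<in> carrier H; \<eta> \<in> extensional I; (\<lambda>i. (hnorm H (\<eta> i))\<^sup>2) summable_on I\<rbrakk>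
    \<Longrightarrow> \<eta> \<in> carrier (l2_space I H)"
  unfolding l2_space_def by (auto simp: PiE_def)

lemma l2_carrierD:
  assumes "\<eta> \<in> carrier (l2_space I H)"
  shows "i \<in> I \<Longrightarrow> \<eta> i \<in> carrier H" "\<eta> \<in> extensional I"
    "(\<lambda>i. (hnorm H (\<eta> i))\<^sup>2) summable_on I"
  using assms unfolding l2_space_def by (auto simp: PiE_def)

lemma l2_ip_summable:
  assumes "\<eta> \<in> carrier (l2_space I H)" "\<zeta> \<in> carrier (l2_space I H)"
  shows "(\<lambda>i. ip H (\<eta> i) (\<zeta> i)) summable_on I"
proof (rule abs_summable_summable, rule summable_on_comparison_test)
  show "(\<lambda>i. (hnorm H (\<eta> i))\<^sup>2 + (hnorm H (\<zeta> i))\<^sup>2) summable_on I"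
    using assms by (intro summable_on_add l2_carrierD)
  fix i assume i: "i \<in> I"
  note car = l2_carrierD(1)[OF assms(1) i] l2_carrierD(1)[OF assms(2) i]
  have "cmod (ip H (\<eta> i) (\<zeta> i)) \<le> hnorm H (\<eta> i) * hnorm H (\<zeta> i)" using car by (rule cauchy_schwarz)
  moreover have "2 * hnorm H (\<eta> i) * hnorm H (\<zeta> i) \<le> (hnorm H (\<eta> i))\<^sup>2 + (hnorm H (\<zeta> i))\<^sup>2"
    by (rule sum_squares_bound)
  moreover have "0 \<le> hnorm H (\<eta> i) * hnorm H (\<zeta> i)" using car by simp
  ultimately show "cmod (ip H (\<eta> i) (\<zeta> i)) \<le> (hnorm H (\<eta> i))\<^sup>2 + (hnorm H (\<zeta> i))\<^sup>2"
    by linarith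
qed simp

lemma l2_add_closed:
  assumes "\<eta> \<in> carrier (l2_space I H)" "\<zeta> \<in> carrier (l2_space I H)"
  shows "(\<lambda>i\<in>I. \<eta> i \<oplus> \<zeta> i) \<in> carrier (l2_space I H)"
proof (rule l2_carrierI)
  have le: "(hnorm H (\<eta> i \<oplus> \<zeta> i))\<^sup>2 \<le> 2 * (hnorm H (\<eta> i))\<^sup>2 + 2 * (hnorm H (\<zeta> i))\<^sup>2"
    if i: "i \<in> I" for i
  proof -
    have "hnorm H (\<eta> i \<oplus> \<zeta> i) \<le> hnorm H (\<eta> i) + hnorm H (\<zeta> i)"
      and "0 \<le> hnorm H (\<eta> i \<oplus> \<zeta> i)"
      using l2_carrierD(1)[OF assms(1) i] l2_carrierD(1)[OF assms(2) i] by (simp_all add: hnorm_triangle)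
    then have "(hnorm H (\<eta> i \<oplus> \<zeta> i))\<^sup>2 \<le> (hnorm H (\<eta> i) + hnorm H (\<zeta> i))\<^sup>2" by (rule power_mono)
    moreover have "2 * hnorm H (\<eta> i) * hnorm H (\<zeta> i) \<le> (hnorm H (\<eta> i))\<^sup>2 + (hnorm H (\<zeta> i))\<^sup>2"
      by (rule sum_squares_bound)
    ultimately show ?thesis unfolding power2_sum by linarith
  qed
  have "(\<lambda>i. 2 * (hnorm H (\<eta> i))\<^sup>2 + 2 * (hnorm H (\<zeta> i))\<^sup>2) summable_on I"
    by (intro summable_on_add summable_on_cmult_right l2_carrierD(3) assms)
  then have "(\<lambda>i. (hnorm H (\<eta> i \<oplus> \<zeta> i))\<^sup>2) summable_on I"
    by (rule summable_on_comparison_test) (simp_all add: le)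
  then show "(\<lambda>i. (hnorm H ((\<lambda>i\<in>I. \<eta> i \<oplus> \<zeta> i) i))\<^sup>2) summable_on I"
    by (rule summable_on_cong[THEN iffD1, rotated]) simp
qed (use l2_carrierD(1)[OF assms(1)] l2_carrierD(1)[OF assms(2)] in auto)

lemma l2_scale_closed:
  assumes "\<eta> \<in> carrier (l2_space I H)"
  shows "(\<lambda>i\<in>I. c \<odot> \<eta> i) \<in> carrier (l2_space I H)"
proof (rule l2_carrierI)
  have "(\<lambda>i. (cmod c)\<^sup>2 * (hnorm H (\<eta> i))\<^sup>2) summable_on I"
    using assms by (intro summable_on_cmult_right l2_carrierD)
  then show "(\<lambda>i. (hnorm H ((\<lambda>i\<in>I. c \<odot> \<eta> i) i))\<^sup>2) summable_on I"
    by (rule summable_on_cong[THEN iffD1, rotated])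
      (use l2_carrierD[OF assms] in \<open>simp add: hnorm_scale power_mult_distrib\<close>)
qed (use l2_carrierD(1)[OF assms] in auto)

lemma l2_zero_closed: "(\<lambda>i\<in>I. \<zero>) \<in> carrier (l2_space I H)"
proof (rule l2_carrierI)
  show "(\<lambda>i. (hnorm H ((\<lambda>i\<in>I. \<zero>) i))\<^sup>2) summable_on I"
    by (rule summable_on_0) simp
qed auto

lemma l2_module: "Module.module complex_ring (l2_space I H)"
proof (rule complex_moduleI)
  fix \<eta> assume \<eta>: "\<eta> \<in> carrier (l2_space I H)"
  show "\<zero>\<^bsub>l2_space I H\<^esub> \<oplus>\<^bsub>l2_space I H\<^esub> \<eta> = \<eta>" "1 \<odot>\<^bsub>l2_space I H\<^esub> \<eta> = \<eta>"
    using l2_carrierD[OF \<eta>]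
    by (auto simp: smult_one[simplified] fun_eq_iff restrict_def extensional_def)
qed (auto simp: l2_add_closed l2_scale_closed l2_zero_closed l2_carrierD M.a_assoc
    smult_l_distr[simplified] smult_r_distr[simplified] smult_assoc1[simplified]
    smult_l_null[simplified] intro!: restrict_ext M.a_comm)

lemma l2_minus:
  assumes "\<eta> \<in> carrier (l2_space I H)" "\<zeta> \<in> carrier (l2_space I H)"
  shows "\<eta> \<ominus>\<^bsub>l2_space I H\<^esub> \<zeta> = (\<lambda>i\<in>I. \<eta> i \<ominus> \<zeta> i)"
  using complex_module_minus(2)[OF l2_module assms] l2_carrierD(1)[OF assms(1)] l2_carrierD(1)[OF assms(2)]
  by (auto simp: complex_module_minus(2)[OF module_axioms] intro!: restrict_ext)

lemma l2_norm_square: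
  assumes "\<eta> \<in> carrier (l2_space I H)"
  shows "(hnorm (l2_space I H) \<eta>)\<^sup>2 = (\<Sum>\<^sub>\<infinity>i\<in>I. (hnorm H (\<eta> i))\<^sup>2)"
    and "hnorm (l2_space I H) \<eta> = sqrt (\<Sum>\<^sub>\<infinity>i\<in>I. (hnorm H (\<eta> i))\<^sup>2)"
proof -
  have "ip (l2_space I H) \<eta> \<eta> = (\<Sum>\<^sub>\<infinity>i\<in>I. of_real ((hnorm H (\<eta> i))\<^sup>2))"
    using l2_carrierD[OF assms] by (auto simp: ip_self intro!: infsum_cong)
  also have "\<dots> = of_real (\<Sum>\<^sub>\<infinity>i\<in>I. (hnorm H (\<eta> i))\<^sup>2)"
    by (intro infsumI has_sum_of_real has_sum_infsum l2_carrierD(3)[OF assms])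
  finally show *: "hnorm (l2_space I H) \<eta> = sqrt (\<Sum>\<^sub>\<infinity>i\<in>I. (hnorm H (\<eta> i))\<^sup>2)"
    unfolding hnorm_def[of "l2_space I H"] by simp
  show "(hnorm (l2_space I H) \<eta>)\<^sup>2 = (\<Sum>\<^sub>\<infinity>i\<in>I. (hnorm H (\<eta> i))\<^sup>2)"
    unfolding * by (simp add: infsum_nonneg)
qed

lemma l2_sum_le:
  assumes "\<eta> \<in> carrier (l2_space I H)" "finite F" "F \<subseteq> I"
  shows "(\<Sum>i\<in>F. (hnorm H (\<eta> i))\<^sup>2) \<le> (hnorm (l2_space I H) \<eta>)\<^sup>2"
  unfolding l2_norm_square(1)[OF assms(1)] infsum_finite[OF assms(2), symmetric]
  using assms(3)
  by (intro infsum_mono_neutral summable_on_finite[OF assms(2)] l2_carrierD(3)[OF assms(1)]) auto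

text \<open>A bound on all finite partial sums puts a family into the space and bounds its norm.\<close>

lemma l2_bounded:
  assumes "\<And>i. i \<in> I \<Longrightarrow> \<eta> i \<in> carrier H" "\<eta> \<in> extensional I" "0 \<le> C"
    and "\<And>F. finite F \<Longrightarrow> F \<subseteq> I \<Longrightarrow> (\<Sum>i\<in>F. (hnorm H (\<eta> i))\<^sup>2) \<le> C\<^sup>2"
  shows "\<eta> \<in> carrier (l2_space I H)" and "hnorm (l2_space I H) \<eta> \<le> C"
proof -
  have sm: "(\<lambda>i. (hnorm H (\<eta> i))\<^sup>2) summable_on I"
    by (rule nonneg_bdd_above_summable_on) (use assms in \<open>auto intro!: bdd_aboveI[of _ "C\<^sup>2"]\<close>)
  then show car: "\<eta> \<in> carrier (l2_space I H)" using assms by (intro l2_carrierI)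
  have "(\<Sum>\<^sub>\<infinity>i\<in>I. (hnorm H (\<eta> i))\<^sup>2) \<le> C\<^sup>2" using assms by (intro infsum_le_finite_sums[OF sm])
  then show "hnorm (l2_space I H) \<eta> \<le> C"
    using assms(3) unfolding l2_norm_square(2)[OF car] by (intro real_le_lsqrt) auto
qed

lemma l2_component_le:
  assumes "\<eta> \<in> carrier (l2_space I H)" "i \<in> I"
  shows "hnorm H (\<eta> i) \<le> hnorm (l2_space I H) \<eta>"
proof (rule power2_le_imp_le)
  show "(hnorm H (\<eta> i))\<^sup>2 \<le> (hnorm (l2_space I H) \<eta>)\<^sup>2"
    using l2_sum_le[OF assms(1), of "{i}"] assms by simp
  show "0 \<le> hnorm (l2_space I H) \<eta>"
    unfolding l2_norm_square(2)[OF assms(1)] by (simp add: infsum_nonneg)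
qed

text \<open>A Cauchy sequence converges in each component, since a component is bounded by the norm. The
  family of the limits is square-summable and is the limit in norm by \<open>l2_bounded\<close>.\<close>

lemma l2_complete:
  assumes s: "cauchy_wrt (l2_space I H) (hnorm (l2_space I H)) s"
  shows "\<exists>v\<in>carrier (l2_space I H). (\<lambda>n. hnorm (l2_space I H) (s n \<ominus>\<^bsub>l2_space I H\<^esub> v)) \<longlonglongrightarrow> 0"
proof -
  let ?L = "l2_space I H"
  have sc: "s n \<in> carrier ?L" for n using s unfolding cauchy_wrt_def by blast
  have scH [simp]: "s n i \<in> carrier H" if "i \<in> I" for n i using l2_carrierD(1)[OF sc] that by blast
  have minus_closed: "a \<ominus>\<^bsub>?L\<^esub> b \<in> carrier ?L" if "a \<in> carrier ?L" "b \<in> carrier ?L" for a b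
    using l2_module that by (meson abelian_group.minus_closed Module.module.axioms(2))
  have "\<exists>v\<in>carrier H. (\<lambda>n. hnorm H (s n i \<ominus> v)) \<longlonglongrightarrow> 0" if i: "i \<in> I" for i
  proof (rule complete, unfold cauchy_wrt_def, intro conjI allI impI)
    show "s n i \<in> carrier H" for n using i by simp
    fix e :: real assume "e > 0"
    then obtain n0 where n0: "\<forall>m\<ge>n0. \<forall>n\<ge>n0. hnorm ?L (s m \<ominus>\<^bsub>?L\<^esub> s n) < e"
      using s unfolding cauchy_wrt_def by blast
    have "hnorm H (s m i \<ominus> s n i) \<le> hnorm ?L (s m \<ominus>\<^bsub>?L\<^esub> s n)" for m n
      using l2_component_le[OF minus_closed[OF sc sc] i, of m n] i sc by (simp add: l2_minus)
    then show "\<exists>n0. \<forall>m\<ge>n0. \<forall>n\<ge>n0. hnorm H (s m i \<ominus> s n i) < e"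
      using n0 by (meson le_less_trans)
  qed
  then obtain v where v: "\<And>i. i \<in> I \<Longrightarrow> v i \<in> carrier H"
    "\<And>i. i \<in> I \<Longrightarrow> (\<lambda>n. hnorm H (s n i \<ominus> v i)) \<longlonglongrightarrow> 0" by metis
  define w where "w = (\<lambda>i\<in>I. v i)"
  define d where "d = (\<lambda>n. \<lambda>i\<in>I. s n i \<ominus> v i)"
  \<comment> \<open>The Cauchy estimate passes to the limit in one index, one finite partial sum at a time.\<close>
  have d_bound: "d n \<in> carrier ?L \<and> hnorm ?L (d n) \<le> e"
    if e: "e > 0" and n0: "\<forall>m\<ge>n0. \<forall>n\<ge>n0. hnorm ?L (s m \<ominus>\<^bsub>?L\<^esub> s n) < e" and n: "n \<ge> n0" for e n0 n
  proof -
    have "(\<Sum>i\<in>F. (hnorm H (d n i))\<^sup>2) \<le> e\<^sup>2" if F: "finite F" "F \<subseteq> I" for F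
    proof -
      have conv: "(\<lambda>m. hnorm H (s n i \<ominus> s m i)) \<longlonglongrightarrow> hnorm H (s n i \<ominus> v i)" if i: "i \<in> I" for i
      proof -
        have le: "\<bar>hnorm H (s n i \<ominus> s m i) - hnorm H (s n i \<ominus> v i)\<bar> \<le> hnorm H (s m i \<ominus> v i)" for m
          using seminorm_triangle_minus[of "s n i" "v i" "s m i"]
            seminorm_triangle_minus[of "s n i" "s m i" "v i"]
            seminorm_minus_commute[of "v i" "s m i"] i v by simp
        show ?thesis by (subst Lim_null, rule Lim_null_comparison[OF _ v(2)[OF i]]) (simp add: le)
      qed
      have "(\<lambda>m. \<Sum>i\<in>F. (hnorm H (s n i \<ominus> s m i))\<^sup>2) \<longlonglongrightarrow> (\<Sum>i\<in>F. (hnorm H (s n i \<ominus> v i))\<^sup>2)"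
        using F conv by (intro tendsto_sum tendsto_power) auto
      moreover have "(\<Sum>i\<in>F. (hnorm H (s n i \<ominus> s m i))\<^sup>2) \<le> e\<^sup>2" if "m \<ge> n0" for m
      proof -
        have "(\<Sum>i\<in>F. (hnorm H (s n i \<ominus> s m i))\<^sup>2) = (\<Sum>i\<in>F. (hnorm H ((s n \<ominus>\<^bsub>?L\<^esub> s m) i))\<^sup>2)"
          using F sc by (auto simp: l2_minus subset_iff intro!: sum.cong)
        also have "\<dots> \<le> (hnorm ?L (s n \<ominus>\<^bsub>?L\<^esub> s m))\<^sup>2" by (rule l2_sum_le[OF minus_closed[OF sc sc] F])
        also have "\<dots> \<le> e\<^sup>2" using n0 n that minus_closed[OF sc sc]
          by (intro power_mono) (auto intro: less_imp_le simp: l2_norm_square(2) infsum_nonneg)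
        finally show ?thesis .
      qed
      ultimately have "(\<Sum>i\<in>F. (hnorm H (s n i \<ominus> v i))\<^sup>2) \<le> e\<^sup>2"
        by (intro LIMSEQ_le_const2) auto
      also have "(\<Sum>i\<in>F. (hnorm H (s n i \<ominus> v i))\<^sup>2) = (\<Sum>i\<in>F. (hnorm H (d n i))\<^sup>2)"
        using F unfolding d_def by (auto intro!: sum.cong)
      finally show ?thesis .
    qed
    then show ?thesis using l2_bounded[of I "d n" e] e v unfolding d_def by auto
  qed
  obtain n1 where "\<forall>m\<ge>n1. \<forall>n\<ge>n1. hnorm ?L (s m \<ominus>\<^bsub>?L\<^esub> s n) < 1"
    using s unfolding cauchy_wrt_def by (meson zero_less_one)
  then have dn1: "d n1 \<in> carrier ?L" using d_bound[of 1 n1 n1] by simp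
  have "s n1 \<ominus>\<^bsub>?L\<^esub> d n1 = (\<lambda>i\<in>I. s n1 i \<ominus> d n1 i)" by (rule l2_minus[OF sc dn1])
  also have "\<dots> = w"
    using v unfolding w_def d_def by (auto simp: minus_minus_cancel intro!: restrict_ext)
  finally have w: "w \<in> carrier ?L" using minus_closed[OF sc dn1, of n1] by simp
  have sw: "s n \<ominus>\<^bsub>?L\<^esub> w = d n" for n
    using l2_minus[OF sc w] unfolding d_def w_def by (auto intro!: restrict_ext)
  have "(\<lambda>n. hnorm ?L (s n \<ominus>\<^bsub>?L\<^esub> w)) \<longlonglongrightarrow> 0"
  proof (rule LIMSEQ_I)
    fix e :: real assume e: "e > 0"
    then obtain n0 where "\<forall>m\<ge>n0. \<forall>n\<ge>n0. hnorm ?L (s m \<ominus>\<^bsub>?L\<^esub> s n) < e / 2"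
      using s unfolding cauchy_wrt_def by (meson half_gt_zero)
    then have "d n \<in> carrier ?L \<and> hnorm ?L (d n) \<le> e / 2" if "n \<ge> n0" for n
      using d_bound[of "e/2" n0 n] e that by simp
    moreover have "0 \<le> hnorm ?L (d n)" if "d n \<in> carrier ?L" for n
      unfolding l2_norm_square(2)[OF that] by (simp add: infsum_nonneg)
    ultimately show "\<exists>n0. \<forall>n\<ge>n0. norm (hnorm ?L (s n \<ominus>\<^bsub>?L\<^esub> w) - 0) < e"
      unfolding sw using e by (intro exI[of _ n0]) fastforce
  qed
  then show ?thesis using w by blast
qed

lemma l2_hilbert_space: "hilbert_space (l2_space I H)"
proof (rule hilbert_space.intro[OF l2_module], rule hilbert_space_axioms.intro)
  let ?L = "l2_space I H"
  fix u v assume u: "u \<in> carrier ?L" and v: "v \<in> carrier ?L"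
  note [simp] = l2_carrierD(1)[OF u] l2_carrierD(1)[OF v]
  show "ip ?L (u \<oplus>\<^bsub>?L\<^esub> v) w = ip ?L u w + ip ?L v w" if w: "w \<in> carrier ?L" for w
  proof -
    have "ip ?L (u \<oplus>\<^bsub>?L\<^esub> v) w = (\<Sum>\<^sub>\<infinity>i\<in>I. ip H (u i) (w i) + ip H (v i) (w i))"
      unfolding l2_simps by (rule infsum_cong) (simp add: ip_add l2_carrierD(1)[OF w])
    then show ?thesis
      using infsum_add[OF l2_ip_summable[OF u w] l2_ip_summable[OF v w]] by simp
  qed
  show "ip ?L (c \<odot>\<^bsub>?L\<^esub> u) v = c * ip ?L u v" for c
  proof -
    have "ip ?L (c \<odot>\<^bsub>?L\<^esub> u) v = (\<Sum>\<^sub>\<infinity>i\<in>I. c * ip H (u i) (v i))"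
      unfolding l2_simps by (rule infsum_cong) (simp add: ip_scale)
    then show ?thesis by (simp add: infsum_cmult_right')
  qed
  have "(\<Sum>\<^sub>\<infinity>i\<in>I. ip H (u i) (v i)) = (\<Sum>\<^sub>\<infinity>i\<in>I. cnj (ip H (v i) (u i)))"
    by (intro infsum_cong ip_cnj) auto
  then show "ip ?L u v = cnj (ip ?L v u)" by simp
next
  let ?L = "l2_space I H"
  fix u assume u: "u \<in> carrier ?L"
  note [simp] = l2_carrierD(1)[OF u]
  have ipu: "ip ?L u u = of_real (\<Sum>\<^sub>\<infinity>i\<in>I. (hnorm H (u i))\<^sup>2)"
  proof -
    have "ip ?L u u = (\<Sum>\<^sub>\<infinity>i\<in>I. of_real ((hnorm H (u i))\<^sup>2))"
      by (auto simp: ip_self intro!: infsum_cong)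
    then show ?thesis
      using infsumI[OF has_sum_of_real[OF has_sum_infsum[OF l2_carrierD(3)[OF u]]]] by metis
  qed
  then show "0 \<le> Re (ip ?L u u)" by (simp add: infsum_nonneg)
  show "u = \<zero>\<^bsub>?L\<^esub>" if "ip ?L u u = 0"
  proof -
    have "(\<Sum>\<^sub>\<infinity>i\<in>I. (hnorm H (u i))\<^sup>2) = 0" using that unfolding ipu of_real_eq_0_iff .
    then have "(hnorm H (u i))\<^sup>2 = 0" if "i \<in> I" for i
      using nonneg_infsum_le_0D[OF _ l2_carrierD(3)[OF u] _ that] by simp
    then show ?thesis
      using l2_carrierD(2)[OF u] by (auto simp: hnorm_eq_zero fun_eq_iff extensional_def)
  qed
qed (rule l2_complete)

end

section \<open>Finitely supported sections of a Fell bundle\<close>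

lemma fibre_simps [simp]:
  "carrier (fibre C x) = {b \<in> total C. proj C b = x}" "\<zero>\<^bsub>fibre C x\<^esub> = bzero C x"
  "a \<oplus>\<^bsub>fibre C x\<^esub> b = badd C a b" "c \<odot>\<^bsub>fibre C x\<^esub> b = bscale C c b"
  by (simp_all add: fibre_def)

text \<open>The section with the single value \<open>b\<close> at the point over which \<open>b\<close> lies.\<close>

definition section_delta :: "('x, 'm) monoid_scheme \<Rightarrow> ('x, 'b) bundle_data \<Rightarrow> 'b \<Rightarrow> 'x \<Rightarrow> 'b" where
  "section_delta K C b = (\<lambda>k\<in>carrier K. if k = proj C b then b else bzero C k)"

context fell_bundle
begin

abbreviation "S \<equiv> finite_sections K C"
abbreviation "supp \<equiv> section_support K C"

lemma fibre_module: "x \<in> carrier K \<Longrightarrow> Module.module complex_ring (fibre C x)"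
  using banach_fibre complex_banach.axioms(1) by blast

lemma fibre_abelian_group: "x \<in> carrier K \<Longrightarrow> abelian_group (fibre C x)"
  using fibre_module Module.module.axioms(2) by blast

lemma fibre_abelian_monoid: "x \<in> carrier K \<Longrightarrow> abelian_monoid (fibre C x)"
  using fibre_abelian_group abelian_group.axioms(1) by blast

lemma bzero_closed [simp]:
  assumes "x \<in> carrier K" shows "bzero C x \<in> total C" "proj C (bzero C x) = x"
proof -
  interpret abelian_group "fibre C x" using fibre_abelian_group[OF assms] .
  show "bzero C x \<in> total C" "proj C (bzero C x) = x" using zero_closed by simp_all
qed

lemma badd_closed [simp]:
  assumes "a \<in> total C" "b \<in> total C" "proj C a = proj C b"
  shows "badd C a b \<in> total C" "proj C (badd C a b) = proj C b"
proof -
  interpret abelian_group "fibre C (proj C b)" using fibre_abelian_group proj_closed assms by simp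
  show "badd C a b \<in> total C" "proj C (badd C a b) = proj C b"
    using a_closed[of a b] assms by simp_all
qed

lemma badd_commute:
  assumes "a \<in> total C" "b \<in> total C" "proj C a = proj C b" shows "badd C a b = badd C b a"
proof -
  interpret abelian_group "fibre C (proj C b)" using fibre_abelian_group proj_closed assms by simp
  show ?thesis using a_comm[of a b] assms by simp
qed

lemma badd_assoc:
  assumes "a \<in> total C" "b \<in> total C" "c \<in> total C" "proj C a = proj C c" "proj C b = proj C c"
  shows "badd C (badd C a b) c = badd C a (badd C b c)"
proof -
  interpret abelian_group "fibre C (proj C c)" using fibre_abelian_group proj_closed assms by simp
  show ?thesis using a_assoc[of a b c] assms by simp
qed

lemma badd_bzero [simp]:
  assumes "b \<in> total C"
  shows "badd C (bzero C (proj C b)) b = b" "badd C b (bzero C (proj C b)) = b"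
proof -
  interpret abelian_group "fibre C (proj C b)" using fibre_abelian_group proj_closed assms by simp
  show "badd C (bzero C (proj C b)) b = b" "badd C b (bzero C (proj C b)) = b"
    using l_zero[of b] r_zero[of b] assms by simp_all
qed

lemma bscale_closed [simp]:
  assumes "b \<in> total C" shows "bscale C c b \<in> total C" "proj C (bscale C c b) = proj C b"
proof -
  interpret Module.module complex_ring "fibre C (proj C b)" using fibre_module proj_closed assms by simp
  show "bscale C c b \<in> total C" "proj C (bscale C c b) = proj C b"
    using smult_closed[of c b] assms by simp_all
qed

lemma bscale_rules:
  assumes "b \<in> total C"
  shows "bscale C (c + d) b = badd C (bscale C c b) (bscale C d b)"
    and "bscale C (c * d) b = bscale C c (bscale C d b)"
    and "bscale C 1 b = b" and "bscale C 0 b = bzero C (proj C b)"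
proof -
  interpret Module.module complex_ring "fibre C (proj C b)" using fibre_module proj_closed assms by simp
  show "bscale C (c + d) b = badd C (bscale C c b) (bscale C d b)"
    "bscale C (c * d) b = bscale C c (bscale C d b)"
    "bscale C 1 b = b" "bscale C 0 b = bzero C (proj C b)"
    using smult_l_distr[of c d b] smult_assoc1[of c d b] smult_one[of b] smult_l_null[of b] assms
    by simp_all
qed

lemma bscale_badd:
  assumes "a \<in> total C" "b \<in> total C" "proj C a = proj C b"
  shows "bscale C c (badd C a b) = badd C (bscale C c a) (bscale C c b)"
proof -
  interpret Module.module complex_ring "fibre C (proj C b)" using fibre_module proj_closed assms by simp
  show ?thesis using smult_r_distr[of c a b] assms by simp
qed

lemma bscale_bzero [simp]: "x \<in> carrier K \<Longrightarrow> bscale C c (bzero C x) = bzero C x"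
  using bscale_rules(4)[of "bzero C x"] bscale_rules(2)[of "bzero C x" c 0] by simp

declare mul_closed [simp] proj_mul [simp]

lemma bmul_bzero [simp]:
  assumes "b \<in> total C" "x \<in> carrier K"
  shows "bmul C (bzero C x) b = bzero C (x \<otimes> proj C b)" "bmul C b (bzero C x) = bzero C (proj C b \<otimes> x)"
proof -
  have "bmul C (bzero C x) b = bscale C 0 (bmul C (bzero C x) b)"
    using mul_scale_left[of "bzero C x" b 0] assms by simp
  then show "bmul C (bzero C x) b = bzero C (x \<otimes> proj C b)" using assms by (simp add: bscale_rules)
  have "bmul C b (bzero C x) = bscale C 0 (bmul C b (bzero C x))"
    using mul_scale_right[of b "bzero C x" 0] assms by simp
  then show "bmul C b (bzero C x) = bzero C (proj C b \<otimes> x)" using assms by (simp add: bscale_rules)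
qed

declare star_closed [simp] proj_star [simp]

lemma bstar_bzero [simp]: "x \<in> carrier K \<Longrightarrow> bstar C (bzero C x) = bzero C (inv x)"
proof -
  assume x: "x \<in> carrier K"
  then have "bstar C (bzero C x) = bscale C 0 (bstar C (bzero C x))"
    using star_scale[of "bzero C x" 0] by simp
  then show ?thesis using x by (simp add: bscale_rules)
qed

lemma bnorm_nonneg [simp]: "b \<in> total C \<Longrightarrow> 0 \<le> bnorm C b"
  using complex_banach.norm_nonneg[OF banach_fibre[of "proj C b"], of b] proj_closed by simp

lemma bnorm_bzero [simp]: "x \<in> carrier K \<Longrightarrow> bnorm C (bzero C x) = 0"
  using complex_banach.norm_eq_zero[OF banach_fibre[of x], of "bzero C x"] by simp

lemma sectionD:
  assumes "\<sigma> \<in> S"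
  shows "k \<in> carrier K \<Longrightarrow> \<sigma> k \<in> total C" "k \<in> carrier K \<Longrightarrow> proj C (\<sigma> k) = k"
    "\<sigma> \<in> extensional (carrier K)" "finite (supp \<sigma>)" "supp \<sigma> \<subseteq> carrier K"
  using assms unfolding finite_sections_def section_support_def by (auto simp: PiE_def)

lemma sectionI:
  assumes "\<And>k. k \<in> carrier K \<Longrightarrow> \<sigma> k \<in> total C" "\<And>k. k \<in> carrier K \<Longrightarrow> proj C (\<sigma> k) = k"
    and "\<sigma> \<in> extensional (carrier K)" and "finite F" "\<And>k. k \<in> carrier K \<Longrightarrow> k \<notin> F \<Longrightarrow> \<sigma> k = bzero C k"
  shows "\<sigma> \<in> S"
proof -
  have "supp \<sigma> \<subseteq> F" using assms(5) unfolding section_support_def by auto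
  then show ?thesis
    using assms(1-3) finite_subset[OF _ assms(4)] unfolding finite_sections_def by (auto simp: PiE_def)
qed

lemma notin_supp: "k \<in> carrier K \<Longrightarrow> k \<notin> supp \<sigma> \<Longrightarrow> \<sigma> k = bzero C k"
  unfolding section_support_def by simp

lemma section_add_closed: "\<sigma> \<in> S \<Longrightarrow> \<tau> \<in> S \<Longrightarrow> section_add K C \<sigma> \<tau> \<in> S"
proof (rule sectionI)
  assume a: "\<sigma> \<in> S" "\<tau> \<in> S"
  show "finite (supp \<sigma> \<union> supp \<tau>)" using a sectionD(4) by blast
  fix k assume k: "k \<in> carrier K"
  show "section_add K C \<sigma> \<tau> k \<in> total C" "proj C (section_add K C \<sigma> \<tau> k) = k"
    using a k unfolding section_add_def by (simp_all add: sectionD)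
  show "section_add K C \<sigma> \<tau> k = bzero C k" if "k \<notin> supp \<sigma> \<union> supp \<tau>"
    using badd_bzero(1)[of "bzero C k"] that k unfolding section_add_def by (simp add: notin_supp)
qed (simp add: section_add_def)

lemma section_scale_closed: "\<sigma> \<in> S \<Longrightarrow> section_scale K C z \<sigma> \<in> S"
proof (rule sectionI)
  assume a: "\<sigma> \<in> S"
  show "finite (supp \<sigma>)" using a sectionD(4) by blast
  fix k assume k: "k \<in> carrier K"
  show "section_scale K C z \<sigma> k \<in> total C" "proj C (section_scale K C z \<sigma> k) = k"
    using a k unfolding section_scale_def by (simp_all add: sectionD)
  show "section_scale K C z \<sigma> k = bzero C k" if "k \<notin> supp \<sigma>"
    using that k unfolding section_scale_def by (simp add: notin_supp)
qed (simp add: section_scale_def)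

lemma section_zero_closed: "(\<lambda>k\<in>carrier K. bzero C k) \<in> S"
  by (rule sectionI[of _ "{}"]) auto

lemma section_star_closed: "\<sigma> \<in> S \<Longrightarrow> section_star K C \<sigma> \<in> S"
proof (rule sectionI)
  assume a: "\<sigma> \<in> S"
  show "finite (m_inv K ` supp \<sigma>)" using a sectionD(4) by blast
  fix k assume k: "k \<in> carrier K"
  show "section_star K C \<sigma> k \<in> total C" "proj C (section_star K C \<sigma> k) = k"
    using a k unfolding section_star_def by (simp_all add: sectionD)
  show "section_star K C \<sigma> k = bzero C k" if "k \<notin> m_inv K ` supp \<sigma>"
  proof -
    have "inv k \<notin> supp \<sigma>" using that k by (metis image_eqI inv_inv)
    then show ?thesis using k unfolding section_star_def by (simp add: notin_supp)
  qed
qed (simp add: section_star_def)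

lemma section_delta_closed: "b \<in> total C \<Longrightarrow> section_delta K C b \<in> S"
  by (rule sectionI[of _ "{proj C b}"]) (auto simp: section_delta_def)

lemma supp_delta: "supp (section_delta K C b) \<subseteq> {proj C b}"
  unfolding section_support_def section_delta_def by auto

lemma mult_summand_closed:
  assumes "\<sigma> \<in> S" "\<tau> \<in> S" "k \<in> carrier K" "l \<in> carrier K"
  shows "bmul C (\<sigma> l) (\<tau> (inv l \<otimes> k)) \<in> total C"
    and "proj C (bmul C (\<sigma> l) (\<tau> (inv l \<otimes> k))) = k"
  using assms by (simp_all add: sectionD m_assoc[symmetric])

text \<open>The convolution sums over the support of the first factor. Sections with different supports
  can be compared once the sum runs over a common larger set, where the new terms vanish.\<close>

lemma section_mult_eq:
  assumes "\<sigma> \<in> S" "\<tau> \<in> S" "k \<in> carrier K" "finite F" "supp \<sigma> \<subseteq> F" "F \<subseteq> carrier K"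
  shows "section_mult K C \<sigma> \<tau> k = finsum (fibre C k) (\<lambda>l. bmul C (\<sigma> l) (\<tau> (inv l \<otimes> k))) F"
proof -
  interpret abelian_monoid "fibre C k" using fibre_abelian_monoid assms by simp
  have "finsum (fibre C k) (\<lambda>l. bmul C (\<sigma> l) (\<tau> (inv l \<otimes> k))) (supp \<sigma>)
      = finsum (fibre C k) (\<lambda>l. bmul C (\<sigma> l) (\<tau> (inv l \<otimes> k))) F"
  proof (rule finsum_superset)
    show "(\<lambda>l. bmul C (\<sigma> l) (\<tau> (inv l \<otimes> k))) \<in> F \<rightarrow> carrier (fibre C k)"
      using assms mult_summand_closed by (auto simp: subset_iff)
    fix l assume "l \<in> F - supp \<sigma>"
    then show "bmul C (\<sigma> l) (\<tau> (inv l \<otimes> k)) = \<zero>\<^bsub>fibre C k\<^esub>"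
      using assms by (auto simp: notin_supp sectionD m_assoc[symmetric] subset_iff)
  qed (use assms in auto)
  then show ?thesis using assms(3) unfolding section_mult_def by simp
qed

lemma section_mult_closed:
  assumes "\<sigma> \<in> S" "\<tau> \<in> S" shows "section_mult K C \<sigma> \<tau> \<in> S"
    and "supp (section_mult K C \<sigma> \<tau>) \<subseteq> (\<lambda>(l, m). l \<otimes> m) ` (supp \<sigma> \<times> supp \<tau>)"
proof -
  let ?F = "(\<lambda>(l, m). l \<otimes> m) ` (supp \<sigma> \<times> supp \<tau>)"
  have zero: "section_mult K C \<sigma> \<tau> k = bzero C k" if k: "k \<in> carrier K" "k \<notin> ?F" for k
  proof -
    interpret abelian_monoid "fibre C k" using fibre_abelian_monoid k by simp
    have "bmul C (\<sigma> l) (\<tau> (inv l \<otimes> k)) = \<zero>\<^bsub>fibre C k\<^esub>" if l: "l \<in> supp \<sigma>" for l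
    proof -
      have lK: "l \<in> carrier K" using l assms sectionD(5) by blast
      have "inv l \<otimes> k \<notin> supp \<tau>"
      proof
        assume "inv l \<otimes> k \<in> supp \<tau>"
        then have "l \<otimes> (inv l \<otimes> k) \<in> ?F" using l by force
        then show False using k lK by (simp add: m_assoc[symmetric])
      qed
      then show ?thesis using k lK assms by (simp add: notin_supp sectionD m_assoc[symmetric])
    qed
    then have "finsum (fibre C k) (\<lambda>l. bmul C (\<sigma> l) (\<tau> (inv l \<otimes> k))) (supp \<sigma>) = \<zero>\<^bsub>fibre C k\<^esub>"
      using finsum_superset[of "supp \<sigma>" "{}" "\<lambda>l. bmul C (\<sigma> l) (\<tau> (inv l \<otimes> k))"]
        sectionD(4)[OF assms(1)] bzero_closed[OF k(1)] by simp
    then show ?thesis using k unfolding section_mult_def by simp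
  qed
  then show "supp (section_mult K C \<sigma> \<tau>) \<subseteq> ?F" unfolding section_support_def by auto
  have "section_mult K C \<sigma> \<tau> k \<in> carrier (fibre C k)" if k: "k \<in> carrier K" for k
  proof -
    interpret abelian_monoid "fibre C k" using fibre_abelian_monoid k by simp
    have "finsum (fibre C k) (\<lambda>l. bmul C (\<sigma> l) (\<tau> (inv l \<otimes> k))) (supp \<sigma>) \<in> carrier (fibre C k)"
      using assms k mult_summand_closed sectionD(5)[OF assms(1)]
      by (intro finsum_closed) (auto simp: subset_iff)
    then show ?thesis using k unfolding section_mult_def by simp
  qed
  then show "section_mult K C \<sigma> \<tau> \<in> S"
    using zero assms by (intro sectionI[of _ ?F]) (auto simp: sectionD section_mult_def)
qed

lemma section_mult_add_left:
  assumes "\<sigma> \<in> S" "\<sigma>' \<in> S" "\<tau> \<in> S"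
  shows "section_mult K C (section_add K C \<sigma> \<sigma>') \<tau>
    = section_add K C (section_mult K C \<sigma> \<tau>) (section_mult K C \<sigma>' \<tau>)"
proof
  fix k
  show "section_mult K C (section_add K C \<sigma> \<sigma>') \<tau> k
    = section_add K C (section_mult K C \<sigma> \<tau>) (section_mult K C \<sigma>' \<tau>) k"
  proof (cases "k \<in> carrier K")
    case k: True
    interpret abelian_monoid "fibre C k" using fibre_abelian_monoid k by simp
    let ?F = "supp \<sigma> \<union> supp \<sigma>'"
    have F: "finite ?F" "?F \<subseteq> carrier K" using assms sectionD(4,5) by blast+
    have "supp (section_add K C \<sigma> \<sigma>') \<subseteq> ?F"
      using badd_bzero(1)[OF bzero_closed(1)] unfolding section_support_def section_add_def by auto
    then have "section_mult K C (section_add K C \<sigma> \<sigma>') \<tau> k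
      = finsum (fibre C k) (\<lambda>l. bmul C (section_add K C \<sigma> \<sigma>' l) (\<tau> (inv l \<otimes> k))) ?F"
      using assms k F by (intro section_mult_eq section_add_closed) auto
    also have "\<dots> = finsum (fibre C k) (\<lambda>l. bmul C (\<sigma> l) (\<tau> (inv l \<otimes> k))
        \<oplus>\<^bsub>fibre C k\<^esub> bmul C (\<sigma>' l) (\<tau> (inv l \<otimes> k))) ?F"
    proof (rule finsum_cong')
      show "(\<lambda>l. bmul C (\<sigma> l) (\<tau> (inv l \<otimes> k)) \<oplus>\<^bsub>fibre C k\<^esub> bmul C (\<sigma>' l) (\<tau> (inv l \<otimes> k)))
          \<in> ?F \<rightarrow> carrier (fibre C k)"
        using assms k F mult_summand_closed by (intro Pi_I a_closed) auto
      fix l assume "l \<in> ?F"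
      then have l: "l \<in> carrier K" using F by blast
      show "bmul C (section_add K C \<sigma> \<sigma>' l) (\<tau> (inv l \<otimes> k)) = bmul C (\<sigma> l) (\<tau> (inv l \<otimes> k))
          \<oplus>\<^bsub>fibre C k\<^esub> bmul C (\<sigma>' l) (\<tau> (inv l \<otimes> k))"
        using l k assms unfolding section_add_def by (simp add: mul_add_left sectionD)
    qed simp
    also have "\<dots> = finsum (fibre C k) (\<lambda>l. bmul C (\<sigma> l) (\<tau> (inv l \<otimes> k))) ?F
        \<oplus>\<^bsub>fibre C k\<^esub> finsum (fibre C k) (\<lambda>l. bmul C (\<sigma>' l) (\<tau> (inv l \<otimes> k))) ?F"
      using assms k F mult_summand_closed by (intro finsum_addf) auto
    also have "\<dots> = section_add K C (section_mult K C \<sigma> \<tau>) (section_mult K C \<sigma>' \<tau>) k"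
      using k F assms section_mult_eq[of \<sigma> \<tau> k ?F] section_mult_eq[of \<sigma>' \<tau> k ?F]
      by (simp add: section_add_def)
    finally show ?thesis .
  qed (simp add: section_mult_def section_add_def)
qed

lemma section_mult_add_right:
  assumes "\<sigma> \<in> S" "\<tau> \<in> S" "\<tau>' \<in> S"
  shows "section_mult K C \<sigma> (section_add K C \<tau> \<tau>')
    = section_add K C (section_mult K C \<sigma> \<tau>) (section_mult K C \<sigma> \<tau>')"
proof
  fix k
  show "section_mult K C \<sigma> (section_add K C \<tau> \<tau>') k
    = section_add K C (section_mult K C \<sigma> \<tau>) (section_mult K C \<sigma> \<tau>') k"
  proof (cases "k \<in> carrier K")
    case k: True
    interpret abelian_monoid "fibre C k" using fibre_abelian_monoid k by simp
    let ?F = "supp \<sigma>"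
    have F: "?F \<subseteq> carrier K" using assms sectionD(5) by blast
    have "finsum (fibre C k) (\<lambda>l. bmul C (\<sigma> l) (section_add K C \<tau> \<tau>' (inv l \<otimes> k))) ?F
        = finsum (fibre C k) (\<lambda>l. bmul C (\<sigma> l) (\<tau> (inv l \<otimes> k))
        \<oplus>\<^bsub>fibre C k\<^esub> bmul C (\<sigma> l) (\<tau>' (inv l \<otimes> k))) ?F"
    proof (rule finsum_cong')
      show "(\<lambda>l. bmul C (\<sigma> l) (\<tau> (inv l \<otimes> k)) \<oplus>\<^bsub>fibre C k\<^esub> bmul C (\<sigma> l) (\<tau>' (inv l \<otimes> k)))
          \<in> ?F \<rightarrow> carrier (fibre C k)"
        using assms k F mult_summand_closed by (intro Pi_I a_closed) auto
      fix l assume "l \<in> ?F"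
      then have l: "l \<in> carrier K" using F by blast
      show "bmul C (\<sigma> l) (section_add K C \<tau> \<tau>' (inv l \<otimes> k)) = bmul C (\<sigma> l) (\<tau> (inv l \<otimes> k))
          \<oplus>\<^bsub>fibre C k\<^esub> bmul C (\<sigma> l) (\<tau>' (inv l \<otimes> k))"
        using l k assms unfolding section_add_def by (simp add: mul_add_right sectionD)
    qed simp
    also have "\<dots> = finsum (fibre C k) (\<lambda>l. bmul C (\<sigma> l) (\<tau> (inv l \<otimes> k))) ?F
        \<oplus>\<^bsub>fibre C k\<^esub> finsum (fibre C k) (\<lambda>l. bmul C (\<sigma> l) (\<tau>' (inv l \<otimes> k))) ?F"
      using assms k F mult_summand_closed by (intro finsum_addf) auto
    finally show ?thesis using k by (simp add: section_mult_def section_add_def)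
  qed (simp add: section_mult_def section_add_def)
qed

lemma section_star_add:
  "\<sigma> \<in> S \<Longrightarrow> \<tau> \<in> S \<Longrightarrow> section_star K C (section_add K C \<sigma> \<tau>)
    = section_add K C (section_star K C \<sigma>) (section_star K C \<tau>)"
  unfolding section_star_def section_add_def
  by (intro restrict_ext) (simp add: star_add sectionD)

lemma delta_add:
  assumes "a \<in> total C" "b \<in> total C" "proj C a = proj C b"
  shows "section_add K C (section_delta K C a) (section_delta K C b) = section_delta K C (badd C a b)"
  unfolding section_add_def section_delta_def
  using assms badd_bzero(1)[OF bzero_closed(1)] by (intro restrict_ext) auto

lemma delta_scale:
  "b \<in> total C \<Longrightarrow> section_scale K C z (section_delta K C b) = section_delta K C (bscale C z b)"
  unfolding section_scale_def section_delta_def by (intro restrict_ext) auto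

lemma delta_star:
  assumes b: "b \<in> total C"
  shows "section_star K C (section_delta K C b) = section_delta K C (bstar C b)"
proof -
  have "inv k = proj C b \<longleftrightarrow> k = inv (proj C b)" if "k \<in> carrier K" for k
    using that b proj_closed by (metis inv_inv)
  then show ?thesis
    using b unfolding section_star_def section_delta_def by (intro restrict_ext) (auto simp: proj_closed)
qed

lemma delta_mult:
  assumes a: "a \<in> total C" and b: "b \<in> total C"
  shows "section_mult K C (section_delta K C a) (section_delta K C b) = section_delta K C (bmul C a b)"
proof
  fix k
  show "section_mult K C (section_delta K C a) (section_delta K C b) k = section_delta K C (bmul C a b) k"
  proof (cases "k \<in> carrier K")
    case k: True
    interpret abelian_monoid "fibre C k" using fibre_abelian_monoid k by simp
    have pa: "proj C a \<in> carrier K" and pb: "proj C b \<in> carrier K" using proj_closed a b by auto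
    let ?f = "\<lambda>l. bmul C (section_delta K C a l) (section_delta K C b (inv l \<otimes> k))"
    have "section_mult K C (section_delta K C a) (section_delta K C b) k = finsum (fibre C k) ?f {proj C a}"
      using a b k pa supp_delta by (intro section_mult_eq section_delta_closed) auto
    also have "\<dots> = ?f (proj C a)"
    proof -
      have cl: "?f (proj C a) \<in> carrier (fibre C k)"
        using mult_summand_closed[OF section_delta_closed[OF a] section_delta_closed[OF b] k pa] by simp
      then have "finsum (fibre C k) ?f (insert (proj C a) {}) = ?f (proj C a) \<oplus>\<^bsub>fibre C k\<^esub> finsum (fibre C k) ?f {}"
        by (intro finsum_insert) auto
      then show ?thesis using r_zero[OF cl] by simp
    qed
    also have "\<dots> = section_delta K C (bmul C a b) k"
    proof (cases "k = proj C a \<otimes> proj C b")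
      case True
      then show ?thesis using a b pa pb by (simp add: section_delta_def m_assoc[symmetric])
    next
      case False
      then have "inv (proj C a) \<otimes> k \<noteq> proj C b" using pa pb k by (metis inv_solve_left)
      then show ?thesis using False a b pa pb k by (simp add: section_delta_def m_assoc[symmetric])
    qed
    finally show ?thesis .
  qed (simp add: section_mult_def section_delta_def)
qed

lemma l1_norm_delta: "b \<in> total C \<Longrightarrow> l1_norm K C (section_delta K C b) = bnorm C b"
proof -
  assume b: "b \<in> total C"
  have "l1_norm K C (section_delta K C b) = (\<Sum>k\<in>{proj C b}. bnorm C (section_delta K C b k))"
    unfolding l1_norm_def
    using supp_delta b proj_closed by (intro sum.mono_neutral_left) (auto simp: notin_supp)
  then show ?thesis using b proj_closed by (simp add: section_delta_def)
qed

lemma section_algebra_module: "Module.module complex_ring (section_algebra K C)"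
proof (rule complex_moduleI)
  fix \<sigma> \<tau> assume s: "\<sigma> \<in> carrier (section_algebra K C)"
  then have [simp]: "\<sigma> \<in> S" unfolding section_algebra_def by simp
  have ext: "f = \<sigma>" if "f \<in> extensional (carrier K)" "\<And>k. k \<in> carrier K \<Longrightarrow> f k = \<sigma> k" for f
    using that sectionD(3)[of \<sigma>] by (auto intro: extensionalityI)
  have z: "badd C (bzero C k) (\<sigma> k) = \<sigma> k" if "k \<in> carrier K" for k
    using badd_bzero(1)[of "\<sigma> k"] that by (simp add: sectionD)
  show "\<zero>\<^bsub>section_algebra K C\<^esub> \<oplus>\<^bsub>section_algebra K C\<^esub> \<sigma> = \<sigma>"
    by (rule ext) (simp_all add: section_algebra_def section_add_def z)
  show "1 \<odot>\<^bsub>section_algebra K C\<^esub> \<sigma> = \<sigma>"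
    by (rule ext) (simp_all add: section_algebra_def section_scale_def bscale_rules sectionD)
qed (auto simp: section_algebra_def section_add_closed section_scale_closed section_zero_closed
    section_add_def section_scale_def bscale_rules bscale_badd badd_assoc sectionD
    section_add_closed[unfolded section_add_def] section_scale_closed[unfolded section_scale_def]
    intro!: restrict_ext badd_commute)

end

section \<open>Representations of a Fell bundle\<close>

lemma (in seminormed_space) seminorm_finsum:
  assumes "finite A" "g \<in> A \<rightarrow> carrier V"
  shows "N (finsum V g A) \<le> (\<Sum>i\<in>A. N (g i))"
  using assms
proof (induction A)
  case (insert a A)
  then have g: "g a \<in> carrier V" "g \<in> A \<rightarrow> carrier V" by auto
  then have "finsum V g (insert a A) = g a \<oplus> finsum V g A"
    using insert by (intro M.finsum_insert) auto
  moreover have "N (g a \<oplus> finsum V g A) \<le> N (g a) + N (finsum V g A)"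
    using g by (intro seminorm_triangle M.finsum_closed)
  ultimately show ?case using insert g by simp
qed simp

lemma (in hilbert_space) ip_finsum_left:
  assumes "finite A" "g \<in> A \<rightarrow> carrier H" "v \<in> carrier H"
  shows "ip H (finsum H g A) v = (\<Sum>i\<in>A. ip H (g i) v)"
  using assms
proof (induction A)
  case (insert a A)
  then have g: "g a \<in> carrier H" "g \<in> A \<rightarrow> carrier H" by auto
  then have "finsum H g (insert a A) = g a \<oplus> finsum H g A"
    using insert by (intro M.finsum_insert) auto
  then show ?case using insert g by (simp add: ip_add M.finsum_closed)
qed simp

lemma (in hilbert_space) ip_finsum_right:
  assumes "finite A" "g \<in> A \<rightarrow> carrier H" "v \<in> carrier H"
  shows "ip H v (finsum H g A) = (\<Sum>i\<in>A. ip H v (g i))"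
proof -
  have "ip H v (finsum H g A) = cnj (\<Sum>i\<in>A. ip H (g i) v)"
    using assms ip_cnj[of v "finsum H g A"] by (simp add: M.finsum_closed ip_finsum_left)
  also have "\<dots> = (\<Sum>i\<in>A. ip H v (g i))"
    unfolding cnj_sum by (rule sum.cong[OF refl]) (use assms in \<open>auto intro!: ip_cnj[symmetric]\<close>)
  finally show ?thesis .
qed

text \<open>Representations of the fibres rather than the sections. They avoid convolution sums: a bundle
  representation integrates to a representation of the sections (\<open>section_rep_integrated\<close>), and a
  representation of the sections restricts to the sections supported at one point
  (\<open>bundle_representation_delta\<close> below).\<close>

locale bundle_representation = C: fell_bundle K C + H: hilbert_space H
  for K :: "('x, 'm) monoid_scheme" and C :: "('x, 'b) bundle_data"
    and H :: "('v, 'n) hilbert_scheme" +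
  fixes \<pi> :: "'b \<Rightarrow> 'v \<Rightarrow> 'v"
  assumes rep_closed: "b \<in> total C \<Longrightarrow> v \<in> carrier H \<Longrightarrow> \<pi> b v \<in> carrier H"
    and rep_vector_add: "b \<in> total C \<Longrightarrow> u \<in> carrier H \<Longrightarrow> v \<in> carrier H \<Longrightarrow>
      \<pi> b (u \<oplus>\<^bsub>H\<^esub> v) = \<pi> b u \<oplus>\<^bsub>H\<^esub> \<pi> b v"
    and rep_vector_scale: "b \<in> total C \<Longrightarrow> v \<in> carrier H \<Longrightarrow> \<pi> b (c \<odot>\<^bsub>H\<^esub> v) = c \<odot>\<^bsub>H\<^esub> \<pi> b v"
    and rep_norm: "b \<in> total C \<Longrightarrow> v \<in> carrier H \<Longrightarrow> hnorm H (\<pi> b v) \<le> bnorm C b * hnorm H v"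
    and rep_add: "a \<in> total C \<Longrightarrow> b \<in> total C \<Longrightarrow> proj C a = proj C b \<Longrightarrow> v \<in> carrier H \<Longrightarrow>
      \<pi> (badd C a b) v = \<pi> a v \<oplus>\<^bsub>H\<^esub> \<pi> b v"
    and rep_scale: "b \<in> total C \<Longrightarrow> v \<in> carrier H \<Longrightarrow> \<pi> (bscale C c b) v = c \<odot>\<^bsub>H\<^esub> \<pi> b v"
    and rep_mul: "a \<in> total C \<Longrightarrow> b \<in> total C \<Longrightarrow> v \<in> carrier H \<Longrightarrow>
      \<pi> (bmul C a b) v = \<pi> a (\<pi> b v)"
    and rep_star: "b \<in> total C \<Longrightarrow> u \<in> carrier H \<Longrightarrow> v \<in> carrier H \<Longrightarrow>
      ip H (\<pi> (bstar C b) u) v = ip H u (\<pi> b v)"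
begin

definition integrated :: "('x \<Rightarrow> 'b) \<Rightarrow> 'v \<Rightarrow> 'v" where
  "integrated \<sigma> v = finsum H (\<lambda>k. \<pi> (\<sigma> k) v) (C.supp \<sigma>)"

lemma rep_bzero [simp]: "x \<in> carrier K \<Longrightarrow> v \<in> carrier H \<Longrightarrow> \<pi> (bzero C x) v = \<zero>\<^bsub>H\<^esub>"
  using rep_scale[of "bzero C x" v 0] H.smult_l_null[of "\<pi> (bzero C x) v"] by (simp add: rep_closed)

lemma summand_closed:
  "\<sigma> \<in> C.S \<Longrightarrow> v \<in> carrier H \<Longrightarrow> F \<subseteq> carrier K \<Longrightarrow> (\<lambda>k. \<pi> (\<sigma> k) v) \<in> F \<rightarrow> carrier H"
  by (auto intro!: rep_closed C.sectionD(1))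

lemma integrated_eq:
  assumes "\<sigma> \<in> C.S" "v \<in> carrier H" "finite F" "C.supp \<sigma> \<subseteq> F" "F \<subseteq> carrier K"
  shows "integrated \<sigma> v = finsum H (\<lambda>k. \<pi> (\<sigma> k) v) F"
  unfolding integrated_def
proof (rule H.M.finsum_superset)
  show "(\<lambda>k. \<pi> (\<sigma> k) v) \<in> F \<rightarrow> carrier H" using assms by (intro summand_closed)
  show "\<pi> (\<sigma> k) v = \<zero>\<^bsub>H\<^esub>" if "k \<in> F - C.supp \<sigma>" for k
    using that assms by (auto simp: C.notin_supp subset_iff)
qed (use assms in auto)

lemma integrated_closed: "\<sigma> \<in> C.S \<Longrightarrow> v \<in> carrier H \<Longrightarrow> integrated \<sigma> v \<in> carrier H"
  unfolding integrated_def by (intro H.M.finsum_closed summand_closed C.sectionD(5))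

lemma integrated_vector_add:
  assumes "\<sigma> \<in> C.S" "u \<in> carrier H" "v \<in> carrier H"
  shows "integrated \<sigma> (u \<oplus>\<^bsub>H\<^esub> v) = integrated \<sigma> u \<oplus>\<^bsub>H\<^esub> integrated \<sigma> v"
proof -
  note s = C.sectionD[OF assms(1)]
  have "finsum H (\<lambda>k. \<pi> (\<sigma> k) (u \<oplus>\<^bsub>H\<^esub> v)) (C.supp \<sigma>)
      = finsum H (\<lambda>k. \<pi> (\<sigma> k) u \<oplus>\<^bsub>H\<^esub> \<pi> (\<sigma> k) v) (C.supp \<sigma>)"
    using assms s by (intro H.M.finsum_cong') (auto simp: rep_vector_add rep_closed subset_iff)
  then show ?thesis
    unfolding integrated_def using assms s(5) by (simp add: H.M.finsum_addf summand_closed)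
qed

lemma integrated_vector_scale:
  assumes "\<sigma> \<in> C.S" "v \<in> carrier H"
  shows "integrated \<sigma> (c \<odot>\<^bsub>H\<^esub> v) = c \<odot>\<^bsub>H\<^esub> integrated \<sigma> v"
proof -
  note s = C.sectionD[OF assms(1)]
  have "c \<odot>\<^bsub>H\<^esub> finsum H (\<lambda>k. \<pi> (\<sigma> k) v) (C.supp \<sigma>) = finsum H (\<lambda>k. c \<odot>\<^bsub>H\<^esub> \<pi> (\<sigma> k) v) (C.supp \<sigma>)"
    using assms s(4,5) H.smult_r_distr[of c] H.smult_r_null[of c]
    by (intro finsum_additive[where f = "\<lambda>w. c \<odot>\<^bsub>H\<^esub> w"] H.M.abelian_monoid_axioms summand_closed) auto
  also have "\<dots> = finsum H (\<lambda>k. \<pi> (\<sigma> k) (c \<odot>\<^bsub>H\<^esub> v)) (C.supp \<sigma>)"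
    using assms s by (intro H.M.finsum_cong') (auto simp: rep_vector_scale rep_closed subset_iff)
  finally show ?thesis unfolding integrated_def by simp
qed

lemma integrated_norm:
  assumes "\<sigma> \<in> C.S" "v \<in> carrier H"
  shows "hnorm H (integrated \<sigma> v) \<le> l1_norm K C \<sigma> * hnorm H v"
proof -
  note s = C.sectionD[OF assms(1)]
  have "hnorm H (integrated \<sigma> v) \<le> (\<Sum>k\<in>C.supp \<sigma>. hnorm H (\<pi> (\<sigma> k) v))"
    unfolding integrated_def using assms s(4,5) by (intro H.seminorm_finsum summand_closed)
  also have "\<dots> \<le> (\<Sum>k\<in>C.supp \<sigma>. bnorm C (\<sigma> k) * hnorm H v)"
    using assms s by (intro sum_mono rep_norm) auto
  finally show ?thesis unfolding l1_norm_def by (simp add: sum_distrib_right)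
qed

lemma l1_norm_nonneg: "\<sigma> \<in> C.S \<Longrightarrow> 0 \<le> l1_norm K C \<sigma>"
  unfolding l1_norm_def by (intro sum_nonneg C.bnorm_nonneg) (auto dest: C.sectionD simp: subset_iff)

lemma bounded_integrated: "\<sigma> \<in> C.S \<Longrightarrow> bounded_operator H (integrated \<sigma>)"
  unfolding bounded_operator_def
  by (intro conjI Pi_I ballI allI exI[of _ "l1_norm K C \<sigma>"] integrated_norm integrated_closed
      integrated_vector_add integrated_vector_scale)

lemma integrated_add:
  assumes "\<sigma> \<in> C.S" "\<tau> \<in> C.S" "v \<in> carrier H"
  shows "integrated (section_add K C \<sigma> \<tau>) v = integrated \<sigma> v \<oplus>\<^bsub>H\<^esub> integrated \<tau> v"
proof -
  note s = C.sectionD[OF assms(1)] and t = C.sectionD[OF assms(2)]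
  let ?F = "C.supp \<sigma> \<union> C.supp \<tau>"
  have F: "finite ?F" "?F \<subseteq> carrier K" using s t by auto
  have "C.supp (section_add K C \<sigma> \<tau>) \<subseteq> ?F"
    using C.badd_bzero(1)[OF C.bzero_closed(1)] unfolding section_support_def section_add_def by auto
  then have "integrated (section_add K C \<sigma> \<tau>) v = finsum H (\<lambda>k. \<pi> (section_add K C \<sigma> \<tau> k) v) ?F"
    using assms F by (intro integrated_eq C.section_add_closed)
  also have "\<dots> = finsum H (\<lambda>k. \<pi> (\<sigma> k) v \<oplus>\<^bsub>H\<^esub> \<pi> (\<tau> k) v) ?F"
    using assms F s t unfolding section_add_def
    by (intro H.M.finsum_cong') (auto simp: rep_add rep_closed subset_iff)
  also have "\<dots> = finsum H (\<lambda>k. \<pi> (\<sigma> k) v) ?F \<oplus>\<^bsub>H\<^esub> finsum H (\<lambda>k. \<pi> (\<tau> k) v) ?F"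
    using assms F by (intro H.M.finsum_addf summand_closed)
  also have "\<dots> = integrated \<sigma> v \<oplus>\<^bsub>H\<^esub> integrated \<tau> v"
    using assms F integrated_eq[of \<sigma> v ?F] integrated_eq[of \<tau> v ?F] by simp
  finally show ?thesis .
qed

lemma integrated_scale:
  assumes "\<sigma> \<in> C.S" "v \<in> carrier H"
  shows "integrated (section_scale K C z \<sigma>) v = z \<odot>\<^bsub>H\<^esub> integrated \<sigma> v"
proof -
  note s = C.sectionD[OF assms(1)]
  have "C.supp (section_scale K C z \<sigma>) \<subseteq> C.supp \<sigma>"
    unfolding section_support_def section_scale_def by auto
  then have "integrated (section_scale K C z \<sigma>) v = finsum H (\<lambda>k. \<pi> (section_scale K C z \<sigma> k) v) (C.supp \<sigma>)"
    using assms s by (intro integrated_eq C.section_scale_closed)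
  also have "\<dots> = finsum H (\<lambda>k. \<pi> (\<sigma> k) (z \<odot>\<^bsub>H\<^esub> v)) (C.supp \<sigma>)"
    using assms s unfolding section_scale_def
    by (intro H.M.finsum_cong') (auto simp: rep_scale rep_vector_scale rep_closed subset_iff)
  also have "\<dots> = z \<odot>\<^bsub>H\<^esub> integrated \<sigma> v"
    using integrated_vector_scale[OF assms] unfolding integrated_def by simp
  finally show ?thesis .
qed

text \<open>The convolution yields a double sum over \<open>k\<close> and \<open>l\<close>; after exchanging the sums, \<open>m = l\<^sup>-\<^sup>1 k\<close>
  becomes the index of the inner sum. The set \<open>F\<close> of products contains the support of the convolution,
  and its translate by \<open>l\<^sup>-\<^sup>1\<close> contains the support of \<open>\<tau>\<close>.\<close>

lemma integrated_mult:
  assumes "\<sigma> \<in> C.S" "\<tau> \<in> C.S" "v \<in> carrier H"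
  shows "integrated (section_mult K C \<sigma> \<tau>) v = integrated \<sigma> (integrated \<tau> v)"
proof -
  note s = C.sectionD[OF assms(1)] and t = C.sectionD[OF assms(2)]
  define F where "F = (\<lambda>(l, m). l \<otimes>\<^bsub>K\<^esub> m) ` (C.supp \<sigma> \<times> C.supp \<tau>)"
  have F: "finite F" "F \<subseteq> carrier K" unfolding F_def using s t by auto
  have t': "\<tau> (inv\<^bsub>K\<^esub> l \<otimes>\<^bsub>K\<^esub> k) \<in> total C" if "l \<in> carrier K" "k \<in> carrier K" for k l
    using that t by simp
  have cl: "\<pi> (\<sigma> l) (\<pi> (\<tau> (inv\<^bsub>K\<^esub> l \<otimes>\<^bsub>K\<^esub> k)) v) \<in> carrier H" if "l \<in> carrier K" "k \<in> carrier K" for k l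
    using that s t' assms(3) by (simp add: rep_closed)
  have "integrated (section_mult K C \<sigma> \<tau>) v = finsum H (\<lambda>k. \<pi> (section_mult K C \<sigma> \<tau> k) v) F"
    using assms F C.section_mult_closed unfolding F_def by (intro integrated_eq) auto
  also have "\<dots> = finsum H (\<lambda>k. finsum H (\<lambda>l. \<pi> (\<sigma> l) (\<pi> (\<tau> (inv\<^bsub>K\<^esub> l \<otimes>\<^bsub>K\<^esub> k)) v)) (C.supp \<sigma>)) F"
  proof (rule H.M.finsum_cong')
    show "(\<lambda>k. finsum H (\<lambda>l. \<pi> (\<sigma> l) (\<pi> (\<tau> (inv\<^bsub>K\<^esub> l \<otimes>\<^bsub>K\<^esub> k)) v)) (C.supp \<sigma>)) \<in> F \<rightarrow> carrier H"
      using cl F s(5) by (intro Pi_I H.M.finsum_closed) blast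
    fix k assume "k \<in> F"
    then have k: "k \<in> carrier K" using F by blast
    let ?f = "\<lambda>l. bmul C (\<sigma> l) (\<tau> (inv\<^bsub>K\<^esub> l \<otimes>\<^bsub>K\<^esub> k))"
    have "\<pi> (finsum (fibre C k) ?f (C.supp \<sigma>)) v = finsum H (\<lambda>l. \<pi> (?f l) v) (C.supp \<sigma>)"
      using s(4,5) assms k C.mult_summand_closed
      by (intro finsum_additive[where f = "\<lambda>b. \<pi> b v"] C.fibre_abelian_monoid H.M.abelian_monoid_axioms)
        (auto simp: rep_closed rep_add subset_iff)
    also have "\<dots> = finsum H (\<lambda>l. \<pi> (\<sigma> l) (\<pi> (\<tau> (inv\<^bsub>K\<^esub> l \<otimes>\<^bsub>K\<^esub> k)) v)) (C.supp \<sigma>)"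
      using s assms(3) k t' cl by (intro H.M.finsum_cong') (auto simp: rep_mul subset_iff)
    finally show "\<pi> (section_mult K C \<sigma> \<tau> k) v
        = finsum H (\<lambda>l. \<pi> (\<sigma> l) (\<pi> (\<tau> (inv\<^bsub>K\<^esub> l \<otimes>\<^bsub>K\<^esub> k)) v)) (C.supp \<sigma>)"
      using k unfolding section_mult_def by simp
  qed simp
  also have "\<dots> = finsum H (\<lambda>l. finsum H (\<lambda>k. \<pi> (\<sigma> l) (\<pi> (\<tau> (inv\<^bsub>K\<^esub> l \<otimes>\<^bsub>K\<^esub> k)) v)) F) (C.supp \<sigma>)"
    using F s(4,5) cl by (intro H.M.finsum_swap) auto
  also have "\<dots> = finsum H (\<lambda>l. \<pi> (\<sigma> l) (integrated \<tau> v)) (C.supp \<sigma>)"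
  proof (rule H.M.finsum_cong')
    show "(\<lambda>l. \<pi> (\<sigma> l) (integrated \<tau> v)) \<in> C.supp \<sigma> \<rightarrow> carrier H"
      using assms s(5) by (intro summand_closed integrated_closed)
    fix l assume l': "l \<in> C.supp \<sigma>"
    then have l: "l \<in> carrier K" using s(5) by blast
    let ?h = "\<lambda>k. inv\<^bsub>K\<^esub> l \<otimes>\<^bsub>K\<^esub> k"
    have "C.supp \<tau> \<subseteq> ?h ` F"
    proof
      fix m assume m: "m \<in> C.supp \<tau>"
      then have "m = ?h (l \<otimes>\<^bsub>K\<^esub> m)" using l t(5) by (auto simp: C.m_assoc[symmetric])
      moreover have "l \<otimes>\<^bsub>K\<^esub> m \<in> F" unfolding F_def using l' m by force
      ultimately show "m \<in> ?h ` F" by blast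
    qed
    then have "integrated \<tau> v = finsum H (\<lambda>m. \<pi> (\<tau> m) v) (?h ` F)"
      using assms F l by (intro integrated_eq) auto
    also have "\<dots> = finsum H (\<lambda>k. \<pi> (\<tau> (?h k)) v) F"
      using F l t' assms(3) by (intro H.M.finsum_reindex) (auto simp: inj_on_def rep_closed subset_iff)
    finally have "\<pi> (\<sigma> l) (integrated \<tau> v) = \<pi> (\<sigma> l) (finsum H (\<lambda>k. \<pi> (\<tau> (?h k)) v) F)" by simp
    also have "\<dots> = finsum H (\<lambda>k. \<pi> (\<sigma> l) (\<pi> (\<tau> (?h k)) v)) F"
    proof (rule finsum_additive[OF H.M.abelian_monoid_axioms H.M.abelian_monoid_axioms F(1)])
      have "\<pi> (\<sigma> l) (0 \<odot>\<^bsub>H\<^esub> \<zero>\<^bsub>H\<^esub>) = 0 \<odot>\<^bsub>H\<^esub> \<pi> (\<sigma> l) \<zero>\<^bsub>H\<^esub>" using s l by (intro rep_vector_scale) auto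
      then show "\<pi> (\<sigma> l) \<zero>\<^bsub>H\<^esub> = \<zero>\<^bsub>H\<^esub>"
        using s l H.smult_l_null[of "\<zero>\<^bsub>H\<^esub>"] H.smult_l_null[of "\<pi> (\<sigma> l) \<zero>\<^bsub>H\<^esub>"] by (simp add: rep_closed)
    qed (use F l s t' assms(3) in \<open>auto simp: rep_closed rep_vector_add subset_iff\<close>)
    finally show "finsum H (\<lambda>k. \<pi> (\<sigma> l) (\<pi> (\<tau> (?h k)) v)) F = \<pi> (\<sigma> l) (integrated \<tau> v)" by simp
  qed simp
  finally show ?thesis unfolding integrated_def .
qed

lemma integrated_star:
  assumes "\<sigma> \<in> C.S" "u \<in> carrier H" "v \<in> carrier H"
  shows "ip H (integrated (section_star K C \<sigma>) u) v = ip H u (integrated \<sigma> v)"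
proof -
  note s = C.sectionD[OF assms(1)]
  let ?F = "m_inv K ` C.supp \<sigma>"
  have F: "finite ?F" "?F \<subseteq> carrier K" using s by auto
  have "C.supp (section_star K C \<sigma>) \<subseteq> ?F"
  proof
    fix k assume "k \<in> C.supp (section_star K C \<sigma>)"
    then have k: "k \<in> carrier K" "inv\<^bsub>K\<^esub> k \<in> C.supp \<sigma>"
      unfolding section_support_def section_star_def by auto
    then show "k \<in> ?F" by (metis C.inv_inv image_eqI)
  qed
  then have "integrated (section_star K C \<sigma>) u = finsum H (\<lambda>k. \<pi> (section_star K C \<sigma> k) u) ?F"
    using assms F by (intro integrated_eq C.section_star_closed)
  then have "ip H (integrated (section_star K C \<sigma>) u) v = (\<Sum>k\<in>?F. ip H (\<pi> (section_star K C \<sigma> k) u) v)"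
    using H.ip_finsum_left[OF F(1) summand_closed[OF C.section_star_closed[OF assms(1)] assms(2) F(2)] assms(3)]
    by simp
  also have "\<dots> = (\<Sum>k\<in>C.supp \<sigma>. ip H (\<pi> (section_star K C \<sigma> (inv\<^bsub>K\<^esub> k)) u) v)"
    using s(5) by (intro sum.reindex_cong[of "m_inv K"]) (auto intro: inj_on_subset[OF C.inv_inj])
  also have "\<dots> = (\<Sum>k\<in>C.supp \<sigma>. ip H u (\<pi> (\<sigma> k) v))"
    using s assms by (intro sum.cong) (auto simp: section_star_def rep_star subset_iff)
  also have "\<dots> = ip H u (integrated \<sigma> v)"
    unfolding integrated_def using assms s by (intro H.ip_finsum_right[symmetric] summand_closed)
  finally show ?thesis .
qed

theorem section_rep_integrated: "section_rep K C H integrated"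
  unfolding section_rep_def
  by (intro conjI ballI allI bounded_integrated integrated_add integrated_scale integrated_mult
      integrated_star H.operator_norm_le l1_norm_nonneg integrated_norm)

end

locale section_representation = C: fell_bundle K C + H: hilbert_space H
  for K :: "('x, 'm) monoid_scheme" and C :: "('x, 'b) bundle_data"
    and H :: "('v, 'n) hilbert_scheme" +
  fixes L :: "('x \<Rightarrow> 'b) \<Rightarrow> 'v \<Rightarrow> 'v"
  assumes section_rep: "section_rep K C H L"
begin

lemma bounded: "\<sigma> \<in> C.S \<Longrightarrow> bounded_operator H (L \<sigma>)"
  and operator_norm_le_l1: "\<sigma> \<in> C.S \<Longrightarrow> operator_norm H (L \<sigma>) \<le> l1_norm K C \<sigma>"
  and L_add: "\<sigma> \<in> C.S \<Longrightarrow> \<tau> \<in> C.S \<Longrightarrow> v \<in> carrier H \<Longrightarrow>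
    L (section_add K C \<sigma> \<tau>) v = L \<sigma> v \<oplus>\<^bsub>H\<^esub> L \<tau> v"
  and L_scale: "\<sigma> \<in> C.S \<Longrightarrow> v \<in> carrier H \<Longrightarrow> L (section_scale K C z \<sigma>) v = z \<odot>\<^bsub>H\<^esub> L \<sigma> v"
  and L_mult: "\<sigma> \<in> C.S \<Longrightarrow> \<tau> \<in> C.S \<Longrightarrow> v \<in> carrier H \<Longrightarrow>
    L (section_mult K C \<sigma> \<tau>) v = L \<sigma> (L \<tau> v)"
  and L_star: "\<sigma> \<in> C.S \<Longrightarrow> u \<in> carrier H \<Longrightarrow> v \<in> carrier H \<Longrightarrow>
    ip H (L (section_star K C \<sigma>) u) v = ip H u (L \<sigma> v)"
  using section_rep unfolding section_rep_def by blast+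

lemma L_closed: "\<sigma> \<in> C.S \<Longrightarrow> v \<in> carrier H \<Longrightarrow> L \<sigma> v \<in> carrier H"
  and L_vector_add: "\<sigma> \<in> C.S \<Longrightarrow> u \<in> carrier H \<Longrightarrow> v \<in> carrier H \<Longrightarrow>
    L \<sigma> (u \<oplus>\<^bsub>H\<^esub> v) = L \<sigma> u \<oplus>\<^bsub>H\<^esub> L \<sigma> v"
  and L_vector_scale: "\<sigma> \<in> C.S \<Longrightarrow> v \<in> carrier H \<Longrightarrow> L \<sigma> (c \<odot>\<^bsub>H\<^esub> v) = c \<odot>\<^bsub>H\<^esub> L \<sigma> v"
  using bounded unfolding bounded_operator_def by blast+

lemma hnorm_L: "\<sigma> \<in> C.S \<Longrightarrow> v \<in> carrier H \<Longrightarrow> hnorm H (L \<sigma> v) \<le> operator_norm H (L \<sigma>) * hnorm H v"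
  using bounded H.hnorm_le_operator_norm by blast

lemma norm_nonneg: "\<sigma> \<in> C.S \<Longrightarrow> 0 \<le> operator_norm H (L \<sigma>)"
  using bounded H.operator_norm_nonneg by blast

lemma L_star':
  assumes "\<sigma> \<in> C.S" "u \<in> carrier H" "v \<in> carrier H"
  shows "ip H (L \<sigma> u) v = ip H u (L (section_star K C \<sigma>) v)"
proof -
  have "ip H (L \<sigma> u) v = cnj (ip H v (L \<sigma> u))" using assms by (intro H.ip_cnj L_closed)
  also have "\<dots> = cnj (ip H (L (section_star K C \<sigma>) v) u)" using assms by (simp add: L_star)
  also have "\<dots> = ip H u (L (section_star K C \<sigma>) v)"
    using assms by (intro H.ip_cnj[symmetric] L_closed C.section_star_closed)
  finally show ?thesis .
qed

text \<open>The bound by the norm of the fibre is the bound by the \<open>l1_norm\<close>, evaluated at a section with one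
  value.\<close>

lemma bundle_representation_delta: "bundle_representation K C H (\<lambda>b. L (section_delta K C b))"
proof (intro bundle_representation.intro bundle_representation_axioms.intro)
  fix b v assume b: "b \<in> total C" and v: "v \<in> carrier H"
  note d = C.section_delta_closed[OF b]
  have "hnorm H (L (section_delta K C b) v) \<le> operator_norm H (L (section_delta K C b)) * hnorm H v"
    by (rule hnorm_L[OF d v])
  also have "\<dots> \<le> bnorm C b * hnorm H v"
    using operator_norm_le_l1[OF d] v by (intro mult_right_mono) (auto simp: C.l1_norm_delta[OF b])
  finally show "hnorm H (L (section_delta K C b) v) \<le> bnorm C b * hnorm H v" .
qed (auto simp: L_closed L_vector_add L_vector_scale C.section_delta_closed L_add L_scale L_mult L_star
    C.delta_add[symmetric] C.delta_scale[symmetric] C.delta_mult[symmetric] C.delta_star[symmetric]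
    C.fell_bundle_axioms H.hilbert_space_axioms)

text \<open>Every section is the sum of the sections supported at the points of its support, so a
  representation is determined by its values on these.\<close>

lemma L_decompose:
  assumes \<sigma>: "\<sigma> \<in> C.S" and v: "v \<in> carrier H"
  shows "L \<sigma> v = finsum H (\<lambda>k. L (section_delta K C (\<sigma> k)) v) (C.supp \<sigma>)"
proof -
  interpret D: bundle_representation K C H "\<lambda>b. L (section_delta K C b)"
    by (rule bundle_representation_delta)
  have "L \<sigma> v = finsum H (\<lambda>k. L (section_delta K C (\<sigma> k)) v) F"
    if "finite F" "F \<subseteq> carrier K" "\<sigma> \<in> C.S" "C.supp \<sigma> \<subseteq> F" for F \<sigma>
    using that
  proof (induction F arbitrary: \<sigma>)
    case empty
    then have "\<sigma> k = section_scale K C 0 \<sigma> k" for k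
      by (cases "k \<in> carrier K")
        (auto simp: section_scale_def C.notin_supp extensional_arb[OF C.sectionD(3)])
    then have "L \<sigma> v = L (section_scale K C 0 \<sigma>) v"
      by (intro arg_cong[where f = "\<lambda>\<sigma>. L \<sigma> v"] ext)
    then have "L \<sigma> v = 0 \<odot>\<^bsub>H\<^esub> L \<sigma> v" unfolding L_scale[OF empty(2) v] .
    then show ?case using H.smult_l_null[of "L \<sigma> v"] L_closed[OF empty(2) v] by simp
  next
    case (insert a F)
    define \<tau> where "\<tau> = (\<lambda>k\<in>carrier K. if k = a then bzero C a else \<sigma> k)"
    note s = C.sectionD[OF insert.prems(2)]
    have a: "a \<in> carrier K" using insert by blast
    have \<tau>: "\<tau> \<in> C.S"
      using s(1,2,4) C.notin_supp[of _ \<sigma>] unfolding \<tau>_def by (intro C.sectionI[of _ "C.supp \<sigma>"]) auto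
    have "C.supp \<tau> \<subseteq> F" using insert.prems(3) unfolding \<tau>_def section_support_def by auto
    then have IH: "L \<tau> v = finsum H (\<lambda>k. L (section_delta K C (\<tau> k)) v) F"
      using insert.IH insert.prems \<tau> by simp
    have "\<sigma> = section_add K C (section_delta K C (\<sigma> a)) \<tau>"
    proof (rule extensionalityI[of _ "carrier K"])
      fix k assume k: "k \<in> carrier K"
      show "\<sigma> k = section_add K C (section_delta K C (\<sigma> a)) \<tau> k"
        using s(1,2)[OF a] s(1,2)[OF k] k C.badd_bzero[of "\<sigma> a"] C.badd_bzero[of "\<sigma> k"]
        unfolding section_add_def section_delta_def \<tau>_def by auto
    qed (use s(3) in \<open>auto simp: section_add_def\<close>)
    then have "L \<sigma> v = L (section_delta K C (\<sigma> a)) v \<oplus>\<^bsub>H\<^esub> L \<tau> v"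
      using L_add[OF C.section_delta_closed[OF s(1)[OF a]] \<tau> v] by simp
    also have "L \<tau> v = finsum H (\<lambda>k. L (section_delta K C (\<sigma> k)) v) F"
      unfolding IH
    proof (rule H.M.finsum_cong')
      show "(\<lambda>k. L (section_delta K C (\<sigma> k)) v) \<in> F \<rightarrow> carrier H"
        using insert.prems by (intro D.summand_closed v) auto
      show "L (section_delta K C (\<tau> k)) v = L (section_delta K C (\<sigma> k)) v" if "k \<in> F" for k
        using that insert unfolding \<tau>_def by auto
    qed simp
    also have "L (section_delta K C (\<sigma> a)) v \<oplus>\<^bsub>H\<^esub> finsum H (\<lambda>k. L (section_delta K C (\<sigma> k)) v) F
        = finsum H (\<lambda>k. L (section_delta K C (\<sigma> k)) v) (insert a F)"
      using insert D.summand_closed[OF insert.prems(2) v] D.rep_closed[OF s(1)[OF a] v]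
      by (intro H.M.finsum_insert[symmetric]) auto
    finally show ?case .
  qed
  then show ?thesis using \<sigma> C.sectionD(4,5)[OF \<sigma>] by blast
qed

end

section \<open>The universal norm\<close>

context section_representation
begin

text \<open>The double orthogonal complement is the closure of the set of cyclic vectors. In this form it is
  visibly a closed subspace, and invariant because the adjoint of \<open>L \<sigma>\<close> preserves the orthogonal
  complement of the cyclic vectors.\<close>

definition cyclic_vectors :: "'v \<Rightarrow> 'v set" where
  "cyclic_vectors \<xi> = {L \<tau> \<xi> | \<tau>. \<tau> \<in> C.S}"

definition cyclic_subspace :: "'v \<Rightarrow> 'v set" where
  "cyclic_subspace \<xi> = H.orth (H.orth (cyclic_vectors \<xi>))"

lemma cyclic_vectors_in: "\<xi> \<in> carrier H \<Longrightarrow> cyclic_vectors \<xi> \<subseteq> carrier H"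
  unfolding cyclic_vectors_def using L_closed by blast

lemma cyclic_vectors_subset: "\<xi> \<in> carrier H \<Longrightarrow> cyclic_vectors \<xi> \<subseteq> cyclic_subspace \<xi>"
proof
  fix v assume \<xi>: "\<xi> \<in> carrier H" and v: "v \<in> cyclic_vectors \<xi>"
  have "ip H v w = 0" if "w \<in> H.orth (cyclic_vectors \<xi>)" for w
  proof -
    have w: "w \<in> carrier H" "ip H w v = 0" using that v unfolding H.orth_def by auto
    then show ?thesis using H.ip_cnj[of v w] v cyclic_vectors_in[OF \<xi>] by auto
  qed
  then show "v \<in> cyclic_subspace \<xi>"
    using v cyclic_vectors_in[OF \<xi>] unfolding cyclic_subspace_def H.orth_def by auto
qed

lemma cyclic_subspace_invariant:
  assumes \<xi>: "\<xi> \<in> carrier H" and \<sigma>: "\<sigma> \<in> C.S" and v: "v \<in> cyclic_subspace \<xi>"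
  shows "L \<sigma> v \<in> cyclic_subspace \<xi>"
proof -
  have vH: "v \<in> carrier H" using v unfolding cyclic_subspace_def H.orth_def by auto
  have "ip H (L \<sigma> v) w = 0" if w: "w \<in> H.orth (cyclic_vectors \<xi>)" for w
  proof -
    have wH: "w \<in> carrier H" using w unfolding H.orth_def by auto
    note star = C.section_star_closed[OF \<sigma>]
    have "ip H (L (section_star K C \<sigma>) w) (L \<tau> \<xi>) = 0" if \<tau>: "\<tau> \<in> C.S" for \<tau>
    proof -
      have "ip H (L (section_star K C \<sigma>) w) (L \<tau> \<xi>) = ip H w (L (section_mult K C \<sigma> \<tau>) \<xi>)"
        using \<sigma> \<tau> wH \<xi> by (simp add: L_star L_mult L_closed)
      also have "\<dots> = 0"
        using w C.section_mult_closed(1)[OF \<sigma> \<tau>] unfolding H.orth_def cyclic_vectors_def by blast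
      finally show ?thesis .
    qed
    then have "L (section_star K C \<sigma>) w \<in> H.orth (cyclic_vectors \<xi>)"
      using L_closed[OF star wH] unfolding H.orth_def cyclic_vectors_def by auto
    then have "ip H v (L (section_star K C \<sigma>) w) = 0"
      using v unfolding cyclic_subspace_def H.orth_def by auto
    then show ?thesis using L_star'[OF \<sigma> vH wH] by simp
  qed
  then show ?thesis
    using L_closed[OF \<sigma> vH] unfolding cyclic_subspace_def H.orth_def by auto
qed

text \<open>A vector of the cyclic subspace whose coefficient function vanishes is orthogonal to all cyclic
  vectors, hence to itself. So the coefficient functions separate the vectors of the subspace.\<close>

definition coefficient :: "'v \<Rightarrow> 'v \<Rightarrow> ('x \<Rightarrow> 'b) \<Rightarrow> complex" where
  "coefficient \<xi> \<eta> = (\<lambda>\<tau>. ip H \<eta> (L \<tau> \<xi>))"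

lemma subspace_transport_cyclic:
  assumes \<xi>: "\<xi> \<in> carrier H"
  shows "subspace_transport H (cyclic_subspace \<xi>) (coefficient \<xi>)"
proof (intro subspace_transport.intro subspace_transport_axioms.intro)
  have "H.orth (cyclic_vectors \<xi>) \<subseteq> carrier H" unfolding H.orth_def by auto
  then show closed: "H.closed_subspace (cyclic_subspace \<xi>)"
    unfolding cyclic_subspace_def by (rule H.closed_subspace_orth)
  show "inj_on (coefficient \<xi>) (cyclic_subspace \<xi>)"
  proof (rule inj_onI)
    fix u v assume u: "u \<in> cyclic_subspace \<xi>" and v: "v \<in> cyclic_subspace \<xi>"
      and eq: "coefficient \<xi> u = coefficient \<xi> v"
    have uH: "u \<in> carrier H" "v \<in> carrier H"
      using u v unfolding cyclic_subspace_def H.orth_def by auto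
    have d: "u \<oplus>\<^bsub>H\<^esub> (-1) \<odot>\<^bsub>H\<^esub> v \<in> cyclic_subspace \<xi>"
      using u v closed unfolding H.closed_subspace_def by blast
    then have d: "u \<ominus>\<^bsub>H\<^esub> v \<in> cyclic_subspace \<xi>"
      using complex_module_minus(2)[OF H.module_axioms uH] by simp
    have "ip H (u \<ominus>\<^bsub>H\<^esub> v) (L \<tau> \<xi>) = 0" if "\<tau> \<in> C.S" for \<tau>
      using fun_cong[OF eq, of \<tau>] that \<xi> uH unfolding coefficient_def
      by (simp add: H.ip_minus_left L_closed)
    then have "u \<ominus>\<^bsub>H\<^esub> v \<in> H.orth (cyclic_vectors \<xi>)"
      using uH unfolding H.orth_def cyclic_vectors_def by auto
    then have "ip H (u \<ominus>\<^bsub>H\<^esub> v) (u \<ominus>\<^bsub>H\<^esub> v) = 0"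
      using d unfolding cyclic_subspace_def H.orth_def[of "H.orth (cyclic_vectors \<xi>)"] by blast
    then have "u \<ominus>\<^bsub>H\<^esub> v = \<zero>\<^bsub>H\<^esub>" using uH by (intro H.ip_definite) auto
    moreover have "u = (u \<ominus>\<^bsub>H\<^esub> v) \<oplus>\<^bsub>H\<^esub> v"
      using uH by (simp add: a_minus_def H.M.a_assoc H.M.l_neg)
    ultimately show "u = v" using uH(2) by simp
  qed
qed (rule H.hilbert_space_axioms)

lemma cyclic_representation:
  fixes \<xi> :: 'v
  assumes \<xi>: "\<xi> \<in> carrier H"
  defines "M \<equiv> cyclic_subspace \<xi>" and "j \<equiv> coefficient \<xi>"
  defines "T \<equiv> transported_space H M j" and "L' \<equiv> \<lambda>\<sigma> a. j (L \<sigma> (the_inv_into M j a))"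
  shows "hilbert_space T" and "section_rep K C T L'"
    and "\<And>\<sigma> v. \<sigma> \<in> C.S \<Longrightarrow> v \<in> M \<Longrightarrow> hnorm H (L \<sigma> v) \<le> operator_norm T (L' \<sigma>) * hnorm H v"
proof -
  interpret T: subspace_transport H M j
    unfolding M_def j_def by (rule subspace_transport_cyclic[OF \<xi>])
  show hT: "hilbert_space T" unfolding T_def by (rule T.transported_hilbert_space)
  interpret HT: hilbert_space T by (rule hT)
  have inv: "L \<sigma> v \<in> M" if "\<sigma> \<in> C.S" "v \<in> M" for \<sigma> v
    using that cyclic_subspace_invariant[OF \<xi>] unfolding M_def by blast
  have L': "L' \<sigma> (j v) = j (L \<sigma> v)" if "v \<in> M" for \<sigma> v using that unfolding L'_def by simp
  note simps = T.transported_simps[folded T_def]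
  have bound: "hnorm T (L' \<sigma> a) \<le> operator_norm H (L \<sigma>) * hnorm T a"
    if "\<sigma> \<in> C.S" "a \<in> carrier T" for \<sigma> a
    using that hnorm_L by (auto simp: simps L' inv)
  have bdd: "bounded_operator T (L' \<sigma>)" if \<sigma>: "\<sigma> \<in> C.S" for \<sigma>
    unfolding bounded_operator_def
  proof (intro conjI)
    show "\<exists>B. \<forall>v\<in>carrier T. hnorm T (L' \<sigma> v) \<le> B * hnorm T v" using bound[OF \<sigma>] by blast
  qed (use \<sigma> in \<open>auto simp: simps L' inv L_vector_add L_vector_scale\<close>)
  show "section_rep K C T L'"
    unfolding section_rep_def
  proof (intro conjI ballI allI)
    fix \<sigma> assume \<sigma>: "\<sigma> \<in> C.S"
    show "bounded_operator T (L' \<sigma>)" by (rule bdd[OF \<sigma>])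
    have "operator_norm T (L' \<sigma>) \<le> operator_norm H (L \<sigma>)"
      using bound[OF \<sigma>] by (intro HT.operator_norm_le norm_nonneg \<sigma>)
    then show "operator_norm T (L' \<sigma>) \<le> l1_norm K C \<sigma>" using operator_norm_le_l1[OF \<sigma>] by linarith
  qed (auto simp: simps L' inv L_add L_scale L_mult L_star C.section_star_closed C.section_add_closed
      C.section_scale_closed C.section_mult_closed)
  fix \<sigma> v assume \<sigma>: "\<sigma> \<in> C.S" and v: "v \<in> M"
  show "hnorm H (L \<sigma> v) \<le> operator_norm T (L' \<sigma>) * hnorm H v"
    using HT.hnorm_le_operator_norm[OF bdd[OF \<sigma>], of "j v"] \<sigma> v by (simp add: simps L' inv)
qed

end

text \<open>The zero representation shows that the supremum in the universal norm is over a nonempty set.\<close>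

definition zero_hilbert_space :: "('a \<Rightarrow> complex) hilbert" where
  "zero_hilbert_space = \<lparr>carrier = {\<lambda>_. 0}, mult = undefined, one = undefined, zero = (\<lambda>_. 0),
     add = (\<lambda>_ _ _. 0), smult = (\<lambda>_ _ _. 0), ip = (\<lambda>_ _. 0)\<rparr>"

lemma hilbert_space_zero: "hilbert_space zero_hilbert_space"
proof (rule hilbert_space.intro)
  show m: "Module.module complex_ring zero_hilbert_space"
    by (rule complex_moduleI) (auto simp: zero_hilbert_space_def)
  show "hilbert_space_axioms zero_hilbert_space"
    by (rule hilbert_space_axioms.intro)
      (auto simp: zero_hilbert_space_def hnorm_def)
qed

context fell_bundle
begin

lemma zero_representation: "section_rep K C zero_hilbert_space (\<lambda>_ _ _. 0)"
proof -
  interpret hilbert_space zero_hilbert_space by (rule hilbert_space_zero)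
  have "operator_norm zero_hilbert_space (\<lambda>_ _. 0) \<le> l1_norm K C \<sigma>" if "\<sigma> \<in> S" for \<sigma>
  proof (rule operator_norm_le)
    show "0 \<le> l1_norm K C \<sigma>"
      unfolding l1_norm_def using that by (intro sum_nonneg bnorm_nonneg) (auto dest: sectionD simp: subset_iff)
  qed (auto simp: zero_hilbert_space_def hnorm_def)
  then show ?thesis
    unfolding section_rep_def bounded_operator_def
    by (auto simp: zero_hilbert_space_def hnorm_def)
qed

lemma operator_norm_le_universal_norm_aux:
  fixes H :: "(('x \<Rightarrow> 'b) \<Rightarrow> complex) hilbert"
  assumes "hilbert_space H" "section_rep K C H L" "\<sigma> \<in> S"
  shows "operator_norm H (L \<sigma>) \<le> universal_norm K C \<sigma>"
  unfolding universal_norm_def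
  using assms by (intro cSup_upper bdd_aboveI[of _ "l1_norm K C \<sigma>"]) (auto simp: section_rep_def)

lemma universal_norm_least:
  assumes "\<And>(H :: (('x \<Rightarrow> 'b) \<Rightarrow> complex) hilbert) L.
    section_representation K C H L \<Longrightarrow> operator_norm H (L \<sigma>) \<le> c"
  shows "universal_norm K C \<sigma> \<le> c"
  unfolding universal_norm_def
proof (rule cSup_least)
  show "{operator_norm H (L \<sigma>) | (H :: (('x \<Rightarrow> 'b) \<Rightarrow> complex) hilbert) L.
      hilbert_space H \<and> section_rep K C H L} \<noteq> {}"
    using hilbert_space_zero zero_representation by blast
qed (use assms fell_bundle_axioms in \<open>auto intro: section_representation.intro section_representation_axioms.intro\<close>)

lemma universal_norm_nonneg: "\<sigma> \<in> S \<Longrightarrow> 0 \<le> universal_norm K C \<sigma>"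
proof -
  assume \<sigma>: "\<sigma> \<in> S"
  interpret section_representation K C "zero_hilbert_space :: (('x \<Rightarrow> 'b) \<Rightarrow> complex) hilbert" "\<lambda>_ _ _. 0"
    by (intro section_representation.intro section_representation_axioms.intro fell_bundle_axioms
        hilbert_space_zero zero_representation)
  show ?thesis
    using norm_nonneg[OF \<sigma>]
      operator_norm_le_universal_norm_aux[OF hilbert_space_zero zero_representation \<sigma>] by linarith
qed

end

text \<open>By definition the universal norm only dominates representations on the fixed type, in particular
  the cyclic ones, so it bounds \<open>L \<sigma>\<close> on each cyclic subspace. A vector \<open>\<xi>\<close> need not lie in the cyclic
  subspace that it generates, but \<open>L \<sigma>\<^sup>* \<xi>\<close> does; so the adjoint is bounded everywhere, and then \<open>L \<sigma>\<close>
  itself is.\<close>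

theorem (in section_representation) operator_norm_le_universal_norm:
  assumes \<sigma>: "\<sigma> \<in> C.S" shows "operator_norm H (L \<sigma>) \<le> universal_norm K C \<sigma>"
proof -
  let ?U = "universal_norm K C \<sigma>"
  have U: "0 \<le> ?U" by (rule C.universal_norm_nonneg[OF \<sigma>])
  note star = C.section_star_closed[OF \<sigma>]
  have cyc: "hnorm H (L \<sigma> v) \<le> ?U * hnorm H v" if "\<xi> \<in> carrier H" "v \<in> cyclic_subspace \<xi>" for \<xi> v
  proof -
    have "v \<in> carrier H" using that unfolding cyclic_subspace_def H.orth_def by auto
    then show ?thesis
      using order_trans[OF cyclic_representation(3)[OF that(1) \<sigma> that(2)] mult_right_mono[OF
        C.operator_norm_le_universal_norm_aux[OF cyclic_representation(1,2)[OF that(1)] \<sigma>]]]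
      by simp
  qed
  have star_bound: "hnorm H (L (section_star K C \<sigma>) \<xi>) \<le> ?U * hnorm H \<xi>" if \<xi>: "\<xi> \<in> carrier H" for \<xi>
  proof -
    let ?w = "L (section_star K C \<sigma>) \<xi>"
    have w: "?w \<in> carrier H" "?w \<in> cyclic_subspace \<xi>"
      using L_closed[OF star \<xi>] cyclic_vectors_subset[OF \<xi>] star unfolding cyclic_vectors_def by auto
    show ?thesis
      using cyc[OF \<xi> w(2)] L_star[OF \<sigma> \<xi> w(1)]
      by (intro H.adjoint_bound[OF \<xi> w(1) L_closed[OF \<sigma> w(1)]] U)
  qed
  show ?thesis
  proof (rule H.operator_norm_le[OF U])
    fix \<xi> assume \<xi>: "\<xi> \<in> carrier H"
    let ?w = "L \<sigma> \<xi>"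
    have w: "?w \<in> carrier H" by (rule L_closed[OF \<sigma> \<xi>])
    show "hnorm H ?w \<le> ?U * hnorm H \<xi>"
      using star_bound[OF w] L_star'[OF \<sigma> \<xi> w]
      by (intro H.adjoint_bound[OF \<xi> w L_closed[OF star w]] U)
  qed
qed

lemma (in section_representation) hnorm_L_le:
  assumes "\<sigma> \<in> C.S" "v \<in> carrier H"
  shows "hnorm H (L \<sigma> v) \<le> universal_norm K C \<sigma> * hnorm H v"
  using order_trans[OF hnorm_L[OF assms] mult_right_mono[OF operator_norm_le_universal_norm[OF assms(1)]]]
    assms(2) by simp

context fell_bundle
begin

lemma section_algebra_simps [simp]:
  "carrier (section_algebra K C) = S" "\<sigma> \<oplus>\<^bsub>section_algebra K C\<^esub> \<tau> = section_add K C \<sigma> \<tau>"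
  "\<sigma> \<otimes>\<^bsub>section_algebra K C\<^esub> \<tau> = section_mult K C \<sigma> \<tau>"
  "c \<odot>\<^bsub>section_algebra K C\<^esub> \<sigma> = section_scale K C c \<sigma>"
  "star (section_algebra K C) \<sigma> = section_star K C \<sigma>"
  "nrm (section_algebra K C) = universal_norm K C"
  by (simp_all add: section_algebra_def)

text \<open>Each inequality holds for the operator norm in every representation and passes to the supremum.\<close>

theorem seminormed_section_algebra: "seminormed_star_algebra (section_algebra K C)"
proof (intro seminormed_star_algebra.intro seminormed_space.intro section_algebra_module
    seminormed_space_axioms.intro seminormed_star_algebra_axioms.intro, simp_all)
  fix \<sigma> \<tau> c assume s: "\<sigma> \<in> S"
  show "0 \<le> universal_norm K C \<sigma>" by (rule universal_norm_nonneg[OF s])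
  show "universal_norm K C (section_scale K C c \<sigma>) \<le> cmod c * universal_norm K C \<sigma>"
  proof (rule universal_norm_least)
    fix H :: "(('x \<Rightarrow> 'b) \<Rightarrow> complex) hilbert" and L assume "section_representation K C H L"
    then interpret section_representation K C H L .
    show "operator_norm H (L (section_scale K C c \<sigma>)) \<le> cmod c * universal_norm K C \<sigma>"
    proof (rule H.operator_norm_le)
      fix v assume v: "v \<in> carrier H"
      have "hnorm H (L (section_scale K C c \<sigma>) v) = cmod c * hnorm H (L \<sigma> v)"
        using s v by (simp add: L_scale L_closed H.hnorm_scale)
      also have "\<dots> \<le> cmod c * (universal_norm K C \<sigma> * hnorm H v)"
        using hnorm_L_le[OF s v] by (intro mult_left_mono) auto
      finally show "hnorm H (L (section_scale K C c \<sigma>) v) \<le> cmod c * universal_norm K C \<sigma> * hnorm H v"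
        by (simp add: mult.assoc)
    qed (simp add: universal_norm_nonneg s)
  qed
  show "universal_norm K C (section_star K C \<sigma>) \<le> universal_norm K C \<sigma>"
  proof (rule universal_norm_least)
    fix H :: "(('x \<Rightarrow> 'b) \<Rightarrow> complex) hilbert" and L assume "section_representation K C H L"
    then interpret section_representation K C H L .
    show "operator_norm H (L (section_star K C \<sigma>)) \<le> universal_norm K C \<sigma>"
    proof (rule H.operator_norm_le[OF universal_norm_nonneg[OF s]])
      fix v assume v: "v \<in> carrier H"
      let ?w = "L (section_star K C \<sigma>) v"
      have w: "?w \<in> carrier H" by (rule L_closed[OF section_star_closed[OF s] v])
      show "hnorm H ?w \<le> universal_norm K C \<sigma> * hnorm H v"
        using hnorm_L_le[OF s w] L_star[OF s v w]
        by (intro H.adjoint_bound[OF v w L_closed[OF s w]] universal_norm_nonneg[OF s])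
    qed
  qed
next
  fix \<sigma> \<tau> assume s: "\<sigma> \<in> S" and t: "\<tau> \<in> S"
  show "universal_norm K C (section_add K C \<sigma> \<tau>) \<le> universal_norm K C \<sigma> + universal_norm K C \<tau>"
  proof (rule universal_norm_least)
    fix H :: "(('x \<Rightarrow> 'b) \<Rightarrow> complex) hilbert" and L assume "section_representation K C H L"
    then interpret section_representation K C H L .
    show "operator_norm H (L (section_add K C \<sigma> \<tau>)) \<le> universal_norm K C \<sigma> + universal_norm K C \<tau>"
    proof (rule H.operator_norm_le)
      fix v assume v: "v \<in> carrier H"
      have "hnorm H (L \<sigma> v \<oplus>\<^bsub>H\<^esub> L \<tau> v) \<le> hnorm H (L \<sigma> v) + hnorm H (L \<tau> v)"
        using s t v by (intro H.hnorm_triangle L_closed)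
      moreover have "hnorm H (L \<sigma> v) \<le> universal_norm K C \<sigma> * hnorm H v"
        by (rule hnorm_L_le[OF s v])
      moreover have "hnorm H (L \<tau> v) \<le> universal_norm K C \<tau> * hnorm H v"
        by (rule hnorm_L_le[OF t v])
      ultimately show "hnorm H (L (section_add K C \<sigma> \<tau>) v)
          \<le> (universal_norm K C \<sigma> + universal_norm K C \<tau>) * hnorm H v"
        using s t v by (simp add: L_add distrib_right)
    qed (simp add: universal_norm_nonneg s t)
  qed
  show "universal_norm K C (section_mult K C \<sigma> \<tau>) \<le> universal_norm K C \<sigma> * universal_norm K C \<tau>"
  proof (rule universal_norm_least)
    fix H :: "(('x \<Rightarrow> 'b) \<Rightarrow> complex) hilbert" and L assume "section_representation K C H L"
    then interpret section_representation K C H L .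
    show "operator_norm H (L (section_mult K C \<sigma> \<tau>)) \<le> universal_norm K C \<sigma> * universal_norm K C \<tau>"
    proof (rule H.operator_norm_le)
      fix v assume v: "v \<in> carrier H"
      have "hnorm H (L \<tau> v) \<le> universal_norm K C \<tau> * hnorm H v"
        by (rule hnorm_L_le[OF t v])
      then have "universal_norm K C \<sigma> * hnorm H (L \<tau> v) \<le> universal_norm K C \<sigma> * (universal_norm K C \<tau> * hnorm H v)"
        by (rule mult_left_mono) (rule universal_norm_nonneg[OF s])
      moreover have "hnorm H (L \<sigma> (L \<tau> v)) \<le> universal_norm K C \<sigma> * hnorm H (L \<tau> v)"
        by (rule hnorm_L_le[OF s L_closed[OF t v]])
      ultimately show "hnorm H (L (section_mult K C \<sigma> \<tau>) v)
          \<le> universal_norm K C \<sigma> * universal_norm K C \<tau> * hnorm H v"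
        using s t v by (simp add: L_mult mult.assoc)
    qed (simp add: universal_norm_nonneg s t)
  qed
qed (simp_all add: section_mult_closed section_star_closed section_mult_add_left section_mult_add_right
    section_star_add)

end

section \<open>The Zappa-Szep product and the product bundle\<close>

context matched_pair
begin

declare act_closed [simp] res_closed [simp]

text \<open>\<open>h\<close> maps the unit to an idempotent of the group.\<close>

lemma act_unit [simp]: "h \<in> carrier \<Lambda> \<Longrightarrow> act h \<one>\<^bsub>\<Gamma>\<^esub> = \<one>\<^bsub>\<Gamma>\<^esub>"
  using act_of_mult[of h "\<one>\<^bsub>\<Gamma>\<^esub>" "\<one>\<^bsub>\<Gamma>\<^esub>"] by (simp add: res_one)

lemma res_unit [simp]: "x \<in> carrier \<Gamma> \<Longrightarrow> res \<one>\<^bsub>\<Lambda>\<^esub> x = \<one>\<^bsub>\<Lambda>\<^esub>"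
  using res_of_mult[of "\<one>\<^bsub>\<Lambda>\<^esub>" "\<one>\<^bsub>\<Lambda>\<^esub>" x] by (simp add: act_one)

lemma act_inv_act [simp]:
  "h \<in> carrier \<Lambda> \<Longrightarrow> x \<in> carrier \<Gamma> \<Longrightarrow> act (inv\<^bsub>\<Lambda>\<^esub> h) (act h x) = x"
  using act_mult[of "inv\<^bsub>\<Lambda>\<^esub> h" h x] by (simp add: act_one)

lemma res_res_inv [simp]:
  "h \<in> carrier \<Lambda> \<Longrightarrow> x \<in> carrier \<Gamma> \<Longrightarrow> res (res h x) (inv\<^bsub>\<Gamma>\<^esub> x) = h"
  "h \<in> carrier \<Lambda> \<Longrightarrow> x \<in> carrier \<Gamma> \<Longrightarrow> res (res h (inv\<^bsub>\<Gamma>\<^esub> x)) x = h"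
  using res_mult[of h x "inv\<^bsub>\<Gamma>\<^esub> x"] res_mult[of h "inv\<^bsub>\<Gamma>\<^esub> x" x] by (simp_all add: res_one)

lemma inv_res: "h \<in> carrier \<Lambda> \<Longrightarrow> x \<in> carrier \<Gamma> \<Longrightarrow> inv\<^bsub>\<Lambda>\<^esub> (res h x) = res (inv\<^bsub>\<Lambda>\<^esub> h) (act h x)"
  using res_of_mult[of "inv\<^bsub>\<Lambda>\<^esub> h" h x] by (intro L.inv_equality) auto

abbreviation "Z \<equiv> zappa_szep \<Gamma> \<Lambda> act res"

lemma zappa_szep_simps [simp]:
  "carrier Z = carrier \<Gamma> \<times> carrier \<Lambda>" "\<one>\<^bsub>Z\<^esub> = (\<one>\<^bsub>\<Gamma>\<^esub>, \<one>\<^bsub>\<Lambda>\<^esub>)"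
  "(x, h) \<otimes>\<^bsub>Z\<^esub> (y, g) = (x \<otimes>\<^bsub>\<Gamma>\<^esub> act h y, res h y \<otimes>\<^bsub>\<Lambda>\<^esub> g)"
  by (simp_all add: zappa_szep_def)

lemma zappa_szep_l_inv:
  "x \<in> carrier \<Gamma> \<Longrightarrow> h \<in> carrier \<Lambda> \<Longrightarrow>
    (act (inv\<^bsub>\<Lambda>\<^esub> h) (inv\<^bsub>\<Gamma>\<^esub> x), res (inv\<^bsub>\<Lambda>\<^esub> h) (inv\<^bsub>\<Gamma>\<^esub> x)) \<otimes>\<^bsub>Z\<^esub> (x, h) = \<one>\<^bsub>Z\<^esub>"
  using act_of_mult[of "inv\<^bsub>\<Lambda>\<^esub> h" "inv\<^bsub>\<Gamma>\<^esub> x" x] by simp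

lemma zappa_szep_group: "group Z"
proof (rule groupI)
  fix a assume a: "a \<in> carrier Z"
  then obtain x h where xh: "a = (x, h)" "x \<in> carrier \<Gamma>" "h \<in> carrier \<Lambda>" by auto
  then show "\<one>\<^bsub>Z\<^esub> \<otimes>\<^bsub>Z\<^esub> a = a" by (simp add: act_one)
  show "\<exists>b\<in>carrier Z. b \<otimes>\<^bsub>Z\<^esub> a = \<one>\<^bsub>Z\<^esub>"
    unfolding xh(1) using zappa_szep_l_inv[OF xh(2,3)] xh(2,3)
    by (intro bexI[of _ "(act (inv\<^bsub>\<Lambda>\<^esub> h) (inv\<^bsub>\<Gamma>\<^esub> x), res (inv\<^bsub>\<Lambda>\<^esub> h) (inv\<^bsub>\<Gamma>\<^esub> x))"]) auto
next
  fix a b c assume "a \<in> carrier Z" "b \<in> carrier Z" "c \<in> carrier Z"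
  then show "a \<otimes>\<^bsub>Z\<^esub> b \<otimes>\<^bsub>Z\<^esub> c = a \<otimes>\<^bsub>Z\<^esub> (b \<otimes>\<^bsub>Z\<^esub> c)"
    by (auto simp: act_mult act_of_mult res_mult res_of_mult G.m_assoc L.m_assoc)
qed auto

sublocale Z: group Z
  by (rule zappa_szep_group)

lemma zappa_szep_inv:
  assumes "x \<in> carrier \<Gamma>" "h \<in> carrier \<Lambda>"
  shows "inv\<^bsub>Z\<^esub> (x, h) = (act (inv\<^bsub>\<Lambda>\<^esub> h) (inv\<^bsub>\<Gamma>\<^esub> x), res (inv\<^bsub>\<Lambda>\<^esub> h) (inv\<^bsub>\<Gamma>\<^esub> x))"
  by (rule Z.inv_equality[OF zappa_szep_l_inv[OF assms]]) (use assms in auto)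

end

context fell_bundle
begin

lemma fibre_seminormed_space: "x \<in> carrier K \<Longrightarrow> seminormed_space (fibre C x) (bnorm C)"
  using banach_fibre[of x]
  by (intro seminormed_space.intro seminormed_space_axioms.intro)
    (auto simp: complex_banach_def complex_banach_axioms_def)

lemma topspace_bundle_topology: "topspace (bundle_topology C) = total C"
proof
  show "topspace (bundle_topology C) \<subseteq> total C" unfolding topspace_def openin_bundle_topology by blast
  have "openin (bundle_topology C) (total C)"
    unfolding openin_bundle_topology by (auto intro: exI[of _ 1])
  then show "total C \<subseteq> topspace (bundle_topology C)" by (rule openin_subset)
qed

text \<open>The next two lemmas translate continuity at the zero of the unit fibre into norms.\<close>

lemma openin_unit_ball:
  assumes x: "x \<in> carrier K" shows "openin (bundle_topology C) {b \<in> total C. proj C b = x \<and> bnorm C b < 1}"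
  unfolding openin_bundle_topology
proof (intro conjI ballI)
  interpret seminormed_space "fibre C x" "bnorm C" by (rule fibre_seminormed_space[OF x])
  fix b assume "b \<in> {b \<in> total C. proj C b = x \<and> bnorm C b < 1}"
  then have b: "b \<in> total C" "proj C b = x" "bnorm C b < 1" by auto
  show "\<exists>\<epsilon>>0. \<forall>c\<in>carrier (fibre C (proj C b)). bnorm C (c \<ominus>\<^bsub>fibre C (proj C b)\<^esub> b) < \<epsilon> \<longrightarrow>
      c \<in> {b \<in> total C. proj C b = x \<and> bnorm C b < 1}"
  proof (intro exI[of _ "1 - bnorm C b"] conjI ballI impI)
    fix c assume c: "c \<in> carrier (fibre C (proj C b))"
      and lt: "bnorm C (c \<ominus>\<^bsub>fibre C (proj C b)\<^esub> b) < 1 - bnorm C b"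
    then have "bnorm C c - bnorm C b \<le> bnorm C (c \<ominus>\<^bsub>fibre C x\<^esub> b)"
      using b by (intro seminorm_diff_le) auto
    then show "c \<in> {b \<in> total C. proj C b = x \<and> bnorm C b < 1}" using lt b c by simp
  qed (use b in simp)
qed auto

lemma openin_contains_ball:
  assumes V: "openin (bundle_topology C) V" and x: "x \<in> carrier K" "bzero C x \<in> V"
  obtains e where "0 < e" "\<And>c. c \<in> total C \<Longrightarrow> proj C c = x \<Longrightarrow> bnorm C c < e \<Longrightarrow> c \<in> V"
proof -
  interpret seminormed_space "fibre C x" "bnorm C" by (rule fibre_seminormed_space[OF x(1)])
  obtain e where e: "0 < e" "\<forall>c\<in>carrier (fibre C (proj C (bzero C x))).
      bnorm C (c \<ominus>\<^bsub>fibre C (proj C (bzero C x))\<^esub> bzero C x) < e \<longrightarrow> c \<in> V"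
    using V x(2) unfolding openin_bundle_topology by blast
  have "c \<ominus>\<^bsub>fibre C x\<^esub> bzero C x = c" if "c \<in> total C" "proj C c = x" for c
    using that x(1) complex_module_minus(2)[OF fibre_module[OF x(1)], of c "bzero C x"] M.r_zero[of c] by simp
  then show ?thesis using e x(1) by (intro that[of e]) auto
qed

end

text \<open>If \<open>x\<close> were larger than \<open>y\<close>, the powers of \<open>x / y\<close> would be unbounded by the inequality of
  Bernoulli.\<close>

lemma power_bound_imp_le:
  fixes x y M :: real
  assumes "0 \<le> x" "0 \<le> y" "\<And>n. x ^ (2 ^ n) \<le> M * y ^ (2 ^ n)"
  shows "x \<le> y"
proof (rule ccontr)
  assume "\<not> x \<le> y"
  then have xy: "y < x" by simp
  show False
  proof (cases "y = 0")
    case True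
    then show ?thesis using assms(3)[of 0] xy by simp
  next
    case False
    then have y: "0 < y" using assms(2) by simp
    define r where "r = x / y - 1"
    have r: "0 < r" using xy y unfolding r_def by simp
    have le: "1 + real n * r \<le> M" for n
    proof -
      have "1 + real n * r \<le> 1 + real (2 ^ n) * r"
        using r less_exp[of n] by (intro add_left_mono mult_right_mono) (simp_all only: of_nat_le_iff less_imp_le)
      also have "\<dots> \<le> (1 + r) ^ (2 ^ n)" using Bernoulli_inequality[of r "2 ^ n"] r by simp
      also have "\<dots> = x ^ (2 ^ n) / y ^ (2 ^ n)" unfolding r_def by (simp add: power_divide)
      also have "\<dots> \<le> M" using assms(3)[of n] y by (simp add: divide_le_eq)
      finally show ?thesis .
    qed
    obtain n where "M < real n * r" using r reals_Archimedean3 by blast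
    then show False using le[of n] by linarith
  qed
qed

context compatible_action
begin

declare action_closed [simp] proj_action [simp] proj_closed [simp]

lemma action_inv [simp]:
  "h \<in> carrier \<Lambda> \<Longrightarrow> b \<in> total B \<Longrightarrow> \<beta> (inv\<^bsub>\<Lambda>\<^esub> h) (\<beta> h b) = b"
  "h \<in> carrier \<Lambda> \<Longrightarrow> b \<in> total B \<Longrightarrow> \<beta> h (\<beta> (inv\<^bsub>\<Lambda>\<^esub> h) b) = b"
  using action_mult[of "inv\<^bsub>\<Lambda>\<^esub> h" h b] action_mult[of h "inv\<^bsub>\<Lambda>\<^esub> h" b] by (simp_all add: action_one)

lemma action_bzero [simp]:
  "h \<in> carrier \<Lambda> \<Longrightarrow> x \<in> carrier \<Gamma> \<Longrightarrow> \<beta> h (bzero B x) = bzero B (act h x)"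
  using action_scale[of h "bzero B x" 0] bscale_rules(4)[of "\<beta> h (bzero B x)"] by simp

text \<open>A linear map that is continuous at zero is bounded: if it maps the ball of radius \<open>e\<close> into the
  unit ball, scaling to norm \<open>e / 2\<close> gives the bound \<open>2 / e\<close>.\<close>

lemma action_bounded_on_unit_fibre:
  assumes h: "h \<in> carrier \<Lambda>"
  obtains M where "0 \<le> M" "\<And>b. b \<in> total B \<Longrightarrow> proj B b = \<one>\<^bsub>\<Gamma>\<^esub> \<Longrightarrow> bnorm B (\<beta> h b) \<le> M * bnorm B b"
proof -
  let ?X = "prod_topology (discrete_topology (carrier \<Lambda>)) (bundle_topology B)"
  let ?U = "{b \<in> total B. proj B b = \<one>\<^bsub>\<Gamma>\<^esub> \<and> bnorm B b < 1}"
  have "openin ?X {p \<in> topspace ?X. (case p of (h, b) \<Rightarrow> \<beta> h b) \<in> ?U}"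
    using openin_continuous_map_preimage[OF action_continuous openin_unit_ball] by simp
  moreover have "(h, bzero B \<one>\<^bsub>\<Gamma>\<^esub>) \<in> {p \<in> topspace ?X. (case p of (h, b) \<Rightarrow> \<beta> h b) \<in> ?U}"
    using h by (simp add: topspace_bundle_topology)
  ultimately obtain W V where WV: "h \<in> W" "openin (bundle_topology B) V" "bzero B \<one>\<^bsub>\<Gamma>\<^esub> \<in> V"
    "W \<times> V \<subseteq> {p \<in> topspace ?X. (case p of (h, b) \<Rightarrow> \<beta> h b) \<in> ?U}"
    unfolding openin_prod_topology_alt by meson
  obtain e where e: "0 < e" "\<And>c. c \<in> total B \<Longrightarrow> proj B c = \<one>\<^bsub>\<Gamma>\<^esub> \<Longrightarrow> bnorm B c < e \<Longrightarrow> c \<in> V"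
    using openin_contains_ball[OF WV(2) _ WV(3)] by auto
  have small: "bnorm B (\<beta> h c) < 1" if "c \<in> total B" "proj B c = \<one>\<^bsub>\<Gamma>\<^esub>" "bnorm B c < e" for c
    using e(2)[OF that] WV(1,4) by auto
  interpret seminormed_space "fibre B \<one>\<^bsub>\<Gamma>\<^esub>" "bnorm B" by (rule fibre_seminormed_space) simp
  have scale: "bnorm B (bscale B c b) = cmod c * bnorm B b" if "b \<in> total B" "proj B b = \<one>\<^bsub>\<Gamma>\<^esub>" for b c
    using seminorm_scale[of b c] that by simp
  have "bnorm B (\<beta> h b) \<le> (2 / e) * bnorm B b" if b: "b \<in> total B" "proj B b = \<one>\<^bsub>\<Gamma>\<^esub>" for b
  proof (cases "bnorm B b = 0")
    case True
    then have "b = bzero B \<one>\<^bsub>\<Gamma>\<^esub>"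
      using complex_banach.norm_eq_zero[OF banach_fibre[of "\<one>\<^bsub>\<Gamma>\<^esub>"], of b] b by simp
    then show ?thesis using h by simp
  next
    case False
    then have pos: "0 < bnorm B b" using bnorm_nonneg[OF b(1)] by linarith
    define t where "t = e / (2 * bnorm B b)"
    have t: "0 < t" using e(1) pos unfolding t_def by simp
    have "bnorm B (bscale B (of_real t) b) = e / 2"
      using scale[OF b, of "of_real t"] t pos e(1) unfolding t_def by (simp add: norm_divide norm_mult)
    then have "bnorm B (\<beta> h (bscale B (of_real t) b)) < 1" using small[of "bscale B (of_real t) b"] b e(1) by simp
    moreover have "bnorm B (\<beta> h (bscale B (of_real t) b)) = t * bnorm B (\<beta> h b)"
      using scale[of "\<beta> h b" "of_real t"] t h b by (simp add: action_scale)
    ultimately have "t * bnorm B (\<beta> h b) \<le> 1" by simp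
    then show ?thesis using e(1) pos unfolding t_def by (simp add: field_simps)
  qed
  then show ?thesis using e(1) by (intro that[of "2 / e"]) auto
qed

text \<open>For a self-adjoint \<open>a\<close> the C*-identity says that squaring \<open>a\<close> squares its norm, and the same holds
  for \<open>\<beta> h a\<close>, which is again self-adjoint because \<open>res h\<close> fixes \<open>h\<close> at the unit. Squaring \<open>n\<close> times
  therefore replaces a bound \<open>M\<close> by its root of order \<open>2^n\<close>.\<close>

lemma action_contractive_self_adjoint:
  assumes h: "h \<in> carrier \<Lambda>" and a: "a \<in> total B" "proj B a = \<one>\<^bsub>\<Gamma>\<^esub>" "bstar B a = a"
  shows "bnorm B (\<beta> h a) \<le> bnorm B a"
proof -
  obtain M where M: "\<And>b. b \<in> total B \<Longrightarrow> proj B b = \<one>\<^bsub>\<Gamma>\<^esub> \<Longrightarrow> bnorm B (\<beta> h b) \<le> M * bnorm B b"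
    using action_bounded_on_unit_fibre[OF h] by metis
  define s where "s = (\<lambda>n. ((\<lambda>b. bmul B b b) ^^ n) a)"
  have s: "s n \<in> total B \<and> proj B (s n) = \<one>\<^bsub>\<Gamma>\<^esub> \<and> bstar B (s n) = s n
      \<and> bnorm B (s n) = bnorm B a ^ (2 ^ n) \<and> bnorm B (\<beta> h (s n)) = bnorm B (\<beta> h a) ^ (2 ^ n)" for n
  proof (induction n)
    case 0
    then show ?case using a by (simp add: s_def)
  next
    case (Suc n)
    have Suc_eq: "s (Suc n) = bmul B (s n) (s n)" by (simp add: s_def)
    have norm: "bnorm B (bmul B (s n) (s n)) = bnorm B (s n) ^ 2"
      using norm_star_mul[of "s n"] Suc by simp
    have star: "bstar B (\<beta> h (s n)) = \<beta> h (s n)"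
      using action_bstar[OF h, of "s n"] Suc h by (simp add: res_one)
    have "\<beta> h (s (Suc n)) = bmul B (\<beta> h (s n)) (\<beta> h (s n))"
      unfolding Suc_eq using action_bmul[OF h, of "s n" "s n"] Suc h by (simp add: res_one)
    then have "bnorm B (\<beta> h (s (Suc n))) = bnorm B (\<beta> h (s n)) ^ 2"
      using norm_star_mul[of "\<beta> h (s n)"] Suc h star by simp
    then show ?case
      using Suc norm unfolding Suc_eq by (simp add: star_mul power_mult[symmetric] mult.commute)
  qed
  have "bnorm B (\<beta> h a) ^ (2 ^ n) \<le> M * bnorm B a ^ (2 ^ n)" for n
    using M[of "s n"] s[of n] by simp
  then show ?thesis using a h by (rule_tac power_bound_imp_le[of _ _ M]) auto
qed

lemma action_bstar_mul:
  assumes h: "h \<in> carrier \<Lambda>" and b: "b \<in> total B"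
  shows "bmul B (\<beta> h (bstar B b)) (\<beta> (res h (inv\<^bsub>\<Gamma>\<^esub> (proj B b))) b) = \<beta> h (bmul B (bstar B b) b)"
  using action_bmul[OF h, of "bstar B b" b] b by simp

text \<open>\<open>\<beta> h\<close> does not preserve products, but \<open>(\<beta> h b)\<^sup>* (\<beta> h b) = \<beta> g (b\<^sup>* b)\<close> with \<open>g = res h (proj b)\<close>. So
  the C*-identity reduces the claim to the self-adjoint element \<open>b\<^sup>* b\<close> of the unit fibre.\<close>

lemma action_contractive:
  assumes h: "h \<in> carrier \<Lambda>" and b: "b \<in> total B"
  shows "bnorm B (\<beta> h b) \<le> bnorm B b"
proof -
  let ?g = "res h (proj B b)"
  have g: "?g \<in> carrier \<Lambda>" using h b by simp
  have "(bnorm B (\<beta> h b))\<^sup>2 = bnorm B (bmul B (bstar B (\<beta> h b)) (\<beta> h b))"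
    using norm_star_mul[of "\<beta> h b"] h b by simp
  also have "bmul B (bstar B (\<beta> h b)) (\<beta> h b) = \<beta> ?g (bmul B (bstar B b) b)"
    using action_bstar_mul[OF g b] action_bstar[OF h b] h b by simp
  also have "bnorm B \<dots> \<le> bnorm B (bmul B (bstar B b) b)"
    using b by (intro action_contractive_self_adjoint g) (simp_all add: star_mul star_star)
  also have "\<dots> = (bnorm B b)\<^sup>2" by (rule norm_star_mul[OF b])
  finally show ?thesis using b by (rule_tac power2_le_imp_le) auto
qed

lemma action_isometric: "h \<in> carrier \<Lambda> \<Longrightarrow> b \<in> total B \<Longrightarrow> bnorm B (\<beta> h b) = bnorm B b"
  using action_contractive[of h b] action_contractive[of "inv\<^bsub>\<Lambda>\<^esub> h" "\<beta> h b"] by simp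

abbreviation "P \<equiv> product_bundle \<Gamma> \<Lambda> res B \<beta>"

lemma product_bundle_simps [simp]:
  "total P = total B \<times> carrier \<Lambda>" "proj P (b, h) = (proj B b, h)" "bzero P (x, h) = (bzero B x, h)"
  "badd P (a, g) (b, h) = (badd B a b, g)" "bscale P z (b, h) = (bscale B z b, h)"
  "bnorm P (b, h) = bnorm B b"
  "bmul P (a, g) (b, h) = (bmul B a (\<beta> g b), res g (proj B b) \<otimes>\<^bsub>\<Lambda>\<^esub> h)"
  "bstar P (b, h) = (\<beta> (inv\<^bsub>\<Lambda>\<^esub> h) (bstar B b), res (inv\<^bsub>\<Lambda>\<^esub> h) (inv\<^bsub>\<Gamma>\<^esub> (proj B b)))"
  by (simp_all add: product_bundle_def)

lemma product_fibre_module: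
  assumes x: "x \<in> carrier \<Gamma>" and h: "h \<in> carrier \<Lambda>"
  shows "Module.module complex_ring (fibre P (x, h))"
  by (rule complex_moduleI)
    (use x h in \<open>auto simp: badd_assoc bscale_rules bscale_badd intro: badd_commute[OF _ _ sym]\<close>)

lemma product_fibre_minus:
  assumes x: "x \<in> carrier \<Gamma>" and h: "h \<in> carrier \<Lambda>"
    and ab: "a \<in> total B" "b \<in> total B" "proj B a = x" "proj B b = x"
  shows "(a, h) \<ominus>\<^bsub>fibre P (x, h)\<^esub> (b, h) = (a \<ominus>\<^bsub>fibre B x\<^esub> b, h)"
  using complex_module_minus(2)[OF product_fibre_module[OF x h], of "(a, h)" "(b, h)"]
    complex_module_minus(2)[OF fibre_module[OF x], of a b] assms by simp

lemma product_fibre_banach: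
  assumes x: "x \<in> carrier \<Gamma>" and h: "h \<in> carrier \<Lambda>"
  shows "complex_banach (fibre P (x, h)) (bnorm P)"
proof (rule complex_banach.intro[OF product_fibre_module[OF x h]], rule complex_banach_axioms.intro)
  interpret complex_banach "fibre B x" "bnorm B" by (rule banach_fibre[OF x])
  fix u v c assume u: "u \<in> carrier (fibre P (x, h))"
  then obtain a where a: "u = (a, h)" "a \<in> carrier (fibre B x)" using h by auto
  show "0 \<le> bnorm P u" "bnorm P (c \<odot>\<^bsub>fibre P (x, h)\<^esub> u) = cmod c * bnorm P u"
    "bnorm P u = 0 \<longleftrightarrow> u = \<zero>\<^bsub>fibre P (x, h)\<^esub>"
    using norm_nonneg[OF a(2)] norm_scale[OF a(2), of c] norm_eq_zero[OF a(2)] a(1) by simp_all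
  assume v: "v \<in> carrier (fibre P (x, h))"
  then obtain b where b: "v = (b, h)" "b \<in> carrier (fibre B x)" using h by auto
  show "bnorm P (u \<oplus>\<^bsub>fibre P (x, h)\<^esub> v) \<le> bnorm P u + bnorm P v"
    using norm_triangle[OF a(2) b(2)] a(1) b(1) by simp
next
  interpret complex_banach "fibre B x" "bnorm B" by (rule banach_fibre[OF x])
  fix s assume s: "cauchy_wrt (fibre P (x, h)) (bnorm P) s"
  define t where "t = (\<lambda>n. fst (s n))"
  have car: "s n \<in> carrier (fibre P (x, h))" for n using s unfolding cauchy_wrt_def by blast
  have t: "s n = (t n, h)" "t n \<in> total B" "proj B (t n) = x" for n
    using car[of n] unfolding t_def by (cases "s n", auto)+
  have "cauchy_wrt (fibre B x) (bnorm B) t"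
    using s unfolding cauchy_wrt_def t(1) by (simp add: product_fibre_minus x h t(2,3))
  then obtain v where "v \<in> carrier (fibre B x)" "(\<lambda>n. bnorm B (t n \<ominus>\<^bsub>fibre B x\<^esub> v)) \<longlonglongrightarrow> 0"
    using complete by blast
  then show "\<exists>v\<in>carrier (fibre P (x, h)). (\<lambda>n. bnorm P (s n \<ominus>\<^bsub>fibre P (x, h)\<^esub> v)) \<longlonglongrightarrow> 0"
    unfolding t(1) using h by (intro bexI[of _ "(v, h)"]) (auto simp: product_fibre_minus x h t(2,3))
qed

lemma product_mul_closed:
  assumes "u \<in> total P" "v \<in> total P"
  shows "bmul P u v \<in> total P" "proj P (bmul P u v) = proj P u \<otimes>\<^bsub>Z\<^esub> proj P v"
  using assms by auto

lemma product_star_closed: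
  assumes "u \<in> total P" shows "bstar P u \<in> total P" "proj P (bstar P u) = inv\<^bsub>Z\<^esub> proj P u"
  using assms by (auto simp: zappa_szep_inv)

text \<open>The second entry of an element is determined by the point over which it lies. So in identities
  between products and adjoints it follows from the group laws, and only the first entries have to be
  compared.\<close>

lemma product_eqI:
  "u \<in> total P \<Longrightarrow> v \<in> total P \<Longrightarrow> proj P u = proj P v \<Longrightarrow> fst u = fst v \<Longrightarrow> u = v"
  by auto

lemma product_star_mul_self:
  assumes b: "b \<in> total B" and h: "h \<in> carrier \<Lambda>"
  shows "bmul P (bstar P (b, h)) (b, h) = (\<beta> (inv\<^bsub>\<Lambda>\<^esub> h) (bmul B (bstar B b) b), \<one>\<^bsub>\<Lambda>\<^esub>)"
  using action_bstar_mul[of "inv\<^bsub>\<Lambda>\<^esub> h" b] b h by simp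

text \<open>The norm axioms hold because \<open>\<beta>\<close> is isometric. Positivity holds because \<open>\<beta> h\<close> restricts to a star
  automorphism of the unit fibre and hence preserves elements of the form \<open>c\<^sup>* c\<close>.\<close>

theorem product_fell_bundle: "fell_bundle Z P"
proof (rule fell_bundle.intro[OF zappa_szep_group], rule fell_bundle_axioms.intro)
  show "bmul P (bmul P u v) w = bmul P u (bmul P v w)"
    if "u \<in> total P" "v \<in> total P" "w \<in> total P" for u v w
    using that by (auto simp: action_bmul action_mult mul_assoc res_mult res_of_mult L.m_assoc)
  show "bstar P (bmul P u v) = bmul P (bstar P v) (bstar P u)"
    if uv: "u \<in> total P" "v \<in> total P" for u v
  proof (rule product_eqI)
    obtain a g b h where ab: "u = (a, g)" "v = (b, h)" "a \<in> total B" "g \<in> carrier \<Lambda>"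
      "b \<in> total B" "h \<in> carrier \<Lambda>" using uv by auto
    let ?k = "res g (proj B b)"
    have k: "?k \<in> carrier \<Lambda>" using ab by simp
    have "fst (bstar P (bmul P u v))
        = \<beta> (inv\<^bsub>\<Lambda>\<^esub> (?k \<otimes>\<^bsub>\<Lambda>\<^esub> h)) (bmul B (bstar B (\<beta> g b)) (bstar B a))"
      using ab by (simp add: star_mul)
    also have "\<dots> = \<beta> (inv\<^bsub>\<Lambda>\<^esub> h) (\<beta> (inv\<^bsub>\<Lambda>\<^esub> ?k) (bmul B (\<beta> ?k (bstar B b)) (bstar B a)))"
      using ab k by (simp add: L.inv_mult_group action_mult action_bstar)
    also have "\<beta> (inv\<^bsub>\<Lambda>\<^esub> ?k) (bmul B (\<beta> ?k (bstar B b)) (bstar B a))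
        = bmul B (bstar B b) (\<beta> (inv\<^bsub>\<Lambda>\<^esub> g) (bstar B a))"
    proof -
      have "res (inv\<^bsub>\<Lambda>\<^esub> ?k) (act ?k (inv\<^bsub>\<Gamma>\<^esub> proj B b)) = inv\<^bsub>\<Lambda>\<^esub> g"
        using inv_res[OF k, of "inv\<^bsub>\<Gamma>\<^esub> proj B b"] ab by simp
      then show ?thesis
        using action_bmul[of "inv\<^bsub>\<Lambda>\<^esub> ?k" "\<beta> ?k (bstar B b)" "bstar B a"] ab k by simp
    qed
    also have "\<beta> (inv\<^bsub>\<Lambda>\<^esub> h) \<dots> = fst (bmul P (bstar P v) (bstar P u))"
      using ab by (simp add: action_bmul)
    finally show "fst (bstar P (bmul P u v)) = fst (bmul P (bstar P v) (bstar P u))" .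
    show "proj P (bstar P (bmul P u v)) = proj P (bmul P (bstar P v) (bstar P u))"
      using uv product_mul_closed product_star_closed Z.inv_mult_group[of "proj P u" "proj P v"] ab
      by (simp del: product_bundle_simps zappa_szep_simps(3)) auto
  qed (use uv product_mul_closed product_star_closed in blast)+
  show "bstar P (bstar P u) = u" if u: "u \<in> total P" for u
  proof (rule product_eqI)
    obtain b h where b: "u = (b, h)" "b \<in> total B" "h \<in> carrier \<Lambda>" using u by auto
    then show "fst (bstar P (bstar P u)) = fst u" by (simp add: action_bstar star_star)
    show "proj P (bstar P (bstar P u)) = proj P u"
      using product_star_closed u product_star_closed[OF product_star_closed(1)[OF u]] b
      by (simp del: product_bundle_simps(7,8))
  qed (use u product_star_closed in blast)+
  show "unit_fibre_pos Z P (bmul P (bstar P u) u)" if u: "u \<in> total P" for u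
  proof -
    obtain b h where b: "u = (b, h)" "b \<in> total B" "h \<in> carrier \<Lambda>" using u by auto
    obtain c where c: "c \<in> total B" "proj B c = \<one>\<^bsub>\<Gamma>\<^esub>" "bmul B (bstar B b) b = bmul B (bstar B c) c"
      using star_mul_pos[OF b(2)] unfolding unit_fibre_pos_def by auto
    let ?d = "\<beta> (inv\<^bsub>\<Lambda>\<^esub> h) c"
    have "bmul B (bstar B ?d) ?d = \<beta> (inv\<^bsub>\<Lambda>\<^esub> h) (bmul B (bstar B c) c)"
      using action_bstar[of "inv\<^bsub>\<Lambda>\<^esub> h" c] action_bstar_mul[of "inv\<^bsub>\<Lambda>\<^esub> h" c] b c by (simp add: res_one)
    then have "bmul P (bstar P u) u = bmul P (bstar P (?d, \<one>\<^bsub>\<Lambda>\<^esub>)) (?d, \<one>\<^bsub>\<Lambda>\<^esub>)"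
      using b c unfolding b(1) product_star_mul_self[OF b(2,3)] by (simp add: action_one)
    then show ?thesis
      unfolding unit_fibre_pos_def using b c by (intro bexI[of _ "(?d, \<one>\<^bsub>\<Lambda>\<^esub>)"]) auto
  qed
  show "bnorm P (bmul P u v) \<le> bnorm P u * bnorm P v"
    if uv: "u \<in> total P" "v \<in> total P" for u v
  proof -
    obtain a g b h where ab: "u = (a, g)" "v = (b, h)" "a \<in> total B" "g \<in> carrier \<Lambda>"
      "b \<in> total B" "h \<in> carrier \<Lambda>" using uv by auto
    then show ?thesis using norm_mul[of a "\<beta> g b"] by (simp add: action_isometric)
  qed
  show "bnorm P (bmul P (bstar P u) u) = (bnorm P u)\<^sup>2" if u: "u \<in> total P" for u
  proof -
    obtain b h where b: "u = (b, h)" "b \<in> total B" "h \<in> carrier \<Lambda>" using u by auto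
    then show ?thesis unfolding b(1) product_star_mul_self[OF b(2,3)] by (simp add: action_isometric norm_star_mul)
  qed
  show "complex_banach (fibre P k) (bnorm P)" if "k \<in> carrier Z" for k
    using that product_fibre_banach by auto
qed (auto simp: mul_add_left mul_add_right mul_scale_left mul_scale_right action_add action_scale
    star_add star_scale action_isometric norm_star zappa_szep_inv)

sublocale P: fell_bundle Z P
  by (rule product_fell_bundle)

end

section \<open>The embedding of sections\<close>

context compatible_action
begin

abbreviation "E \<equiv> section_embedding \<Gamma> \<Lambda> B"

lemma embedding_apply:
  "x \<in> carrier \<Gamma> \<Longrightarrow> h \<in> carrier \<Lambda> \<Longrightarrow>
    E \<sigma> (x, h) = (if h = \<one>\<^bsub>\<Lambda>\<^esub> then \<sigma> x else bzero B x, h)"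
  unfolding section_embedding_def by simp

lemma embedding_extensional: "E \<sigma> \<in> extensional (carrier Z)"
  unfolding section_embedding_def by simp

lemma embedding_eqI:
  assumes "\<tau> \<in> extensional (carrier Z)"
    and "\<And>x h. x \<in> carrier \<Gamma> \<Longrightarrow> h \<in> carrier \<Lambda> \<Longrightarrow>
      \<tau> (x, h) = (if h = \<one>\<^bsub>\<Lambda>\<^esub> then \<sigma> x else bzero B x, h)"
  shows "E \<sigma> = \<tau>"
  using assms embedding_extensional by (intro extensionalityI[of _ "carrier Z"]) (auto simp: embedding_apply)

text \<open>Over \<open>(x, h)\<close> with \<open>h \<noteq> e\<close> the embedded section has the value zero, so only the points \<open>(x, e)\<close>
  contribute to norms and convolutions.\<close>

lemma supp_embedding: "P.supp (E \<sigma>) = (\<lambda>x. (x, \<one>\<^bsub>\<Lambda>\<^esub>)) ` supp \<sigma>"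
  unfolding section_support_def by (auto simp: embedding_apply split: if_splits)

lemma embedding_closed: "\<sigma> \<in> S \<Longrightarrow> E \<sigma> \<in> P.S"
proof (rule P.sectionI)
  assume \<sigma>: "\<sigma> \<in> S"
  show "finite ((\<lambda>x. (x, \<one>\<^bsub>\<Lambda>\<^esub>)) ` supp \<sigma>)" using sectionD(4)[OF \<sigma>] by simp
  fix k assume "k \<in> carrier Z"
  then obtain x h where k: "k = (x, h)" "x \<in> carrier \<Gamma>" "h \<in> carrier \<Lambda>" by auto
  then show "E \<sigma> k \<in> total P" "proj P (E \<sigma> k) = k"
    using \<sigma> by (auto simp: embedding_apply sectionD)
  show "E \<sigma> k = bzero P k" if "k \<notin> (\<lambda>x. (x, \<one>\<^bsub>\<Lambda>\<^esub>)) ` supp \<sigma>"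
    using P.notin_supp[of k "E \<sigma>"] that k by (simp add: supp_embedding)
qed (rule embedding_extensional)

lemma embedding_add: "E (section_add \<Gamma> B \<sigma> \<tau>) = section_add Z P (E \<sigma>) (E \<tau>)"
proof (rule embedding_eqI)
  fix x h assume "x \<in> carrier \<Gamma>" "h \<in> carrier \<Lambda>"
  then show "section_add Z P (E \<sigma>) (E \<tau>) (x, h)
      = (if h = \<one>\<^bsub>\<Lambda>\<^esub> then section_add \<Gamma> B \<sigma> \<tau> x else bzero B x, h)"
    using badd_bzero(1)[of "bzero B x"] by (simp add: section_add_def embedding_apply)
qed (simp add: section_add_def)

lemma embedding_scale: "E (section_scale \<Gamma> B z \<sigma>) = section_scale Z P z (E \<sigma>)"
  by (rule embedding_eqI) (auto simp: section_scale_def embedding_apply)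

lemma embedding_star:
  assumes \<sigma>: "\<sigma> \<in> S" shows "E (section_star \<Gamma> B \<sigma>) = section_star Z P (E \<sigma>)"
proof (rule embedding_eqI)
  fix x h assume x: "x \<in> carrier \<Gamma>" and h: "h \<in> carrier \<Lambda>"
  show "section_star Z P (E \<sigma>) (x, h)
      = (if h = \<one>\<^bsub>\<Lambda>\<^esub> then section_star \<Gamma> B \<sigma> x else bzero B x, h)"
  proof (cases "h = \<one>\<^bsub>\<Lambda>\<^esub>")
    case True
    then show ?thesis
      using x \<sigma> by (simp add: section_star_def zappa_szep_inv act_one embedding_apply action_one sectionD)
  next
    case False
    let ?h = "res (inv\<^bsub>\<Lambda>\<^esub> h) (inv\<^bsub>\<Gamma>\<^esub> x)"
    have "?h \<noteq> \<one>\<^bsub>\<Lambda>\<^esub>"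
    proof
      assume "?h = \<one>\<^bsub>\<Lambda>\<^esub>"
      then have "inv\<^bsub>\<Lambda>\<^esub> h = \<one>\<^bsub>\<Lambda>\<^esub>" using res_res_inv(2)[of "inv\<^bsub>\<Lambda>\<^esub> h" x] x h by simp
      then show False using False h by (metis L.inv_inv L.inv_one)
    qed
    then have "E \<sigma> (inv\<^bsub>Z\<^esub> (x, h)) = bzero P (inv\<^bsub>Z\<^esub> (x, h))"
      using x h by (simp add: zappa_szep_inv embedding_apply)
    moreover have "bstar P (bzero P (inv\<^bsub>Z\<^esub> (x, h))) = bzero P (x, h)"
      using P.bstar_bzero[of "inv\<^bsub>Z\<^esub> (x, h)"] Z.inv_closed[of "(x, h)"] Z.inv_inv[of "(x, h)"] x h
      by (simp del: product_bundle_simps)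
    ultimately show ?thesis using False x h by (simp add: section_star_def del: product_bundle_simps(8))
  qed
qed (simp add: section_star_def)

text \<open>A point \<open>l = (y, e)\<close> of the support satisfies \<open>l\<^sup>-\<^sup>1 (x, h) = (y\<^sup>-\<^sup>1 x, h)\<close>, so all second factors in the
  convolution at \<open>(x, h)\<close> lie over the same \<open>h\<close>. The auxiliary section \<open>\<tau>'\<close> is \<open>\<tau>\<close> for \<open>h = e\<close> and zero
  otherwise, which treats both cases by one sum in the fibre over \<open>x\<close>.\<close>

lemma embedding_mult:
  assumes \<sigma>: "\<sigma> \<in> S" and \<tau>: "\<tau> \<in> S"
  shows "E (section_mult \<Gamma> B \<sigma> \<tau>) = section_mult Z P (E \<sigma>) (E \<tau>)"
proof (rule embedding_eqI)
  fix x h assume x: "x \<in> carrier \<Gamma>" and h: "h \<in> carrier \<Lambda>"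
  define \<tau>' where "\<tau>' = (\<lambda>y. if h = \<one>\<^bsub>\<Lambda>\<^esub> then \<tau> y else bzero B y)"
  have \<tau>': "\<tau>' y \<in> total B" "proj B (\<tau>' y) = y" if "y \<in> carrier \<Gamma>" for y
    using that \<tau> unfolding \<tau>'_def by (simp_all add: sectionD)
  let ?f = "\<lambda>l. bmul P (E \<sigma> l) (E \<tau> (inv\<^bsub>Z\<^esub> l \<otimes>\<^bsub>Z\<^esub> (x, h)))"
  let ?s = "\<lambda>y. bmul B (\<sigma> y) (\<tau>' (inv\<^bsub>\<Gamma>\<^esub> y \<otimes>\<^bsub>\<Gamma>\<^esub> x))"
  interpret X: abelian_monoid "fibre B x" by (rule fibre_abelian_monoid[OF x])
  interpret XH: abelian_monoid "fibre P (x, h)" using x h by (intro P.fibre_abelian_monoid) simp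
  have f: "?f (y, \<one>\<^bsub>\<Lambda>\<^esub>) = (?s y, h)" "?s y \<in> total B" "proj B (?s y) = x" if "y \<in> carrier \<Gamma>" for y
    using that x h \<sigma> \<tau>' unfolding \<tau>'_def
    by (simp_all add: zappa_szep_inv act_one embedding_apply action_one sectionD G.m_assoc[symmetric])
  have sub: "supp \<sigma> \<subseteq> carrier \<Gamma>" by (rule sectionD(5)[OF \<sigma>])
  have "section_mult Z P (E \<sigma>) (E \<tau>) (x, h) = finsum (fibre P (x, h)) ?f ((\<lambda>y. (y, \<one>\<^bsub>\<Lambda>\<^esub>)) ` supp \<sigma>)"
    using x h by (simp add: section_mult_def supp_embedding)
  also have "\<dots> = finsum (fibre P (x, h)) (\<lambda>y. ?f (y, \<one>\<^bsub>\<Lambda>\<^esub>)) (supp \<sigma>)"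
    using sub h f by (intro XH.finsum_reindex) (auto simp: inj_on_def)
  also have "\<dots> = finsum (fibre P (x, h)) (\<lambda>y. (?s y, h)) (supp \<sigma>)"
    using sub h f by (intro XH.finsum_cong') auto
  also have "\<dots> = (finsum (fibre B x) ?s (supp \<sigma>), h)"
    using sub h x f sectionD(4)[OF \<sigma>]
    by (intro finsum_additive[where f = "\<lambda>b. (b, h)", symmetric] X.abelian_monoid_axioms XH.abelian_monoid_axioms)
      auto
  also have "finsum (fibre B x) ?s (supp \<sigma>)
      = (if h = \<one>\<^bsub>\<Lambda>\<^esub> then section_mult \<Gamma> B \<sigma> \<tau> x else bzero B x)"
  proof (cases "h = \<one>\<^bsub>\<Lambda>\<^esub>")
    case True
    then show ?thesis using x unfolding section_mult_def \<tau>'_def by simp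
  next
    case False
    have zero: "?s y = bzero B x" if "y \<in> carrier \<Gamma>" for y
      using False that x \<sigma> unfolding \<tau>'_def by (simp add: sectionD G.m_assoc[symmetric])
    have "finsum (fibre B x) ?s {} = finsum (fibre B x) ?s (supp \<sigma>)"
      by (rule X.finsum_superset) (use sub zero x sectionD(4)[OF \<sigma>] in \<open>auto simp: subset_iff\<close>)
    then show ?thesis using False by simp
  qed
  finally show "section_mult Z P (E \<sigma>) (E \<tau>) (x, h)
      = (if h = \<one>\<^bsub>\<Lambda>\<^esub> then section_mult \<Gamma> B \<sigma> \<tau> x else bzero B x, h)" .
qed (simp add: section_mult_def)

lemma l1_norm_embedding: "\<sigma> \<in> S \<Longrightarrow> l1_norm Z P (E \<sigma>) = l1_norm \<Gamma> B \<sigma>"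
proof -
  assume \<sigma>: "\<sigma> \<in> S"
  have "l1_norm Z P (E \<sigma>) = (\<Sum>x\<in>supp \<sigma>. bnorm P (E \<sigma> (x, \<one>\<^bsub>\<Lambda>\<^esub>)))"
    unfolding l1_norm_def supp_embedding by (intro sum.reindex_cong[of "\<lambda>x. (x, \<one>\<^bsub>\<Lambda>\<^esub>)"]) (auto simp: inj_on_def)
  also have "\<dots> = l1_norm \<Gamma> B \<sigma>"
    unfolding l1_norm_def using sectionD(5)[OF \<sigma>] by (intro sum.cong) (auto simp: embedding_apply)
  finally show ?thesis .
qed

text \<open>The bound by the \<open>l1_norm\<close> survives because the embedding preserves that norm.\<close>

lemma section_rep_comp_embedding:
  assumes "section_representation Z P H L" shows "section_representation \<Gamma> B H (\<lambda>\<sigma>. L (E \<sigma>))"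
proof -
  interpret R: section_representation Z P H L by fact
  have "section_rep \<Gamma> B H (\<lambda>\<sigma>. L (E \<sigma>))"
    unfolding section_rep_def
    by (auto simp: R.bounded R.L_add R.L_scale R.L_mult R.L_star embedding_closed embedding_add
        embedding_scale embedding_mult embedding_star l1_norm_embedding[symmetric] R.operator_norm_le_l1)
  then show ?thesis
    by (intro section_representation.intro section_representation_axioms.intro fell_bundle_axioms
        R.H.hilbert_space_axioms)
qed

lemma universal_norm_embedding_le:
  assumes \<sigma>: "\<sigma> \<in> S" shows "universal_norm Z P (E \<sigma>) \<le> universal_norm \<Gamma> B \<sigma>"
proof (rule P.universal_norm_least)
  fix H :: "(('a \<times> 'h \<Rightarrow> 'b \<times> 'h) \<Rightarrow> complex) hilbert" and L
  assume "section_representation Z P H L"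
  then interpret R: section_representation \<Gamma> B H "\<lambda>\<sigma>. L (E \<sigma>)" by (rule section_rep_comp_embedding)
  show "operator_norm H (L (E \<sigma>)) \<le> universal_norm \<Gamma> B \<sigma>"
    by (rule R.operator_norm_le_universal_norm[OF \<sigma>])
qed

end

section \<open>The induced representation\<close>

locale induced_representation =
  compatible_action \<Gamma> \<Lambda> act res B \<beta> + R: bundle_representation \<Gamma> B H \<pi>
  for \<Gamma> :: "('x, 'm) monoid_scheme" and \<Lambda> :: "('h, 'n) monoid_scheme"
    and act :: "'h \<Rightarrow> 'x \<Rightarrow> 'x" and res :: "'h \<Rightarrow> 'x \<Rightarrow> 'h"
    and B :: "('x, 'b) bundle_data" and \<beta> :: "'h \<Rightarrow> 'b \<Rightarrow> 'b"
    and H :: "('v, 'k) hilbert_scheme" and \<pi> :: "'b \<Rightarrow> 'v \<Rightarrow> 'v"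
begin

abbreviation "\<H> \<equiv> l2_space (carrier \<Lambda>) H"

text \<open>The component \<open>m\<close> belongs to the left coset of \<open>\<Gamma>\<close> that contains \<open>(e, m\<^sup>-\<^sup>1)\<close>.\<close>

definition induced :: "'b \<times> 'h \<Rightarrow> ('h \<Rightarrow> 'v) \<Rightarrow> 'h \<Rightarrow> 'v" where
  "induced u \<eta> = (\<lambda>m\<in>carrier \<Lambda>. \<pi> (\<beta> m (fst u)) (\<eta> (res m (proj B (fst u)) \<otimes>\<^bsub>\<Lambda>\<^esub> snd u)))"

text \<open>Left multiplication by an element over \<open>(x, g)\<close> permutes the cosets of \<open>\<Gamma>\<close>; in the labelling by \<open>\<Lambda>\<close>
  this is the permutation below.\<close>

lemma bij_betw_translate:
  assumes x: "x \<in> carrier \<Gamma>" and g: "g \<in> carrier \<Lambda>"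
  shows "bij_betw (\<lambda>m. res m x \<otimes>\<^bsub>\<Lambda>\<^esub> g) (carrier \<Lambda>) (carrier \<Lambda>)"
proof (rule bij_betwI[where g = "\<lambda>n. res (n \<otimes>\<^bsub>\<Lambda>\<^esub> inv\<^bsub>\<Lambda>\<^esub> g) (inv\<^bsub>\<Gamma>\<^esub> x)"])
  show "res (res m x \<otimes>\<^bsub>\<Lambda>\<^esub> g \<otimes>\<^bsub>\<Lambda>\<^esub> inv\<^bsub>\<Lambda>\<^esub> g) (inv\<^bsub>\<Gamma>\<^esub> x) = m" if "m \<in> carrier \<Lambda>" for m
    using that x g by (simp add: L.m_assoc)
  show "res (res (n \<otimes>\<^bsub>\<Lambda>\<^esub> inv\<^bsub>\<Lambda>\<^esub> g) (inv\<^bsub>\<Gamma>\<^esub> x)) x \<otimes>\<^bsub>\<Lambda>\<^esub> g = n" if "n \<in> carrier \<Lambda>" for n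
    using that x g by (simp add: L.m_assoc)
qed (use x g in auto)

text \<open>An induced operator permutes the components and applies to each an operator of norm at most that
  of \<open>b\<close>.\<close>

lemma induced_bound:
  assumes b: "b \<in> total B" and g: "g \<in> carrier \<Lambda>" and \<eta>: "\<eta> \<in> carrier \<H>"
  shows "induced (b, g) \<eta> \<in> carrier \<H>" "hnorm \<H> (induced (b, g) \<eta>) \<le> bnorm B b * hnorm \<H> \<eta>"
proof -
  interpret HL: hilbert_space \<H> by (rule R.H.l2_hilbert_space)
  let ?\<theta> = "\<lambda>m. res m (proj B b) \<otimes>\<^bsub>\<Lambda>\<^esub> g"
  have \<theta>: "?\<theta> m \<in> carrier \<Lambda>" if "m \<in> carrier \<Lambda>" for m using that b g by simp
  note \<eta>H = R.H.l2_carrierD(1)[OF \<eta>]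
  have sum: "(\<Sum>m\<in>F. (hnorm H (induced (b, g) \<eta> m))\<^sup>2) \<le> (bnorm B b * hnorm \<H> \<eta>)\<^sup>2"
    if F: "finite F" "F \<subseteq> carrier \<Lambda>" for F
  proof -
    have inj: "inj_on ?\<theta> F"
      using bij_betw_imp_inj_on[OF bij_betw_translate] b g F(2) by (meson inj_on_subset proj_closed)
    have "(hnorm H (induced (b, g) \<eta> m))\<^sup>2 \<le> (bnorm B b)\<^sup>2 * (hnorm H (\<eta> (?\<theta> m)))\<^sup>2" if "m \<in> F" for m
    proof -
      have m: "m \<in> carrier \<Lambda>" using F that by blast
      have "hnorm H (induced (b, g) \<eta> m) \<le> bnorm B b * hnorm H (\<eta> (?\<theta> m))"
        using R.rep_norm[of "\<beta> m b" "\<eta> (?\<theta> m)"] m b \<theta>[OF m] \<eta>H unfolding induced_def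
        by (simp add: action_isometric)
      moreover have "0 \<le> hnorm H (induced (b, g) \<eta> m)"
        using m b \<theta>[OF m] \<eta>H unfolding induced_def by (simp add: R.rep_closed)
      ultimately show ?thesis unfolding power_mult_distrib[symmetric] by (rule power_mono)
    qed
    then have "(\<Sum>m\<in>F. (hnorm H (induced (b, g) \<eta> m))\<^sup>2)
        \<le> (\<Sum>m\<in>F. (bnorm B b)\<^sup>2 * (hnorm H (\<eta> (?\<theta> m)))\<^sup>2)" by (rule sum_mono)
    also have "\<dots> = (bnorm B b)\<^sup>2 * (\<Sum>n\<in>?\<theta> ` F. (hnorm H (\<eta> n))\<^sup>2)"
      by (simp add: sum.reindex[OF inj] sum_distrib_left)
    also have "\<dots> \<le> (bnorm B b)\<^sup>2 * (hnorm \<H> \<eta>)\<^sup>2"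
      using F \<theta> by (intro mult_left_mono R.H.l2_sum_le[OF \<eta>]) auto
    finally show ?thesis by (simp add: power_mult_distrib)
  qed
  have cl: "induced (b, g) \<eta> m \<in> carrier H" if "m \<in> carrier \<Lambda>" for m
    using that \<theta>[OF that] b \<eta>H unfolding induced_def by (simp add: R.rep_closed)
  have ext: "induced (b, g) \<eta> \<in> extensional (carrier \<Lambda>)" unfolding induced_def by simp
  have nonneg: "0 \<le> bnorm B b * hnorm \<H> \<eta>" using b \<eta> by simp
  show "induced (b, g) \<eta> \<in> carrier \<H>" "hnorm \<H> (induced (b, g) \<eta>) \<le> bnorm B b * hnorm \<H> \<eta>"
    using R.H.l2_bounded[OF cl ext nonneg sum] by blast+
qed

text \<open>Substitute \<open>n = res m x g\<close> in the sum of the left-hand side. Then \<open>n g\<^sup>-\<^sup>1 = res m x\<close>, so the operator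
  coming from the adjoint of \<open>(b, g)\<close> is that of \<open>(\<beta> m b)\<^sup>*\<close>, and the inverse permutation returns to
  \<open>m\<close>.\<close>

lemma induced_star:
  assumes b: "b \<in> total B" and g: "g \<in> carrier \<Lambda>" and \<eta>: "\<eta> \<in> carrier \<H>" and \<zeta>: "\<zeta> \<in> carrier \<H>"
  shows "ip \<H> (induced (bstar P (b, g)) \<eta>) \<zeta> = ip \<H> \<eta> (induced (b, g) \<zeta>)"
proof -
  let ?x = "proj B b"
  let ?\<theta> = "\<lambda>m. res m ?x \<otimes>\<^bsub>\<Lambda>\<^esub> g"
  let ?f = "\<lambda>n. ip H (induced (bstar P (b, g)) \<eta> n) (\<zeta> n)"
  have "ip \<H> (induced (bstar P (b, g)) \<eta>) \<zeta> = (\<Sum>\<^sub>\<infinity>m\<in>carrier \<Lambda>. ?f (?\<theta> m))"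
    using infsum_reindex_bij_betw[OF bij_betw_translate[of ?x g], of ?f] b g by simp
  also have "\<dots> = (\<Sum>\<^sub>\<infinity>m\<in>carrier \<Lambda>. ip H (\<eta> m) (induced (b, g) \<zeta> m))"
  proof (rule infsum_cong)
    fix m assume m: "m \<in> carrier \<Lambda>"
    have \<theta>: "?\<theta> m \<in> carrier \<Lambda>" using m b g by simp
    have "\<beta> (?\<theta> m) (\<beta> (inv\<^bsub>\<Lambda>\<^esub> g) (bstar B b)) = \<beta> (?\<theta> m \<otimes>\<^bsub>\<Lambda>\<^esub> inv\<^bsub>\<Lambda>\<^esub> g) (bstar B b)"
      using action_mult[of "?\<theta> m" "inv\<^bsub>\<Lambda>\<^esub> g" "bstar B b"] \<theta> b g by simp
    also have "\<dots> = bstar B (\<beta> m b)" using m b g by (simp add: action_bstar L.m_assoc)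
    finally have 1: "\<beta> (?\<theta> m) (\<beta> (inv\<^bsub>\<Lambda>\<^esub> g) (bstar B b)) = bstar B (\<beta> m b)" .
    have "res (?\<theta> m) (act (inv\<^bsub>\<Lambda>\<^esub> g) (inv\<^bsub>\<Gamma>\<^esub> ?x)) \<otimes>\<^bsub>\<Lambda>\<^esub> res (inv\<^bsub>\<Lambda>\<^esub> g) (inv\<^bsub>\<Gamma>\<^esub> ?x)
        = res (?\<theta> m \<otimes>\<^bsub>\<Lambda>\<^esub> inv\<^bsub>\<Lambda>\<^esub> g) (inv\<^bsub>\<Gamma>\<^esub> ?x)"
      using res_of_mult[of "?\<theta> m" "inv\<^bsub>\<Lambda>\<^esub> g" "inv\<^bsub>\<Gamma>\<^esub> ?x"] \<theta> b g by simp
    also have "\<dots> = m" using m b g by (simp add: L.m_assoc)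
    finally have 2: "res (?\<theta> m) (act (inv\<^bsub>\<Lambda>\<^esub> g) (inv\<^bsub>\<Gamma>\<^esub> ?x)) \<otimes>\<^bsub>\<Lambda>\<^esub> res (inv\<^bsub>\<Lambda>\<^esub> g) (inv\<^bsub>\<Gamma>\<^esub> ?x) = m" .
    have "?f (?\<theta> m) = ip H (\<pi> (bstar B (\<beta> m b)) (\<eta> m)) (\<zeta> (?\<theta> m))"
      using \<theta> b g 1 2 unfolding induced_def by simp
    also have "\<dots> = ip H (\<eta> m) (\<pi> (\<beta> m b) (\<zeta> (?\<theta> m)))"
      using m b \<theta> R.H.l2_carrierD(1)[OF \<eta>] R.H.l2_carrierD(1)[OF \<zeta>] by (intro R.rep_star) auto
    finally show "?f (?\<theta> m) = ip H (\<eta> m) (induced (b, g) \<zeta> m)" using m unfolding induced_def by simp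
  qed
  finally show ?thesis by simp
qed

theorem induced_bundle_representation: "bundle_representation Z P \<H> induced"
proof (intro bundle_representation.intro bundle_representation_axioms.intro product_fell_bundle
    R.H.l2_hilbert_space)
  fix u v \<eta> \<zeta> c assume u: "u \<in> total P" and \<eta>: "\<eta> \<in> carrier \<H>"
  obtain b g where b: "u = (b, g)" "b \<in> total B" "g \<in> carrier \<Lambda>" using u by auto
  note \<eta>H = R.H.l2_carrierD(1)[OF \<eta>]
  show "induced u \<eta> \<in> carrier \<H>" "hnorm \<H> (induced u \<eta>) \<le> bnorm P u * hnorm \<H> \<eta>"
    using induced_bound[OF b(2,3) \<eta>] unfolding b(1) by simp_all
  show "induced u (c \<odot>\<^bsub>\<H>\<^esub> \<eta>) = c \<odot>\<^bsub>\<H>\<^esub> induced u \<eta>"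
    unfolding b(1) l2_simps induced_def using b \<eta>H by (intro restrict_ext) (simp add: R.rep_vector_scale)
  show "induced (bscale P c u) \<eta> = c \<odot>\<^bsub>\<H>\<^esub> induced u \<eta>"
    unfolding b(1) l2_simps induced_def using b \<eta>H
    by (intro restrict_ext) (simp add: action_scale R.rep_scale)
  show "induced u (\<eta> \<oplus>\<^bsub>\<H>\<^esub> \<zeta>) = induced u \<eta> \<oplus>\<^bsub>\<H>\<^esub> induced u \<zeta>" if \<zeta>: "\<zeta> \<in> carrier \<H>"
    unfolding b(1) l2_simps induced_def using b \<eta>H R.H.l2_carrierD(1)[OF \<zeta>]
    by (intro restrict_ext) (simp add: R.rep_vector_add)
  show "ip \<H> (induced (bstar P u) \<eta>) \<zeta> = ip \<H> \<eta> (induced u \<zeta>)" if "\<zeta> \<in> carrier \<H>"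
    unfolding b(1) by (rule induced_star[OF b(2,3) \<eta> that])
  assume v: "v \<in> total P"
  obtain a f where a: "v = (a, f)" "a \<in> total B" "f \<in> carrier \<Lambda>" using v by auto
  show "induced (badd P u v) \<eta> = induced u \<eta> \<oplus>\<^bsub>\<H>\<^esub> induced v \<eta>" if "proj P u = proj P v"
    using that a b \<eta>H unfolding a(1) b(1) l2_simps induced_def
    by (intro restrict_ext) (simp add: action_add R.rep_add)
  show "induced (bmul P u v) \<eta> = induced u (induced v \<eta>)"
    unfolding a(1) b(1) induced_def using a b \<eta>H
    by (intro restrict_ext)
      (simp add: action_bmul action_mult R.rep_mul res_mult res_of_mult L.m_assoc)
qed

sublocale I: bundle_representation Z P \<H> induced
  by (rule induced_bundle_representation)

definition base_vector :: "'v \<Rightarrow> 'h \<Rightarrow> 'v" where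
  "base_vector \<xi> = (\<lambda>m\<in>carrier \<Lambda>. if m = \<one>\<^bsub>\<Lambda>\<^esub> then \<xi> else \<zero>\<^bsub>H\<^esub>)"

lemma base_vector_closed:
  assumes \<xi>: "\<xi> \<in> carrier H"
  shows "base_vector \<xi> \<in> carrier \<H>" "hnorm \<H> (base_vector \<xi>) \<le> hnorm H \<xi>"
proof -
  have "(\<Sum>m\<in>F. (hnorm H (base_vector \<xi> m))\<^sup>2) \<le> (hnorm H \<xi>)\<^sup>2" if F: "finite F" "F \<subseteq> carrier \<Lambda>" for F
  proof -
    \<comment> \<open>The set \<open>F\<close> may or may not contain the unit.\<close>
    have "(\<Sum>m\<in>F. (hnorm H (base_vector \<xi> m))\<^sup>2) \<le> (\<Sum>m\<in>F. if m = \<one>\<^bsub>\<Lambda>\<^esub> then (hnorm H \<xi>)\<^sup>2 else 0)"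
      using F by (intro sum_mono) (auto simp: base_vector_def)
    also have "\<dots> \<le> (hnorm H \<xi>)\<^sup>2" using F by (simp add: sum.delta)
    finally show ?thesis .
  qed
  then show "base_vector \<xi> \<in> carrier \<H>" "hnorm \<H> (base_vector \<xi>) \<le> hnorm H \<xi>"
    using \<xi> R.H.l2_bounded[of "carrier \<Lambda>" "base_vector \<xi>" "hnorm H \<xi>"] by (auto simp: base_vector_def)
qed

text \<open>At the component \<open>e\<close>, an element over \<open>(x, e)\<close> reads the component \<open>res e x e = e\<close> of the vector,
  and \<open>\<beta> e\<close> is the identity.\<close>

lemma integrated_embedding_base:
  assumes \<sigma>: "\<sigma> \<in> S" and \<xi>: "\<xi> \<in> carrier H"
  shows "I.integrated (E \<sigma>) (base_vector \<xi>) \<one>\<^bsub>\<Lambda>\<^esub> = R.integrated \<sigma> \<xi>"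
proof -
  note \<eta> = base_vector_closed(1)[OF \<xi>]
  have summand: "(\<lambda>k. induced (E \<sigma> k) (base_vector \<xi>)) \<in> P.supp (E \<sigma>) \<rightarrow> carrier \<H>"
    by (intro I.summand_closed embedding_closed \<sigma> \<eta> P.sectionD(5))
  have "I.integrated (E \<sigma>) (base_vector \<xi>) \<one>\<^bsub>\<Lambda>\<^esub>
      = finsum H (\<lambda>k. induced (E \<sigma> k) (base_vector \<xi>) \<one>\<^bsub>\<Lambda>\<^esub>) (P.supp (E \<sigma>))"
    unfolding I.integrated_def
    by (rule finsum_additive[where f = "\<lambda>\<eta>. \<eta> \<one>\<^bsub>\<Lambda>\<^esub>", OF I.H.M.abelian_monoid_axioms
          R.H.M.abelian_monoid_axioms P.sectionD(4)[OF embedding_closed[OF \<sigma>]] summand])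
      (auto simp: R.H.l2_carrierD)
  also have "\<dots> = finsum H (\<lambda>x. induced (E \<sigma> (x, \<one>\<^bsub>\<Lambda>\<^esub>)) (base_vector \<xi>) \<one>\<^bsub>\<Lambda>\<^esub>) (supp \<sigma>)"
    unfolding supp_embedding using summand unfolding supp_embedding
    by (intro R.H.M.finsum_reindex) (auto simp: inj_on_def Pi_iff R.H.l2_carrierD)
  also have "\<dots> = finsum H (\<lambda>x. \<pi> (\<sigma> x) \<xi>) (supp \<sigma>)"
    using \<sigma> \<xi> sectionD(5)[OF \<sigma>]
    by (intro R.H.M.finsum_cong' R.summand_closed)
      (auto simp: induced_def embedding_apply base_vector_def action_one sectionD subset_iff)
  finally show ?thesis unfolding R.integrated_def .
qed

lemma hnorm_integrated_le:
  assumes \<sigma>: "\<sigma> \<in> S" and \<xi>: "\<xi> \<in> carrier H"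
  shows "hnorm H (R.integrated \<sigma> \<xi>) \<le> universal_norm Z P (E \<sigma>) * hnorm H \<xi>"
proof -
  interpret J: section_representation Z P \<H> I.integrated
    by (intro section_representation.intro section_representation_axioms.intro product_fell_bundle
        R.H.l2_hilbert_space I.section_rep_integrated)
  note e = embedding_closed[OF \<sigma>] and \<eta> = base_vector_closed[OF \<xi>]
  have "hnorm H (R.integrated \<sigma> \<xi>) \<le> hnorm \<H> (I.integrated (E \<sigma>) (base_vector \<xi>))"
    using R.H.l2_component_le[OF I.integrated_closed[OF e \<eta>(1)], of "\<one>\<^bsub>\<Lambda>\<^esub>"]
      integrated_embedding_base[OF assms] by simp
  also have "\<dots> \<le> universal_norm Z P (E \<sigma>) * hnorm \<H> (base_vector \<xi>)" by (rule J.hnorm_L_le[OF e \<eta>(1)])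
  also have "\<dots> \<le> universal_norm Z P (E \<sigma>) * hnorm H \<xi>"
    using \<eta>(2) P.universal_norm_nonneg[OF e] by (rule mult_left_mono)
  finally show ?thesis .
qed

end

section \<open>The canonical map\<close>

context compatible_action
begin

theorem universal_norm_embedding:
  assumes \<sigma>: "\<sigma> \<in> S" shows "universal_norm Z P (E \<sigma>) = universal_norm \<Gamma> B \<sigma>"
proof (rule antisym[OF universal_norm_embedding_le[OF \<sigma>]])
  show "universal_norm \<Gamma> B \<sigma> \<le> universal_norm Z P (E \<sigma>)"
  proof (rule universal_norm_least)
    fix H :: "(('a \<Rightarrow> 'b) \<Rightarrow> complex) hilbert" and L assume "section_representation \<Gamma> B H L"
    then interpret T: section_representation \<Gamma> B H L .
    interpret induced_representation \<Gamma> \<Lambda> act res B \<beta> H "\<lambda>b. L (section_delta \<Gamma> B b)"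
      by (intro induced_representation.intro compatible_action_axioms T.bundle_representation_delta)
    show "operator_norm H (L \<sigma>) \<le> universal_norm Z P (E \<sigma>)"
    proof (rule T.H.operator_norm_le[OF P.universal_norm_nonneg[OF embedding_closed[OF \<sigma>]]])
      fix \<xi> assume \<xi>: "\<xi> \<in> carrier H"
      show "hnorm H (L \<sigma> \<xi>) \<le> universal_norm Z P (E \<sigma>) * hnorm H \<xi>"
        using hnorm_integrated_le[OF \<sigma> \<xi>] unfolding R.integrated_def T.L_decompose[OF \<sigma> \<xi>] .
    qed
  qed
qed

theorem isometric_section_embedding:
  "isometric_star_hom (section_algebra \<Gamma> B) (section_algebra Z P) E"
  by (intro isometric_star_hom.intro isometric_star_hom_axioms.intro seminormed_section_algebra
      P.seminormed_section_algebra)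
    (auto simp: star_hom_def embedding_closed embedding_add embedding_scale embedding_mult
      embedding_star universal_norm_embedding)

end

theorem theorem6p6:
  fixes \<Gamma> :: "('x, 'm) monoid_scheme" and \<Lambda> :: "('h, 'n) monoid_scheme"
    and act :: "'h \<Rightarrow> 'x \<Rightarrow> 'x" and res :: "'h \<Rightarrow> 'x \<Rightarrow> 'h"
    and B :: "('x, 'b) bundle_data" and \<beta> :: "'h \<Rightarrow> 'b \<Rightarrow> 'b"
  assumes "matched_pair \<Gamma> \<Lambda> act res"
    and "fell_bundle \<Gamma> B"
    and "unital_unit_fibre \<Gamma> B"
    and "compatible_action \<Gamma> \<Lambda> act res B \<beta>"
  shows "(\<forall>\<sigma>\<in>finite_sections \<Gamma> B.
           canonical_map \<Gamma> \<Lambda> act res B \<beta> (to_completion (section_algebra \<Gamma> B) \<sigma>)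
             = to_completion
                 (section_algebra (zappa_szep \<Gamma> \<Lambda> act res) (product_bundle \<Gamma> \<Lambda> res B \<beta>))
                 (section_embedding \<Gamma> \<Lambda> B \<sigma>))
       \<and> star_hom (Cstar \<Gamma> B)
           (Cstar (zappa_szep \<Gamma> \<Lambda> act res) (product_bundle \<Gamma> \<Lambda> res B \<beta>))
           (canonical_map \<Gamma> \<Lambda> act res B \<beta>)
       \<and> inj_on (canonical_map \<Gamma> \<Lambda> act res B \<beta>) (carrier (Cstar \<Gamma> B))"
proof -
  interpret compatible_action \<Gamma> \<Lambda> act res B \<beta> by fact
  interpret i: isometric_star_hom "section_algebra \<Gamma> B" "section_algebra Z P" E
    by (rule isometric_section_embedding)
  show ?thesis
    unfolding canonical_map_def Cstar_def
    using i.extend_to_completion_eq i.star_hom_extend i.inj_on_extend by simp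
qed

end
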